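(* The Fréchet gradient $\mathcal J'$ of the functional $\mathcal J$ is Lipschitz continuous. More precisely, for all $\mathcal W$ and $\delta\mathcal W$ with $\mathcal W,\ \mathcal W+\delta\mathcal W\in\mathcal U_{\mathrm{ad}}$, $$\left\|\mathcal J'(\mathcal W+\delta\mathcal W)-\mathcal J'(\mathcal W)\right\|_{\mathbb L^2_T}\le L_T\,\|\delta\mathcal W\|_{\mathbb L^2_T},$$ where the Lipschitz constant $L_T>0$ is given by $$L_T=\left[3T^4\left(l+\frac{l+2}{l}\,T^2\right)\right]^{1/2}.$$
   Context: Fix $T>0$, $l>0$. All spaces are real. Let $\mathbb L^2:=L^2(0,l)\times\mathbb R^2$ with $\langle (y,a,b),(z,c,d)\rangle_{\mathbb L^2}=\langle y,z\rangle_{L^2(0,l)}+ac+bd$, and $\mathbb L^2_T:=L^2((0,T)\times(0,l))\times L^2(0,T)$ with $\langle (y,y_1),(z,z_1)\rangle_{\mathbb L^2_T}=\langle y,z\rangle_{L^2((0,T)\times(0,l))}+\langle y_1,z_1\rangle_{L^2(0,T)}$. For $k=1,2$ let $\mathbb H^k:=\{(u,u(0),u(l)) : u\in H^k(0,l)\}$ with the product norm of $H^k(0,l)\times\mathbb R^2$, and let $\mathcal H_{\mathrm{en}}:=\mathbb H^1\times\mathbb L^2$. Direct problem: for fixed initial data $(Y_0,Y_1)=((y_0,a,b),(y_1,c,d))\in\mathcal H_{\mathrm{en}}$ and a source $\mathcal W=(F,G)\in\mathbb L^2_T$, $Y(t,\cdot,\mathcal W)=(y(t,\cdot),y(t,0),y(t,l))$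 denotes the mild solution of $$\begin{cases} y_{tt}-y_{xx}=F(t,x) & \text{in }(0,T)\times(0,l),\\ y_{tt}(t,0)-y_x(t,0)=G(t) & \text{in }(0,T),\\ y_{tt}(t,l)+y_x(t,l)=0 & \text{in }(0,T),\\ (y(0,\cdot),y(0,0),y(0,l))=(y_0,a,b),\quad (y_t(0,\cdot),y_t(0,0),y_t(0,l))=(y_1,c,d).\end{cases}$$ Mild solutions: the operator $\mathcal A=\begin{pmatrix}0&I\\ \mathcal B&0\end{pmatrix}$ with $D(\mathcal A)=\mathbb H^2\times\mathbb H^1$ and $\mathcal B(u,u(0),u(l))=(u_{xx},u_x(0),-u_x(l))$, $D(\mathcal B)=\mathbb H^2$, generates a strongly continuous group $(e^{t\mathcal A})_{t\in\mathbb R}$ on $\mathcal H_{\mathrm{en}}$. The mild solution is given by $(Y(t),Y_t(t))=e^{t\mathcal A}(Y_0,Y_1)+\int_0^t e^{(t-s)\mathcal A}(0,0,0,F(s,\cdot),G(s),0)\,ds$; it satisfies $Y\in C([0,T];\mathbb H^1)\cap C^1([0,T];\mathbb L^2)$. Problems with terminal data at $t=T$ are understood in the same way, using the group backward in time. Admissible set: given real constants $F_*\le F^*$, $G_*\le G^*$, $\mathcal U_{\mathrm{ad}}:=\{(F,G)\in\mathbb L^2_T : F_*\le F(t,x)\le F^* \text{ for a.e. }(t,x),\ G_*\le G(t)\le G^*\text{ for a.e. }t\}$. Cost functional: given a (noisy) datum $Y_T^\delta\in\mathbb L^2$, $\mathcal J(\mathcal W):=\frac12\|Y(T,\cdot,\mathcal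 W)-Y_T^\delta\|_{\mathbb L^2}^2$. Its Fréchet gradient at $\mathcal W$ is $\mathcal J'(\mathcal W)=(\varphi(t,x,\mathcal W),\varphi(t,0,\mathcal W))\in\mathbb L^2_T$, where $(\varphi(t,\cdot,\mathcal W),\varphi(t,0,\mathcal W),\varphi(t,l,\mathcal W))$ is the mild solution of the adjoint system $$\begin{cases}\varphi_{tt}-\varphi_{xx}=0 & \text{in }(0,T)\times(0,l),\\ \varphi_{tt}(t,0)-\varphi_x(t,0)=0,\quad \varphi_{tt}(t,l)+\varphi_x(t,l)=0 & \text{in }(0,T),\\ (\varphi(T,\cdot),\varphi(T,0),\varphi(T,l))=(0,0,0),\\ (\varphi_t(T,\cdot),\varphi_t(T,0),\varphi_t(T,l))=-\left(Y(T,\cdot,\mathcal W)-Y_T^\delta\right).\end{cases}$$ *)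

theory Defs
  imports "HOL-Analysis.Analysis"
begin

text \<open>Elements of \<open>'a L2\<close> are classes of Borel functions on the whole Euclidean space that are square
  integrable and equal almost everywhere. The space \<open>L\<^sup>2(A)\<close> of a Borel set \<open>A\<close> is the closed subspace
  \<open>L2_on A\<close> of classes vanishing outside \<open>A\<close>, i.e. functions on \<open>A\<close> are extended by zero; this
  identification is isometric.\<close>

definition square_integrable :: "('a::euclidean_space \<Rightarrow> real) \<Rightarrow> bool" where
  "square_integrable f \<longleftrightarrow>
     f \<in> borel_measurable lborel \<and> integrable lborel (\<lambda>x. (f x)\<^sup>2)"

lemma square_integrable_mult:
  assumes "square_integrable f" "square_integrable g"
  shows "integrable lborel (\<lambda>x. f x * g x)"
proof (rule Bochner_Integration.integrable_bound)
  show "integrable lborel (\<lambda>x. (f x)\<^sup>2 + (g x)\<^sup>2)"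
    using assms by (auto simp: square_integrable_def)
  show "(\<lambda>x. f x * g x) \<in> borel_measurable lborel"
    using assms by (auto simp: square_integrable_def)
  have "\<bar>a * b\<bar> \<le> a\<^sup>2 + b\<^sup>2" for a b :: real
  proof -
    have "0 \<le> (\<bar>a\<bar> - \<bar>b\<bar>)\<^sup>2" by simp
    then have "2 * (\<bar>a\<bar> * \<bar>b\<bar>) \<le> a\<^sup>2 + b\<^sup>2"
      by (simp add: power2_diff)
    moreover have "0 \<le> \<bar>a\<bar> * \<bar>b\<bar>" by simp
    ultimately show ?thesis unfolding abs_mult by linarith
  qed
  then show "AE x in lborel. norm (f x * g x) \<le> norm ((f x)\<^sup>2 + (g x)\<^sup>2)"
    by (auto simp del: abs_mult)
qed

lemma square_integrable_0: "square_integrable (\<lambda>x. 0)"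
  by (simp add: square_integrable_def)

lemma square_integrable_add:
  assumes "square_integrable f" "square_integrable g"
  shows "square_integrable (\<lambda>x. f x + g x)"
  using assms square_integrable_mult[OF assms]
  by (auto simp: square_integrable_def power2_sum mult.assoc)

lemma square_integrable_scale:
  assumes "square_integrable f"
  shows "square_integrable (\<lambda>x. c * f x)"
  using assms by (auto simp: square_integrable_def power_mult_distrib)

lemma square_integrable_diff:
  assumes "square_integrable f" "square_integrable g"
  shows "square_integrable (\<lambda>x. f x - g x)"
  using square_integrable_add[OF assms(1) square_integrable_scale[OF assms(2), of "-1"]] by simp

lemma square_integrable_bound:
  assumes "square_integrable g" "f \<in> borel_measurable lborel" "\<And>x. \<bar>f x\<bar> \<le> \<bar>g x\<bar>"
  shows "square_integrable f"
  unfolding square_integrable_def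
proof (intro conjI)
  show "integrable lborel (\<lambda>x. (f x)\<^sup>2)"
  proof (rule Bochner_Integration.integrable_bound)
    show "integrable lborel (\<lambda>x. (g x)\<^sup>2)" using assms by (auto simp: square_integrable_def)
    show "(\<lambda>x. (f x)\<^sup>2) \<in> borel_measurable lborel" using assms by auto
    show "AE x in lborel. norm ((f x)\<^sup>2) \<le> norm ((g x)\<^sup>2)"
      using assms(3) by (auto simp: abs_le_square_iff)
  qed
qed (use assms in auto)

lemma square_integrable_indicator:
  assumes "A \<in> sets borel" "emeasure lborel A < \<infinity>"
  shows "square_integrable (indicator A :: 'a::euclidean_space \<Rightarrow> real)"
proof -
  have "(\<lambda>x. (indicator A x :: real)\<^sup>2) = indicator A"
    by (auto simp: indicator_def)
  then show ?thesis
    using assms by (auto simp: square_integrable_def)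
qed

definition L2_eq :: "('a::euclidean_space \<Rightarrow> real) \<Rightarrow> ('a \<Rightarrow> real) \<Rightarrow> bool" where
  "L2_eq f g \<longleftrightarrow> square_integrable f \<and> square_integrable g \<and> (AE x in lborel. f x = g x)"

lemma L2_eq_sym: "L2_eq f g \<Longrightarrow> L2_eq g f"
  by (auto simp: L2_eq_def elim: eventually_mono)

lemma L2_eq_trans: "L2_eq f g \<Longrightarrow> L2_eq g h \<Longrightarrow> L2_eq f h"
  by (auto simp: L2_eq_def elim: eventually_elim2)

typedef (overloaded) ('a::euclidean_space) L2 =
  "{C :: ('a \<Rightarrow> real) set. \<exists>f. square_integrable f \<and> C = Collect (L2_eq f)}"
  using square_integrable_0 by blast

definition abs_L2 :: "('a::euclidean_space \<Rightarrow> real) \<Rightarrow> 'a L2" where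
  "abs_L2 f = Abs_L2 (Collect (L2_eq f))"

definition rep_L2 :: "'a::euclidean_space L2 \<Rightarrow> 'a \<Rightarrow> real" where
  "rep_L2 F = (SOME f. f \<in> Rep_L2 F)"

lemma rep_L2_in_class: "rep_L2 F \<in> Rep_L2 F"
proof -
  obtain f where "square_integrable f" "Rep_L2 F = Collect (L2_eq f)"
    using Rep_L2[of F] by auto
  then have "f \<in> Rep_L2 F" by (simp add: L2_eq_def)
  then show ?thesis unfolding rep_L2_def by (rule someI[where P="\<lambda>f. f \<in> Rep_L2 F"])
qed

lemma Rep_L2_eq: "f \<in> Rep_L2 F \<Longrightarrow> Rep_L2 F = Collect (L2_eq f)"
proof -
  assume f: "f \<in> Rep_L2 F"
  obtain g where "Rep_L2 F = Collect (L2_eq g)"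
    using Rep_L2[of F] by auto
  then show ?thesis using f by (auto intro: L2_eq_sym L2_eq_trans)
qed

lemma rep_L2_refl: "L2_eq (rep_L2 F) (rep_L2 F)"
  using rep_L2_in_class[of F] Rep_L2_eq[OF rep_L2_in_class[of F]] by auto

lemma abs_rep_L2: "abs_L2 (rep_L2 F) = F"
  by (simp add: abs_L2_def Rep_L2_eq[OF rep_L2_in_class, symmetric] Rep_L2_inverse)

lemma rep_abs_L2: "square_integrable f \<Longrightarrow> L2_eq f (rep_L2 (abs_L2 f))"
  using rep_L2_in_class[of "abs_L2 f"] by (simp add: abs_L2_def) (subst (asm) Abs_L2_inverse, auto)

definition cr_L2 :: "('a::euclidean_space \<Rightarrow> real) \<Rightarrow> 'a L2 \<Rightarrow> bool" where
  "cr_L2 = (\<lambda>f F. L2_eq f f \<and> abs_L2 f = F)"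

lemma Quotient_L2: "Quotient L2_eq abs_L2 rep_L2 cr_L2"
proof (rule QuotientI)
  fix f g :: "'a \<Rightarrow> real"
  show "L2_eq f g = (L2_eq f f \<and> L2_eq g g \<and> abs_L2 f = abs_L2 g)"
  proof
    assume fg: "L2_eq f g"
    then have "Collect (L2_eq f) = Collect (L2_eq g)"
      by (auto intro: L2_eq_sym L2_eq_trans)
    then show "L2_eq f f \<and> L2_eq g g \<and> abs_L2 f = abs_L2 g"
      using fg by (auto simp: abs_L2_def intro: L2_eq_sym L2_eq_trans)
  next
    assume "L2_eq f f \<and> L2_eq g g \<and> abs_L2 f = abs_L2 g"
    then show "L2_eq f g"
      using rep_abs_L2[of f] rep_abs_L2[of g] by (auto simp: L2_eq_def elim: eventually_elim2)
  qed
qed (auto simp: abs_rep_L2 rep_L2_refl cr_L2_def)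

setup_lifting Quotient_L2

instantiation L2 :: (euclidean_space) real_inner
begin

lift_definition zero_L2 :: "'a L2" is "\<lambda>x. 0"
  using square_integrable_0 by (auto simp: L2_eq_def)

lift_definition plus_L2 :: "'a L2 \<Rightarrow> 'a L2 \<Rightarrow> 'a L2" is "\<lambda>f g x. f x + g x"
  by (auto simp: L2_eq_def intro: square_integrable_add elim: eventually_elim2)

lift_definition minus_L2 :: "'a L2 \<Rightarrow> 'a L2 \<Rightarrow> 'a L2" is "\<lambda>f g x. f x - g x"
  by (auto simp: L2_eq_def intro: square_integrable_diff elim: eventually_elim2)

lift_definition scaleR_L2 :: "real \<Rightarrow> 'a L2 \<Rightarrow> 'a L2" is "\<lambda>c f x. c * f x"
  by (auto simp: L2_eq_def intro: square_integrable_scale elim: eventually_mono)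

lift_definition uminus_L2 :: "'a L2 \<Rightarrow> 'a L2" is "\<lambda>f x. - f x"
  using square_integrable_scale[where c="-1"] by (auto simp: L2_eq_def elim: eventually_mono)

lift_definition inner_L2 :: "'a L2 \<Rightarrow> 'a L2 \<Rightarrow> real" is "\<lambda>f g. \<integral>x. f x * g x \<partial>lborel"
proof -
  fix f g f' g' :: "'a \<Rightarrow> real"
  assume "L2_eq f g" "L2_eq f' g'"
  note 1 = this[unfolded L2_eq_def]
  show "(\<integral>x. f x * f' x \<partial>lborel) = (\<integral>x. g x * g' x \<partial>lborel)"
  proof (rule integral_cong_AE)
    show "AE x in lborel. f x * f' x = g x * g' x"
      using 1 by (auto elim: eventually_elim2)
  qed (use 1 in \<open>auto simp: square_integrable_def\<close>)
qed

definition norm_L2 :: "'a L2 \<Rightarrow> real" where "norm_L2 f = sqrt (inner f f)"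
definition dist_L2 :: "'a L2 \<Rightarrow> 'a L2 \<Rightarrow> real" where "dist_L2 f g = norm (f - g)"
definition sgn_L2 :: "'a L2 \<Rightarrow> 'a L2" where "sgn_L2 f = inverse (norm f) *\<^sub>R f"
definition uniformity_L2 :: "('a L2 \<times> 'a L2) filter" where
  "uniformity_L2 = (INF e\<in>{0<..}. principal {(x, y). dist x y < e})"
definition open_L2 :: "'a L2 set \<Rightarrow> bool" where
  "open_L2 U = (\<forall>x\<in>U. eventually (\<lambda>(x', y). x' = x \<longrightarrow> y \<in> U) uniformity)"

instance
proof
  fix x y z :: "'a L2" and a b r :: real
  show "x + y + z = x + (y + z)"
    by transfer (auto simp: L2_eq_def algebra_simps intro!: square_integrable_add)
  show "x + y = y + x"
    by transfer (auto simp: L2_eq_def algebra_simps intro!: square_integrable_add)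
  show "0 + x = x" by transfer (auto simp: L2_eq_def)
  show "- x + x = 0"
    by transfer (auto simp: L2_eq_def square_integrable_0)
  show "x - y = x + - y"
    by transfer (auto simp: L2_eq_def intro!: square_integrable_diff)
  show "a *\<^sub>R (x + y) = a *\<^sub>R x + a *\<^sub>R y"
    by transfer (auto simp: L2_eq_def distrib_left intro!: square_integrable_add square_integrable_scale)
  show "(a + b) *\<^sub>R x = a *\<^sub>R x + b *\<^sub>R x"
    by transfer (auto simp: L2_eq_def distrib_right intro!: square_integrable_add square_integrable_scale)
  show "a *\<^sub>R b *\<^sub>R x = (a * b) *\<^sub>R x"
    by transfer (auto simp: L2_eq_def mult.assoc intro: square_integrable_scale)
  show "1 *\<^sub>R x = x" by transfer (auto simp: L2_eq_def)
  show "dist x y = norm (x - y)" by (simp add: dist_L2_def)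
  show "sgn x = inverse (norm x) *\<^sub>R x" by (simp add: sgn_L2_def)
  show "uniformity = (INF e\<in>{0<..}. principal {(x :: 'a L2, y). dist x y < e})"
    by (simp add: uniformity_L2_def)
  show "open U = (\<forall>x\<in>U. \<forall>\<^sub>F (x', y) in uniformity. x' = x \<longrightarrow> y \<in> U)" for U :: "'a L2 set"
    by (simp add: open_L2_def)
  show "inner x y = inner y x" by transfer (simp add: mult.commute)
  show "inner (x + y) z = inner x z + inner y z"
    by transfer (simp add: L2_eq_def distrib_right square_integrable_mult)
  show "inner (r *\<^sub>R x) y = r * inner x y"
    by transfer (simp add: mult.assoc)
  show "0 \<le> inner x x" by transfer simp
  show "(inner x x = 0) = (x = 0)"
  proof transfer
    fix f :: "'a \<Rightarrow> real"
    assume "L2_eq f f"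
    then have f: "square_integrable f" by (simp add: L2_eq_def)
    have "(\<integral>x. f x * f x \<partial>lborel) = 0 \<longleftrightarrow> (AE x in lborel. f x * f x = 0)"
      using f by (intro integral_nonneg_eq_0_iff_AE square_integrable_mult) auto
    then show "((\<integral>x. f x * f x \<partial>lborel) = 0) =
L2_eq f (\<lambda>x. 0)"
      using f square_integrable_0 by (auto simp: L2_eq_def)
  qed
  show "norm x = sqrt (inner x x)" by (simp add: norm_L2_def)
qed

end

lemma rep_L2_square_integrable: "square_integrable (rep_L2 f)"
  using rep_L2_refl by (auto simp: L2_eq_def)

lemma abs_L2_diff:
  "square_integrable f \<Longrightarrow> square_integrable g \<Longrightarrow> abs_L2 f - abs_L2 g = abs_L2 (\<lambda>x. f x - g x)"
  by (simp add: minus_L2.abs_eq L2_eq_def)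

lemma abs_L2_add:
  "square_integrable f \<Longrightarrow> square_integrable g \<Longrightarrow> abs_L2 f + abs_L2 g = abs_L2 (\<lambda>x. f x + g x)"
  by (simp add: plus_L2.abs_eq L2_eq_def)

lemma abs_L2_scale:
  "square_integrable f \<Longrightarrow> c *\<^sub>R abs_L2 f = abs_L2 (\<lambda>x. c * f x)"
  by (simp add: scaleR_L2.abs_eq L2_eq_def)

lemma norm_abs_L2:
  "square_integrable f \<Longrightarrow> norm (abs_L2 f) = sqrt (\<integral>x. (f x)\<^sup>2 \<partial>lborel)"
  by (simp add: norm_L2_def inner_L2.abs_eq L2_eq_def power2_eq_square)

lemma ennreal_norm_abs_L2:
  assumes "square_integrable f"
  shows "(\<integral>\<^sup>+x. ennreal ((f x)\<^sup>2) \<partial>lborel) = ennreal ((norm (abs_L2 f))\<^sup>2)"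
  using assms by (simp add: norm_abs_L2 square_integrable_def nn_integral_eq_integral)

lemma tendsto_abs_L2:
  assumes f: "\<And>n. square_integrable (f n)" and g: "g \<in> borel_measurable lborel"
    and w: "square_integrable w" and bd: "\<And>n x. \<bar>f n x\<bar> \<le> \<bar>w x\<bar>"
    and lim: "\<And>x. (\<lambda>n. f n x) \<longlonglongrightarrow> g x"
  shows "square_integrable g" "(\<lambda>n. abs_L2 (f n)) \<longlonglongrightarrow> abs_L2 g"
proof -
  have bg: "\<bar>g x\<bar> \<le> \<bar>w x\<bar>" for x
    by (rule LIMSEQ_le_const2[OF tendsto_rabs[OF lim]]) (use bd in auto)
  show sg: "square_integrable g" using square_integrable_bound[OF w g bg] .
  have "(\<lambda>n. \<integral>x. (f n x - g x)\<^sup>2 \<partial>lborel) \<longlonglongrightarrow> (\<integral>x. (0::real) \<partial>(lborel :: 'a measure))"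
  proof (rule integral_dominated_convergence[where w="\<lambda>x. (2 * w x)\<^sup>2"])
    show "integrable lborel (\<lambda>x. (2 * w x)\<^sup>2)"
      using square_integrable_scale[OF w, of 2] by (simp add: square_integrable_def)
    show "(\<lambda>x. (f i x - g x)\<^sup>2) \<in> borel_measurable lborel" for i
      using f[of i] g by (auto simp: square_integrable_def)
    show "AE x in lborel. (\<lambda>i. (f i x - g x)\<^sup>2) \<longlonglongrightarrow> 0"
      using lim by (intro AE_I2) (auto intro!: tendsto_eq_intros)
    show "AE x in lborel. norm ((f i x - g x)\<^sup>2) \<le> (2 * w x)\<^sup>2" for i
    proof (intro AE_I2)
      fix x
      have "\<bar>f i x - g x\<bar> \<le> \<bar>2 * w x\<bar>" using bd[of i x] bg[of x] by linarith
      then show "norm ((f i x - g x)\<^sup>2) \<le> (2 * w x)\<^sup>2" by (simp add: abs_le_square_iff)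
    qed
  qed auto
  then have "(\<lambda>n. norm (abs_L2 (f n) - abs_L2 g)) \<longlonglongrightarrow> 0"
    using f sg by (simp add: abs_L2_diff norm_abs_L2 square_integrable_diff real_sqrt_zero
        tendsto_real_sqrt[where x=0, simplified])
  then show "(\<lambda>n. abs_L2 (f n)) \<longlonglongrightarrow> abs_L2 g"
    by (simp add: LIM_zero_cancel tendsto_norm_zero_iff)
qed

lemma Cauchy_L2_convergent:
  fixes X :: "nat \<Rightarrow> 'a::euclidean_space L2"
  assumes fast: "\<And>n. norm (X (Suc n) - X n) \<le> (1/2) ^ n" and C: "Cauchy X"
  shows "convergent X"
proof -
  define f where "f n = rep_L2 (X n)" for n
  have sf: "square_integrable (f n)" for n by (simp add: f_def rep_L2_square_integrable)
  have Xf: "X n = abs_L2 (f n)" for n by (simp add: f_def abs_rep_L2)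
  have [measurable]: "f n \<in> borel_measurable borel" for n using sf[of n] by (simp add: square_integrable_def)
  have nn: "(\<integral>\<^sup>+x. ennreal ((f m x - f n x)\<^sup>2) \<partial>lborel) = ennreal ((norm (X m - X n))\<^sup>2)" for m n
    by (simp add: Xf abs_L2_diff sf square_integrable_diff ennreal_norm_abs_L2)
  have "AE x in lborel. convergent (\<lambda>n. f n x)"
  proof -
    let ?h = "\<lambda>x k. ennreal (2 ^ k * (f (Suc k) x - f k x)\<^sup>2)"
    have "(\<integral>\<^sup>+x. (\<Sum>k. ?h x k) \<partial>lborel) = (\<Sum>k. \<integral>\<^sup>+x. ?h x k \<partial>lborel)"
      by (intro nn_integral_suminf) auto
    also have "\<dots> \<le> (\<Sum>k. ennreal ((1/2) ^ k))"
    proof (intro suminf_le)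
      fix k
      have "(\<integral>\<^sup>+x. ?h x k \<partial>lborel) = ennreal (2 ^ k) * (\<integral>\<^sup>+x. ennreal ((f (Suc k) x - f k x)\<^sup>2) \<partial>lborel)"
        by (subst nn_integral_cmult[symmetric]) (auto simp: ennreal_mult')
      also have "\<dots> = ennreal (2 ^ k * (norm (X (Suc k) - X k))\<^sup>2)"
        by (simp add: nn ennreal_mult')
      also have "\<dots> \<le> ennreal (2 ^ k * ((1/2) ^ k)\<^sup>2)"
        by (intro ennreal_leI mult_left_mono power_mono fast) auto
      also have "2 ^ k * ((1/2) ^ k)\<^sup>2 = (1/2 :: real) ^ k"
        by (simp add: power2_eq_square power_one_over field_simps)
      finally show "(\<integral>\<^sup>+x. ?h x k \<partial>lborel) \<le> ennreal ((1/2) ^ k)" .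
    qed auto
    also have "\<dots> = ennreal (\<Sum>k. (1/2) ^ k)"
      by (intro suminf_ennreal2) (auto intro: summable_geometric)
    also have "\<dots> < \<infinity>" by simp
    finally have "AE x in lborel. (\<Sum>k. ?h x k) \<noteq> \<infinity>"
      by (intro nn_integral_PInf_AE) auto
    then show ?thesis
    proof eventually_elim
      case (elim x)
      have "summable (\<lambda>k. 2 ^ k * (f (Suc k) x - f k x)\<^sup>2)"
        by (rule summable_suminf_not_top) (use elim in auto)
      then have "(\<lambda>k. 2 ^ k * (f (Suc k) x - f k x)\<^sup>2) \<longlonglongrightarrow> 0" by (rule summable_LIMSEQ_zero)
      then have "Bseq (\<lambda>k. 2 ^ k * (f (Suc k) x - f k x)\<^sup>2)"
        by (intro convergent_imp_Bseq convergentI)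
      then obtain B where B: "\<And>k. \<bar>2 ^ k * (f (Suc k) x - f k x)\<^sup>2\<bar> \<le> B"
        unfolding Bseq_def real_norm_def by blast
      have B0: "0 \<le> B" using B[of 0] by linarith
      define q where "q = sqrt (1/2)"
      have q: "q\<^sup>2 = 1/2" "0 \<le> q" "q < 1" by (auto simp: q_def)
      have le: "\<bar>f (Suc k) x - f k x\<bar> \<le> sqrt B * q ^ k" for k
      proof -
        have "(f (Suc k) x - f k x)\<^sup>2 = (2 ^ k * (f (Suc k) x - f k x)\<^sup>2) * (1/2) ^ k"
          by (simp add: power_one_over)
        also have "\<dots> \<le> B * (1/2) ^ k" using B[of k] by (intro mult_right_mono) auto
        also have "(1/2) ^ k = (q ^ k)\<^sup>2"
          unfolding q(1)[symmetric] by (metis power_mult mult.commute)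
        also have "B * (q ^ k)\<^sup>2 = (sqrt B * q ^ k)\<^sup>2"
          using B0 by (simp add: power_mult_distrib)
        finally have "\<bar>f (Suc k) x - f k x\<bar> \<le> \<bar>sqrt B * q ^ k\<bar>" by (simp only: abs_le_square_iff)
        then show ?thesis using B0 q(2) by simp
      qed
      have "summable (\<lambda>k. f (Suc k) x - f k x)"
        by (rule summable_comparison_test'[where g="\<lambda>k. sqrt B * q ^ k" and N=0])
           (use le q in \<open>auto intro!: summable_mult summable_geometric\<close>)
      then have "convergent (\<lambda>n. \<Sum>k<n. f (Suc k) x - f k x)" by (simp add: summable_iff_convergent)
      then have "convergent (\<lambda>n. f n x - f 0 x)" by (simp only: sum_lessThan_telescope[of "\<lambda>n. f n x"])
      then show "convergent (\<lambda>n. f n x)"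
        using convergent_diff_const_right_iff by blast
    qed
  qed
  then have lim: "AE x in lborel. (\<lambda>n. f n x) \<longlonglongrightarrow> lim (\<lambda>n. f n x)"
    by eventually_elim (simp add: convergent_LIMSEQ_iff)
  define g where "g x = lim (\<lambda>n. f n x)" for x
  have [measurable]: "g \<in> borel_measurable borel"
    unfolding g_def[abs_def] by measurable
  have bound: "(\<integral>\<^sup>+x. ennreal ((g x - f n x)\<^sup>2) \<partial>lborel) \<le> ennreal (e\<^sup>2)"
    if "\<And>m. m \<ge> n \<Longrightarrow> norm (X m - X n) \<le> e" for n e
  proof -
    have "(\<integral>\<^sup>+x. ennreal ((g x - f n x)\<^sup>2) \<partial>lborel)
        = (\<integral>\<^sup>+x. liminf (\<lambda>m. ennreal ((f m x - f n x)\<^sup>2)) \<partial>lborel)"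
    proof (rule nn_integral_cong_AE, use lim in eventually_elim)
      case (elim x)
      then have "(\<lambda>m. ennreal ((f m x - f n x)\<^sup>2)) \<longlonglongrightarrow> ennreal ((g x - f n x)\<^sup>2)"
        by (auto intro!: tendsto_intros simp: g_def)
      then show ?case by (intro lim_imp_Liminf[symmetric]) auto
    qed
    also have "\<dots> \<le> liminf (\<lambda>m. \<integral>\<^sup>+x. ennreal ((f m x - f n x)\<^sup>2) \<partial>lborel)"
      by (intro nn_integral_liminf) auto
    also have "\<dots> \<le> liminf (\<lambda>m. ennreal (e\<^sup>2))"
    proof (intro Liminf_mono eventually_sequentiallyI[of n])
      fix m assume "n \<le> m"
      from that[OF this] show "(\<integral>\<^sup>+x. ennreal ((f m x - f n x)\<^sup>2) \<partial>lborel) \<le> ennreal (e\<^sup>2)"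
        by (auto simp: nn intro!: ennreal_leI power_mono)
    qed
    also have "\<dots> = ennreal (e\<^sup>2)" by (simp add: Liminf_const)
    finally show ?thesis .
  qed
  have CE: "\<exists>N. \<forall>n\<ge>N. \<forall>m\<ge>n. norm (X m - X n) \<le> e" if "e > 0" for e
    using C that unfolding Cauchy_iff by (meson less_imp_le order_trans)
  have sgd: "square_integrable (\<lambda>x. g x - f n x)" if "\<And>m. m \<ge> n \<Longrightarrow> norm (X m - X n) \<le> e" for n e
    using bound[OF that] unfolding square_integrable_def
    by (auto simp: integrable_iff_bounded intro: le_less_trans)
  obtain N where N: "\<forall>n\<ge>N. \<forall>m\<ge>n. norm (X m - X n) \<le> 1" using CE[of 1] by auto
  have sg: "square_integrable g"
    using square_integrable_add[OF sgd[of N 1] sf[of N]] N by simp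
  have "X \<longlonglongrightarrow> abs_L2 g"
  proof (rule LIMSEQ_I)
    fix r :: real assume r: "0 < r"
    obtain M where M: "\<forall>n\<ge>M. \<forall>m\<ge>n. norm (X m - X n) \<le> r / 2" using CE[of "r/2"] r by auto
    have "norm (X n - abs_L2 g) < r" if n: "n \<ge> M" for n
    proof -
      have "ennreal ((norm (abs_L2 g - X n))\<^sup>2) \<le> ennreal ((r/2)\<^sup>2)"
        using bound[of n "r/2"] M n
        by (simp add: Xf abs_L2_diff sf sg square_integrable_diff ennreal_norm_abs_L2[symmetric])
      then have "norm (abs_L2 g - X n) \<le> r / 2"
        using r by (auto simp: power_mono_iff)
      then show ?thesis using r by (simp add: norm_minus_commute)
    qed
    then show "\<exists>no. \<forall>n\<ge>no. norm (X n - abs_L2 g) < r" by blast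
  qed
  then show ?thesis by (rule convergentI)
qed

instance L2 :: (euclidean_space) banach
proof
  fix X :: "nat \<Rightarrow> 'a L2"
  assume C: "Cauchy X"
  have "\<exists>N. \<forall>m\<ge>N. \<forall>n\<ge>N. norm (X m - X n) < (1/2) ^ k" for k
    using C unfolding Cauchy_iff by simp
  then obtain N where N: "\<And>k m n. m \<ge> N k \<Longrightarrow> n \<ge> N k \<Longrightarrow> norm (X m - X n) < (1/2) ^ k"
    by metis
  define r where "r n = n + (\<Sum>k\<le>n. N k)" for n
  have r: "strict_mono r" by (auto simp: strict_mono_Suc_iff r_def)
  have rN: "N n \<le> r n" for n
    using member_le_sum[of n "{..n}" N] by (simp add: r_def trans_le_add2)
  have "convergent (X \<circ> r)"
  proof (rule Cauchy_L2_convergent)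
    fix n
    have "N n \<le> r (Suc n)" using rN[of n] strict_monoD[OF r, of n "Suc n"] by simp
    then show "norm ((X \<circ> r) (Suc n) - (X \<circ> r) n) \<le> (1/2) ^ n"
      using N[of n "r (Suc n)" "r n"] rN[of n] by (simp add: less_imp_le)
  next
    show "Cauchy (X \<circ> r)" by (rule Cauchy_subseq_Cauchy[OF C r])
  qed
  then obtain l where "(X \<circ> r) \<longlonglongrightarrow> l" by (auto simp: convergent_def)
  then have "X \<longlonglongrightarrow> l"
    using C r Cauchy_converges_subseq by blast
  then show "convergent X" by (rule convergentI)
qed

text \<open>Separability: rational combinations of indicators of finite unions of basic open sets, cut off
  to balls, are dense. The Bochner integral of the library needs a second countable target.\<close>

definition box_union_classes :: "'a::euclidean_space L2 set" where
  "box_union_classes = {abs_L2 (indicator (\<Union>\<B> \<inter> ball 0 (real n))) | \<B> n.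
      finite \<B> \<and> \<B> \<subseteq> (SOME B. countable B \<and> topological_basis B)}"

definition rat_span :: "'a::euclidean_space L2 set" where
  "rat_span = {\<Sum>(q, c)\<leftarrow>xs. of_rat q *\<^sub>R c | xs. set xs \<subseteq> UNIV \<times> box_union_classes}"

lemma some_basis:
  "countable (SOME B :: 'a::euclidean_space set set. countable B \<and> topological_basis B)"
  "topological_basis (SOME B :: 'a::euclidean_space set set. countable B \<and> topological_basis B)"
  using someI_ex[OF ex_countable_basis[where 'a='a]] by auto

lemma countable_rat_span: "countable (rat_span :: 'a::euclidean_space L2 set)"
proof -
  let ?B = "SOME B :: 'a set set. countable B \<and> topological_basis B"
  have "countable {\<B>. finite \<B> \<and> \<B> \<subseteq> ?B}"
    using countable_Collect_finite_subset[OF some_basis(1)] by simp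
  then have "countable ((\<lambda>(\<B>, n). abs_L2 (indicator (\<Union>\<B> \<inter> ball 0 (real n))) :: 'a L2) `
      ({\<B>. finite \<B> \<and> \<B> \<subseteq> ?B} \<times> UNIV))" by (intro countable_image countable_SIGMA) auto
  moreover have "box_union_classes \<subseteq> (\<lambda>(\<B>, n). abs_L2 (indicator (\<Union>\<B> \<inter> ball 0 (real n))) :: 'a L2) `
      ({\<B>. finite \<B> \<and> \<B> \<subseteq> ?B} \<times> UNIV)"
    by (force simp: box_union_classes_def)
  ultimately have C: "countable (box_union_classes :: 'a L2 set)" by (rule countable_subset[rotated])
  have "countable (lists (UNIV \<times> (box_union_classes :: 'a L2 set)) :: (rat \<times> 'a L2) list set)"
    using C by (intro countable_lists countable_SIGMA) auto
  then have "countable ((\<lambda>xs. \<Sum>(q, c)\<leftarrow>xs. of_rat q *\<^sub>R c) `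
      (lists (UNIV \<times> (box_union_classes :: 'a L2 set)) :: (rat \<times> 'a L2) list set))"
    by (rule countable_image)
  moreover have "(rat_span :: 'a L2 set) \<subseteq> (\<lambda>xs. \<Sum>(q, c)\<leftarrow>xs. of_rat q *\<^sub>R c) `
      (lists (UNIV \<times> (box_union_classes :: 'a L2 set)) :: (rat \<times> 'a L2) list set)"
    by (auto simp: rat_span_def)
  ultimately show ?thesis by (rule countable_subset[rotated])
qed

lemma rat_span_add: "x \<in> rat_span \<Longrightarrow> y \<in> rat_span \<Longrightarrow> x + y \<in> rat_span"
proof -
  assume "x \<in> rat_span" "y \<in> rat_span"
  then obtain xs ys where "x = (\<Sum>(q, c)\<leftarrow>xs. of_rat q *\<^sub>R c)" "set xs \<subseteq> UNIV \<times> box_union_classes"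
     "y = (\<Sum>(q, c)\<leftarrow>ys. of_rat q *\<^sub>R c)" "set ys \<subseteq> UNIV \<times> box_union_classes"
    unfolding rat_span_def by blast
  then show ?thesis unfolding rat_span_def by (intro CollectI exI[of _ "xs @ ys"]) auto
qed

lemma rat_span_scale: "x \<in> rat_span \<Longrightarrow> of_rat p *\<^sub>R x \<in> rat_span"
proof -
  assume "x \<in> rat_span"
  then obtain xs where x: "x = (\<Sum>(q, c)\<leftarrow>xs. of_rat q *\<^sub>R c)" "set xs \<subseteq> UNIV \<times> box_union_classes"
    unfolding rat_span_def by blast
  have "of_rat p *\<^sub>R (\<Sum>(q, c)\<leftarrow>ys. of_rat q *\<^sub>R c) =
     (\<Sum>(q, c)\<leftarrow>map (\<lambda>(q, c). (p * q, c)) ys. of_rat q *\<^sub>R c)" for ys :: "(rat \<times> 'a L2) list"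
    by (induction ys) (auto simp: scaleR_add_right of_rat_mult)
  then show ?thesis using x unfolding rat_span_def
    by (intro CollectI exI[of _ "map (\<lambda>(q, c). (p * q, c)) xs"]) auto
qed

lemma closure_rat_span_add:
  "x \<in> closure rat_span \<Longrightarrow> y \<in> closure rat_span \<Longrightarrow> x + y \<in> closure rat_span"
  unfolding closure_sequential
proof (elim exE conjE)
  fix f g assume "\<forall>n. f n \<in> rat_span" "f \<longlonglongrightarrow> x" "\<forall>n. g n \<in> rat_span" "g \<longlonglongrightarrow> y"
  then show "\<exists>h. (\<forall>n. h n \<in> rat_span) \<and> h \<longlonglongrightarrow> x + y"
    by (intro exI[of _ "\<lambda>n. f n + g n"]) (auto intro: rat_span_add tendsto_add)
qed

lemma closure_rat_span_scale:
  "x \<in> closure rat_span \<Longrightarrow> a *\<^sub>R x \<in> closure rat_span"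
  unfolding closure_sequential
proof (elim exE conjE)
  fix f assume f: "\<forall>n. f n \<in> rat_span" "f \<longlonglongrightarrow> x"
  have "\<exists>q. \<bar>of_rat q - a\<bar> < 1 / real (Suc n)" for n
  proof -
    obtain q where "a < of_rat q" "of_rat q < a + 1 / real (Suc n)"
      using of_rat_dense[of a "a + 1 / real (Suc n)"] by auto
    then show ?thesis by (intro exI[of _ q]) auto
  qed
  then obtain q where q: "\<And>n. \<bar>of_rat (q n) - a\<bar> < 1 / real (Suc n)" by metis
  have "(\<lambda>n. of_rat (q n) - a) \<longlonglongrightarrow> 0"
  proof (rule Lim_null_comparison)
    show "\<forall>\<^sub>F n in sequentially. norm (of_rat (q n) - a) \<le> 1 / real (Suc n)"
      using q by (auto intro!: always_eventually less_imp_le)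
  qed (rule LIMSEQ_Suc[OF lim_1_over_n])
  then have "(\<lambda>n. of_rat (q n)) \<longlonglongrightarrow> a" by (rule LIM_zero_cancel)
  then show "\<exists>h. (\<forall>n. h n \<in> rat_span) \<and> h \<longlonglongrightarrow> a *\<^sub>R x"
    using f by (intro exI[of _ "\<lambda>n. of_rat (q n) *\<^sub>R f n"]) (auto intro: rat_span_scale tendsto_scaleR)
qed

lemma square_integrable_indicator_ball:
  "A \<in> sets borel \<Longrightarrow> square_integrable (indicator (A \<inter> ball 0 r) :: 'a::euclidean_space \<Rightarrow> real)"
proof (rule square_integrable_indicator)
  have "emeasure lborel (A \<inter> ball 0 r) \<le> emeasure lborel (ball (0::'a) r)"
    by (intro emeasure_mono) auto
  also have "\<dots> < \<infinity>" using emeasure_lborel_ball_finite by simp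
  finally show "emeasure lborel (A \<inter> ball 0 r) < \<infinity>" .
qed auto

lemma abs_L2_indicator_Un:
  fixes P Q :: "'a::euclidean_space set"
  assumes "P \<in> sets borel" "Q \<in> sets borel" "P \<inter> Q = {}"
  shows "abs_L2 (indicator ((P \<union> Q) \<inter> ball 0 r)) =
    abs_L2 (indicator (P \<inter> ball 0 r)) + abs_L2 (indicator (Q \<inter> ball 0 r))"
proof -
  have "(\<lambda>x. indicator (P \<inter> ball 0 r) x + indicator (Q \<inter> ball 0 r) x) =
      (indicator ((P \<union> Q) \<inter> ball 0 r) :: 'a \<Rightarrow> real)"
    using assms(3) by (auto simp: indicator_def fun_eq_iff)
  then show ?thesis
    by (simp only: abs_L2_add[OF square_integrable_indicator_ball[OF assms(1)]
          square_integrable_indicator_ball[OF assms(2)]])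
qed

lemma indicator_in_closure_rat_span:
  fixes A :: "'a::euclidean_space set"
  assumes "A \<in> sets borel"
  shows "abs_L2 (indicator (A \<inter> ball 0 (real n))) \<in> closure rat_span"
proof -
  let ?B = "SOME B :: 'a set set. countable B \<and> topological_basis B"
  let ?b = "ball (0::'a) (real n)"
  have gen: "abs_L2 (indicator (\<Union>\<B> \<inter> ?b)) \<in> rat_span" if "finite \<B>" "\<B> \<subseteq> ?B" for \<B>
    using that unfolding rat_span_def box_union_classes_def
    by (intro CollectI exI[of _ "[(1, abs_L2 (indicator (\<Union>\<B> \<inter> ?b)))]"]) auto
  have opens: "abs_L2 (indicator (U \<inter> ?b)) \<in> closure rat_span" if U: "open U" for U
  proof (cases "U = {}")
    case True
    then show ?thesis using gen[of "{}"] closure_subset by auto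
  next
    case False
    obtain \<B> where \<B>: "\<B> \<subseteq> ?B" "\<Union>\<B> = U"
      using U some_basis(2)[where 'a='a] unfolding topological_basis_def by blast
    have cB: "countable \<B>" "\<B> \<noteq> {}" using \<B> some_basis(1)[where 'a='a] False by (blast intro: countable_subset, blast)
    define s where "s = from_nat_into \<B>"
    have s: "range s = \<B>"
      unfolding s_def by (intro range_from_nat_into) fact+
    have lim: "(\<lambda>k. abs_L2 (indicator (\<Union>(s ` {..<k}) \<inter> ?b))) \<longlonglongrightarrow> abs_L2 (indicator (U \<inter> ?b))"
    proof (rule tendsto_abs_L2(2)[where w="indicator ?b"])
      have "s i \<in> ?B" for i using s \<B>(1) by blast
      then have "open (s i)" for i by (rule topological_basis_open[OF some_basis(2)])
      then show "square_integrable (indicator (\<Union>(s ` {..<k}) \<inter> ?b) :: 'a \<Rightarrow> real)" for k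
        by (intro square_integrable_indicator_ball) auto
      show "(indicator (U \<inter> ?b) :: 'a \<Rightarrow> real) \<in> borel_measurable lborel"
        using square_integrable_indicator_ball[OF borel_open[OF U]] by (simp add: square_integrable_def)
      show "square_integrable (indicator ?b :: 'a \<Rightarrow> real)"
        using square_integrable_indicator_ball[of UNIV] by simp
      show "\<bar>indicator (\<Union>(s ` {..<k}) \<inter> ?b) x\<bar> \<le> \<bar>indicator ?b x :: real\<bar>" for k x
        by (auto simp: indicator_def)
      show "(\<lambda>k. indicator (\<Union>(s ` {..<k}) \<inter> ?b) x :: real) \<longlonglongrightarrow> indicator (U \<inter> ?b) x" for x
      proof (cases "x \<in> U \<inter> ?b")
        case True
        then obtain i where i: "x \<in> s i" using s \<B>(2) by blast
        have "\<forall>\<^sub>F k in sequentially. indicator (\<Union>(s ` {..<k}) \<inter> ?b) x = (1::real)"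
          by (rule eventually_sequentiallyI[of "Suc i"]) (use i True in \<open>auto simp: indicator_def\<close>)
        then show ?thesis using True by (simp add: tendsto_eventually)
      next
        case False
        then have "indicator (\<Union>(s ` {..<k}) \<inter> ?b) x = (0::real)" for k
          using s \<B>(2) by (auto simp: indicator_def)
        then show ?thesis using False by simp
      qed
    qed
    have "abs_L2 (indicator (\<Union>(s ` {..<k}) \<inter> ?b)) \<in> rat_span" for k
      using s \<B>(1) by (intro gen) auto
    with lim show ?thesis
      unfolding closure_sequential by (intro exI conjI allI) assumption+
  qed
  have "Int_stable {S :: 'a set. open S}" by (auto simp: Int_stable_def)
  moreover have "{S :: 'a set. open S} \<subseteq> Pow UNIV" by simp
  moreover have "A \<in> sigma_sets UNIV {S. open S}" using assms by (simp add: borel_def)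
  ultimately show ?thesis
  proof (induction rule: sigma_sets_induct_disjoint)
    case (compl A)
    have A: "A \<in> sets borel" using compl(1) by (simp add: borel_def)
    have "abs_L2 (indicator ((UNIV - A) \<inter> ?b)) =
        abs_L2 (indicator (UNIV \<inter> ?b)) + (-1) *\<^sub>R abs_L2 (indicator (A \<inter> ?b) :: 'a \<Rightarrow> real)"
    proof -
      have eq: "(\<lambda>x. indicator (UNIV \<inter> ?b) x + -1 * indicator (A \<inter> ?b) x :: real) = indicator ((UNIV - A) \<inter> ?b)"
        by (auto simp: indicator_def fun_eq_iff)
      have 1: "square_integrable (indicator (UNIV \<inter> ?b) :: 'a \<Rightarrow> real)"
        "square_integrable (indicator (A \<inter> ?b) :: 'a \<Rightarrow> real)"
        by (rule square_integrable_indicator_ball, simp) (rule square_integrable_indicator_ball[OF A])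
      show ?thesis
        unfolding abs_L2_scale[OF 1(2)] abs_L2_add[OF 1(1) square_integrable_scale[OF 1(2)]] eq ..
    qed
    also have "\<dots> \<in> closure rat_span"
      by (intro closure_rat_span_add closure_rat_span_scale compl.IH opens) auto
    finally show ?case .
  next
    case (union A)
    have A: "A i \<in> sets borel" for i using union(2) by (simp add: borel_def subset_iff)
    have fin: "abs_L2 (indicator (\<Union>(A ` {..<k}) \<inter> ?b)) \<in> closure rat_span" for k
    proof (induction k)
      case 0
      have "\<Union>(A ` {..<0::nat}) = {}" by simp
      then show ?case using opens[OF open_empty] by (simp only:)
    next
      case (Suc k)
      have "abs_L2 (indicator (\<Union>(A ` {..<Suc k}) \<inter> ?b)) =
          abs_L2 (indicator (\<Union>(A ` {..<k}) \<inter> ?b)) + abs_L2 (indicator (A k \<inter> ?b) :: 'a \<Rightarrow> real)"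
      proof -
        have disj: "A j \<inter> A k = {}" if "j < k" for j
          by (rule disjoint_family_onD[OF union(1)]) (use that in auto)
        have "\<Union>(A ` {..<k}) \<inter> A k = (\<Union>j<k. A j \<inter> A k)" by blast
        also have "\<dots> = {}" using disj by simp
        finally have "\<Union>(A ` {..<k}) \<inter> A k = {}" .
        then have "abs_L2 (indicator ((\<Union>(A ` {..<k}) \<union> A k) \<inter> ?b)) =
            abs_L2 (indicator (\<Union>(A ` {..<k}) \<inter> ?b)) + abs_L2 (indicator (A k \<inter> ?b) :: 'a \<Rightarrow> real)"
          by (rule abs_L2_indicator_Un[rotated 2]) (use A in auto)
        then show ?thesis by (simp only: lessThan_Suc image_insert Union_insert Un_commute)
      qed
      then show ?case using closure_rat_span_add[OF Suc union(3)[of k]] by simp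
    qed
    have "(\<lambda>k. abs_L2 (indicator (\<Union>(A ` {..<k}) \<inter> ?b))) \<longlonglongrightarrow> abs_L2 (indicator (\<Union>(range A) \<inter> ?b))"
    proof (rule tendsto_abs_L2(2)[where w="indicator ?b"])
      show "square_integrable (indicator (\<Union>(A ` {..<k}) \<inter> ?b) :: 'a \<Rightarrow> real)" for k
        using A by (intro square_integrable_indicator_ball) auto
      show "(indicator (\<Union>(range A) \<inter> ?b) :: 'a \<Rightarrow> real) \<in> borel_measurable lborel"
        using square_integrable_indicator_ball[of "\<Union>(range A)"] A by (simp add: square_integrable_def)
      show "square_integrable (indicator ?b :: 'a \<Rightarrow> real)"
        using square_integrable_indicator_ball[of UNIV] by simp
      show "\<bar>indicator (\<Union>(A ` {..<k}) \<inter> ?b) x\<bar> \<le> \<bar>indicator ?b x :: real\<bar>" for k x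
        by (auto simp: indicator_def)
      show "(\<lambda>k. indicator (\<Union>(A ` {..<k}) \<inter> ?b) x :: real) \<longlonglongrightarrow> indicator (\<Union>(range A) \<inter> ?b) x" for x
      proof (cases "x \<in> \<Union>(range A) \<inter> ?b")
        case True
        then obtain i where i: "x \<in> A i" by blast
        have "\<forall>\<^sub>F k in sequentially. indicator (\<Union>(A ` {..<k}) \<inter> ?b) x = (1::real)"
          by (rule eventually_sequentiallyI[of "Suc i"]) (use i True in \<open>auto simp: indicator_def\<close>)
        then show ?thesis using True by (simp add: tendsto_eventually)
      next
        case False
        then have "indicator (\<Union>(A ` {..<k}) \<inter> ?b) x = (0::real)" for k
          by (auto simp: indicator_def)
        then show ?thesis using False by simp
      qed
    qed
    with fin show ?case by (meson closed_closure closed_sequentially)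
  next
    case empty
    show ?case by (rule opens[OF open_empty])
  next
    case (basic U)
    then show ?case by (intro opens) simp
  qed
qed

lemma closure_rat_span_UNIV: "closure rat_span = (UNIV :: 'a::euclidean_space L2 set)"
proof (intro equalityI subset_UNIV subsetI)
  fix F :: "'a L2"
  define f where "f = rep_L2 F"
  have f: "square_integrable f" by (simp add: f_def rep_L2_square_integrable)
  then have fm: "f \<in> borel_measurable lborel" by (simp add: square_integrable_def)
  obtain s where s: "\<And>i. simple_function lborel (s i)" "\<And>x. (\<lambda>i. s i x) \<longlonglongrightarrow> f x"
      "\<And>i x. dist (s i x) 0 \<le> 2 * dist (f x) 0"
    using borel_measurable_implies_sequence_metric[OF fm, of 0] by auto
  define g where "g i x = s i x * indicator (ball 0 (real i)) x" for i x
  have sm: "s i \<in> borel_measurable lborel" for i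
    using s(1) by (rule borel_measurable_simple_function)
  have gm: "g i \<in> borel_measurable lborel" for i
    unfolding g_def[abs_def] by (intro borel_measurable_times sm borel_measurable_indicator) auto
  have bnd: "\<bar>g i x\<bar> \<le> \<bar>2 * f x\<bar>" for i x
    using s(3)[of i x] by (auto simp: g_def indicator_def)
  have sg: "square_integrable (g i)" for i
    by (rule square_integrable_bound[OF square_integrable_scale[OF f, of 2] gm bnd])
  have lim: "(\<lambda>i. abs_L2 (g i)) \<longlonglongrightarrow> abs_L2 f"
  proof (rule tendsto_abs_L2(2)[OF sg fm square_integrable_scale[OF f, of 2] bnd])
    fix x :: 'a
    obtain N where N: "norm x < real N" using reals_Archimedean2 by blast
    have "\<forall>\<^sub>F i in sequentially. g i x = s i x"
      by (rule eventually_sequentiallyI[of N]) (use N in \<open>auto simp: g_def indicator_def\<close>)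
    then show "(\<lambda>i. g i x) \<longlonglongrightarrow> f x"
      using s(2)[of x] by (simp add: tendsto_cong)
  qed
  have "abs_L2 (g i) \<in> closure rat_span" for i
  proof -
    let ?b = "ball (0::'a) (real i)"
    have fin: "finite (range (s i))" using simple_functionD(1)[OF s(1)] by simp
    have meas: "s i -` {y} \<in> sets borel" for y
      using simple_functionD(2)[OF s(1)[of i], of "{y}"] by simp
    define h where "h y x = y * (indicator (s i -` {y} \<inter> ?b) x :: real)" for y x
    have sq: "square_integrable (h y)" for y
      unfolding h_def[abs_def] by (intro square_integrable_scale square_integrable_indicator_ball meas)
    have hcl: "abs_L2 (h y) \<in> closure rat_span" for y
      using closure_rat_span_scale[OF indicator_in_closure_rat_span[OF meas[of y], of i], of y]
        square_integrable_indicator_ball[OF meas[of y], of "real i"]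
      by (simp add: abs_L2_scale h_def[abs_def])
    have part: "square_integrable (\<lambda>x. \<Sum>y\<in>Y. h y x) \<and>
        abs_L2 (\<lambda>x. \<Sum>y\<in>Y. h y x) \<in> closure rat_span" if "finite Y" for Y
      using that
    proof (induction Y rule: finite_induct)
      case empty
      have "abs_L2 (\<lambda>x::'a. 0) = 0 *\<^sub>R abs_L2 (h 0)"
        by (subst abs_L2_scale[OF sq]) simp
      also have "\<dots> \<in> closure rat_span"
        by (intro closure_rat_span_scale hcl)
      finally show ?case by (simp add: square_integrable_0)
    next
      case (insert y Y)
      have "abs_L2 (h y) + abs_L2 (\<lambda>x. \<Sum>y\<in>Y. h y x) = abs_L2 (\<lambda>x. h y x + (\<Sum>y\<in>Y. h y x))"
        using insert sq[of y] by (intro abs_L2_add) auto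
      then show ?case
        using insert closure_rat_span_add[OF hcl[of y], of "abs_L2 (\<lambda>x. \<Sum>y\<in>Y. h y x)"]
          square_integrable_add[OF sq[of y], of "\<lambda>x. \<Sum>y\<in>Y. h y x"]
        by (simp add: sum.insert)
    qed
    have "g i = (\<lambda>x. \<Sum>y\<in>range (s i). h y x)"
    proof
      fix x
      have "(\<Sum>y\<in>range (s i). h y x) = (\<Sum>y\<in>range (s i). if y = s i x then g i x else 0)"
        by (intro sum.cong) (auto simp: g_def h_def indicator_def)
      then show "g i x = (\<Sum>y\<in>range (s i). h y x)" using fin by simp
    qed
    then show ?thesis using part[OF fin] by simp
  qed
  with lim show "F \<in> closure rat_span"
    by (metis abs_rep_L2 closed_closure closed_sequentially f_def)
qed

instance L2 :: (euclidean_space) second_countable_topology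
proof
  let ?D = "rat_span :: 'a L2 set"
  let ?B = "(\<lambda>(x, q). ball x (of_rat q)) ` (?D \<times> UNIV) :: 'a L2 set set"
  have "topological_basis ?B"
  proof (rule topological_basisI)
    show "open S" if "S \<in> ?B" for S using that by auto
    fix U :: "'a L2 set" and x assume U: "open U" "x \<in> U"
    then obtain e where e: "e > 0" "ball x e \<subseteq> U" by (meson open_contains_ball)
    obtain q :: rat where q: "0 < (of_rat q :: real)" "of_rat q < e / 2"
      using of_rat_dense[of 0 "e/2"] e(1) by auto
    have "x \<in> closure ?D" by (simp add: closure_rat_span_UNIV)
    then obtain d where d: "d \<in> ?D" "dist d x < of_rat q"
      using q(1) unfolding closure_approachable by blast
    have "ball d (of_rat q) \<subseteq> U"
    proof
      fix z assume "z \<in> ball d (of_rat q)"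
      then have "dist x z < e" using d(2) q(2) dist_triangle[of x z d] by (simp add: dist_commute)
      then show "z \<in> U" using e(2) by auto
    qed
    then show "\<exists>S\<in>?B. x \<in> S \<and> S \<subseteq> U"
      using d by (intro bexI[of _ "ball d (of_rat q)"]) auto
  qed
  moreover have "countable ?B" by (intro countable_image countable_SIGMA countable_rat_span) auto
  ultimately show "\<exists>B :: 'a L2 set set. countable B \<and> open = generate_topology B"
    using topological_basis_imp_subbasis by blast
qed

definition L2_on :: "'a::euclidean_space set \<Rightarrow> 'a L2 set" where
  "L2_on A = {f. AE x in lborel. x \<notin> A \<longrightarrow> rep_L2 f x = 0}"

definition L2_slice :: "(real \<times> real) L2 \<Rightarrow> real \<Rightarrow> real L2" where
  "L2_slice F t = abs_L2 (\<lambda>x. rep_L2 F (t, x))"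

text \<open>By Fubini, the slice \<open>L2_slice F t\<close> is a class of \<open>L\<^sup>2\<close> for almost every \<open>t\<close>, and up to a null set of
  \<open>t\<close> it does not depend on the representative. The inverse operation turns a path in \<open>L\<^sup>2(0,l)\<close> into an
  element of \<open>L\<^sup>2((0,T) \<times> (0,l))\<close>, which is determined by almost all of its slices.\<close>

definition L2_of_path :: "real \<Rightarrow> real \<Rightarrow> (real \<Rightarrow> real L2) \<Rightarrow> (real \<times> real) L2" where
  "L2_of_path T l u = (THE F. F \<in> L2_on ({0<..<T} \<times> {0<..<l}) \<and>
      (AE t in lborel. t \<in> {0<..<T} \<longrightarrow> L2_slice F t = u t))"

text \<open>Weak derivatives are tested against compactly supported functions of class \<open>C\<^sup>1\<close>, as is common
  in one dimension; by mollification this is the same as testing with smooth functions.\<close>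

definition test_function :: "real \<Rightarrow> (real \<Rightarrow> real) \<Rightarrow> bool" where
  "test_function l \<psi> \<longleftrightarrow> \<psi> C1_differentiable_on UNIV \<and>
     (\<exists>a b. 0 < a \<and> b < l \<and> (\<forall>x. x \<notin> {a..b} \<longrightarrow> \<psi> x = 0))"

definition weak_derivative :: "real \<Rightarrow> real L2 \<Rightarrow> real L2 \<Rightarrow> bool" where
  "weak_derivative l u p \<longleftrightarrow> u \<in> L2_on {0<..<l} \<and> p \<in> L2_on {0<..<l} \<and>
     (\<forall>\<psi>. test_function l \<psi> \<longrightarrow>
        (\<integral>x. rep_L2 u x * deriv \<psi> x \<partial>lborel) = - (\<integral>x. rep_L2 p x * \<psi> x \<partial>lborel))"

primrec sobolev :: "real \<Rightarrow> nat \<Rightarrow> real L2 set" where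
  "sobolev l 0 = L2_on {0<..<l}"
| "sobolev l (Suc k) = {u. \<exists>p\<in>sobolev l k. weak_derivative l u p}"

definition wderiv :: "real \<Rightarrow> real L2 \<Rightarrow> real L2" where
  "wderiv l u = (THE p. weak_derivative l u p)"

text \<open>The value at \<open>z \<in> [0,l]\<close> of the continuous representative of \<open>u\<close>.\<close>

definition trace :: "real \<Rightarrow> real L2 \<Rightarrow> real \<Rightarrow> real" where
  "trace l u z = (THE a. \<exists>v. continuous_on {0..l} v \<and>
      (AE x in lborel. x \<in> {0<..<l} \<longrightarrow> rep_L2 u x = v x) \<and> a = v z)"

text \<open>Triples \<open>(y, a, b)\<close> and pairs carry the product inner products of the library, which are exactly
  the inner products of \<open>\<L>\<^sup>2 = L\<^sup>2(0,l) \<times> \<real>\<^sup>2\<close> and \<open>\<L>\<^sup>2\<^sub>T\<close>.\<close>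

type_synonym triple = "real L2 \<times> real \<times> real"

definition LL2 :: "real \<Rightarrow> triple set" where
  "LL2 l = L2_on {0<..<l} \<times> UNIV \<times> UNIV"

definition LL2T :: "real \<Rightarrow> real \<Rightarrow> ((real \<times> real) L2 \<times> real L2) set" where
  "LL2T T l = L2_on ({0<..<T} \<times> {0<..<l}) \<times> L2_on {0<..<T}"

definition HH :: "real \<Rightarrow> nat \<Rightarrow> triple set" where
  "HH l k = {(u, trace l u 0, trace l u l) | u. u \<in> sobolev l k}"

definition HH1_norm :: "real \<Rightarrow> triple \<Rightarrow> real" where
  "HH1_norm l = (\<lambda>(u, a, b). sqrt ((norm u)\<^sup>2 + (norm (wderiv l u))\<^sup>2 + a\<^sup>2 + b\<^sup>2))"

definition energy_space :: "real \<Rightarrow> (triple \<times> triple) set" where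
  "energy_space l = HH l 1 \<times> LL2 l"

definition energy_space_norm :: "real \<Rightarrow> triple \<times> triple \<Rightarrow> real" where
  "energy_space_norm l = (\<lambda>(U, V). sqrt ((HH1_norm l U)\<^sup>2 + (norm V)\<^sup>2))"

text \<open>Groups on a linear subspace \<open>X\<close> that is normed by \<open>N\<close>; the norm of the surrounding type plays no
  role, and \<open>S t\<close> is unconstrained outside \<open>X\<close>.\<close>

definition C0_group_on ::
    "'a::real_vector set \<Rightarrow> ('a \<Rightarrow> real) \<Rightarrow> (real \<Rightarrow> 'a \<Rightarrow> 'a) \<Rightarrow> bool" where
  "C0_group_on X N S \<longleftrightarrow>
     (\<forall>t. \<forall>x\<in>X. S t x \<in> X) \<and>
     (\<forall>t. \<forall>x\<in>X. \<forall>y\<in>X. S t (x + y) = S t x + S t y) \<and>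
     (\<forall>t c. \<forall>x\<in>X. S t (c *\<^sub>R x) = c *\<^sub>R S t x) \<and>
     (\<forall>t. \<exists>M. \<forall>x\<in>X. N (S t x) \<le> M * N x) \<and>
     (\<forall>x\<in>X. S 0 x = x) \<and>
     (\<forall>s t. \<forall>x\<in>X. S (s + t) x = S s (S t x)) \<and>
     (\<forall>x\<in>X. ((\<lambda>t. N (S t x - x)) \<longlongrightarrow> 0) (at 0))"

text \<open>\<open>A\<close> with domain \<open>D\<close> is the infinitesimal generator of \<open>S\<close>.\<close>

definition generates_group ::
    "'a::real_vector set \<Rightarrow> ('a \<Rightarrow> real) \<Rightarrow> 'a set \<Rightarrow> ('a \<Rightarrow> 'a) \<Rightarrow> (real \<Rightarrow> 'a \<Rightarrow> 'a) \<Rightarrow> bool" where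
  "generates_group X N D A S \<longleftrightarrow> C0_group_on X N S \<and>
     (\<forall>x\<in>X. \<forall>y\<in>X. (x \<in> D \<and> y = A x) \<longleftrightarrow>
        ((\<lambda>h. N (inverse h *\<^sub>R (S h x - x) - y)) \<longlongrightarrow> 0) (at 0))"

definition wave_B :: "real \<Rightarrow> triple \<Rightarrow> triple" where
  "wave_B l = (\<lambda>(u, a, b).
     (wderiv l (wderiv l u), trace l (wderiv l u) 0, - trace l (wderiv l u) l))"

definition wave_A :: "real \<Rightarrow> triple \<times> triple \<Rightarrow> triple \<times> triple" where
  "wave_A l = (\<lambda>(U, V). (V, wave_B l U))"

definition wave_group :: "real \<Rightarrow> (real \<Rightarrow> triple \<times> triple \<Rightarrow> triple \<times> triple) \<Rightarrow> bool" where
  "wave_group l S \<longleftrightarrow>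
     generates_group (energy_space l) (energy_space_norm l) (HH l 2 \<times> HH l 1) (wave_A l) S"

definition source :: "(real \<times> real) L2 \<times> real L2 \<Rightarrow> real \<Rightarrow> triple \<times> triple" where
  "source = (\<lambda>(F, G) s. ((0, 0, 0), (L2_slice F s, rep_L2 G s, 0)))"

text \<open>\<open>mild S Z W t = (Y(t), Y\<^sub>t(t))\<close> for the group \<open>S\<close>, initial data \<open>Z\<close> and source \<open>W\<close>. The Bochner
  integral is taken in the surrounding Hilbert space; as the energy space embeds continuously,
  its value is that of the integral in the energy space. The complete measure \<open>lebesgue\<close> makes the
  null set of \<open>s\<close> on which the slice is not in \<open>L\<^sup>2(0,l)\<close> irrelevant.\<close>

definition mild ::
    "(real \<Rightarrow> triple \<times> triple \<Rightarrow> triple \<times> triple) \<Rightarrow> triple \<times> triple \<Rightarrow>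
     (real \<times> real) L2 \<times> real L2 \<Rightarrow> real \<Rightarrow> triple \<times> triple" where
  "mild S Z W t = S t Z + (LINT s:{0..t}|lebesgue. S (t - s) (source W s))"

definition final_state ::
    "(real \<Rightarrow> triple \<times> triple \<Rightarrow> triple \<times> triple) \<Rightarrow> real \<Rightarrow> triple \<times> triple \<Rightarrow>
     (real \<times> real) L2 \<times> real L2 \<Rightarrow> triple" where
  "final_state S T Z W = fst (mild S Z W T)"

definition cost ::
    "(real \<Rightarrow> triple \<times> triple \<Rightarrow> triple \<times> triple) \<Rightarrow> real \<Rightarrow> triple \<times> triple \<Rightarrow> triple \<Rightarrow>
     (real \<times> real) L2 \<times> real L2 \<Rightarrow> real" where
  "cost S T Z Yd W = 1 / 2 * (norm (final_state S T Z W - Yd))\<^sup>2"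

definition adjoint_state ::
    "(real \<Rightarrow> triple \<times> triple \<Rightarrow> triple \<times> triple) \<Rightarrow> real \<Rightarrow> triple \<times> triple \<Rightarrow> triple \<Rightarrow>
     (real \<times> real) L2 \<times> real L2 \<Rightarrow> real \<Rightarrow> triple" where
  "adjoint_state S T Z Yd W t = fst (S (t - T) (0, - (final_state S T Z W - Yd)))"

text \<open>The pair \<open>(\<phi>(t,x), \<phi>(t,0))\<close> in \<open>\<L>\<^sup>2\<^sub>T\<close>; the second entry of the triple \<open>adjoint_state\<close> is \<open>\<phi>(t,0)\<close>.\<close>

definition adjoint_gradient ::
    "(real \<Rightarrow> triple \<times> triple \<Rightarrow> triple \<times> triple) \<Rightarrow> real \<Rightarrow> real \<Rightarrow> triple \<times> triple \<Rightarrow> triple \<Rightarrow>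
     (real \<times> real) L2 \<times> real L2 \<Rightarrow> (real \<times> real) L2 \<times> real L2" where
  "adjoint_gradient S T l Z Yd W =
     (L2_of_path T l (\<lambda>t. fst (adjoint_state S T Z Yd W t)),
      abs_L2 (\<lambda>t. indicator {0<..<T} t * fst (snd (adjoint_state S T Z Yd W t))))"

definition frechet_gradient_on :: "'a::real_inner set \<Rightarrow> ('a \<Rightarrow> real) \<Rightarrow> 'a \<Rightarrow> 'a \<Rightarrow> bool" where
  "frechet_gradient_on V f x g \<longleftrightarrow> g \<in> V \<and> (f has_derivative (\<lambda>h. g \<bullet> h)) (at x within V)"

definition admissible ::
    "real \<Rightarrow> real \<Rightarrow> real \<Rightarrow> real \<Rightarrow> real \<Rightarrow> real \<Rightarrow> ((real \<times> real) L2 \<times> real L2) set" where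
  "admissible T l F_lo F_hi G_lo G_hi = {(F, G). (F, G) \<in> LL2T T l \<and>
     (AE z in lborel. z \<in> {0<..<T} \<times> {0<..<l} \<longrightarrow> F_lo \<le> rep_L2 F z \<and> rep_L2 F z \<le> F_hi) \<and>
     (AE t in lborel. t \<in> {0<..<T} \<longrightarrow> G_lo \<le> rep_L2 G t \<and> rep_L2 G t \<le> G_hi)}"

end

theory Submission
  imports Defs
begin

text \<open>Functions in \<open>H\<^sup>1(0,l)\<close> are exactly the functions \<open>c + \<integral>\<^sub>0\<^sup>x p\<close> with \<open>p \<in> L\<^sup>2(0,l)\<close>, so integration by parts
  gives \<open>\<langle>V, B U\<rangle> = - \<langle>V\<^sub>x, U\<^sub>x\<rangle>\<close>: the boundary terms cancel against the dynamic boundary conditions. Hence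
  along orbits in the domain the energy \<open>\<parallel>U\<^sub>x\<parallel>\<^sup>2 + \<parallel>U\<^sub>t\<parallel>\<^sup>2\<close> and the symplectic form \<open>\<langle>U, V\<^sub>t\<rangle> - \<langle>U\<^sub>t, V\<rangle>\<close> of two
  orbits are conserved. For the displacement \<open>R(t) V\<close> of the orbit with initial data \<open>(0, V)\<close> this yields, by
  density, \<open>\<parallel>R(t) V\<parallel> \<le> \<bar>t\<bar> \<parallel>V\<parallel>\<close> and \<open>\<langle>R(-t) V, W\<rangle> = - \<langle>V, R(t) W\<rangle>\<close>.

  The final state depends on the source through the linear map \<open>K W = \<integral>\<^sub>0\<^sup>T R(T - s) W(s) ds\<close>, whose norm is at
  most \<open>T\<^sup>3\<^sup>/\<^sup>2\<close> by the first estimate. By the second one the adjoint problem computes the adjoint of \<open>K\<close>, so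
  the cost is a quadratic functional with gradient \<open>K\<^sup>* (Y(T) - Y\<^sub>T)\<close>, and the gradient is Lipschitz with
  constant \<open>\<parallel>K\<parallel>\<^sup>2 \<le> T\<^sup>3\<close>, which is smaller than the stated one.\<close>

section \<open>The space \<open>L\<^sup>2\<close>\<close>

text \<open>The group is known only through its generator, so an orbit can be differentiated only
  for data in the domain. A pair \<open>(0, V)\<close> with \<open>V\<close> in
  \<open>HH l 1\<close> lies there, and such \<open>V\<close> are dense in \<open>LL2 l\<close>.
  Both estimates are therefore set up for data \<open>(0, V)\<close>, which is also the form of the
  source and of the terminal data of the adjoint problem. The energy controls velocities but not
  displacements, since nonzero constant states have zero energy; the displacement is recovered by
  integrating the velocity in time, which is where \<open>|t|\<close> comes from. Cauchy-Schwarz on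
  (0,T) then contributes sqrt T, whence the exponent 3/2. The other obstacle is that weak
  derivatives, traces and classes of paths are given by definite descriptions, while representatives
  and slices are fixed only up to null sets. The parametrization of H^1 by a constant and a
  derivative makes the first two explicit. Borel versions of slices and sources serve to compute the
  Bochner integral, and step paths to construct the class of a path.\<close>

lemma abs_L2_eq_iff:
  "square_integrable f \<Longrightarrow> square_integrable g \<Longrightarrow>
    abs_L2 f = abs_L2 g \<longleftrightarrow> (AE x in lborel. f x = g x)"
  using Quotient_rel[OF Quotient_L2, of f g] by (auto simp: L2_eq_def)

lemma rep_abs_L2_AE: "square_integrable f \<Longrightarrow> AE x in lborel. rep_L2 (abs_L2 f) x = f x"
  using rep_abs_L2[of f] by (auto simp: L2_eq_def elim: eventually_mono)

lemma rep_L2_measurable [measurable]: "rep_L2 F \<in> borel_measurable borel"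
  using rep_L2_square_integrable[of F] by (simp add: square_integrable_def)

lemma L2_eqI: "AE x in lborel. rep_L2 F x = rep_L2 G x \<Longrightarrow> F = G"
  by (metis abs_L2_eq_iff abs_rep_L2 rep_L2_square_integrable)

lemma inner_abs_L2:
  "square_integrable f \<Longrightarrow> square_integrable g \<Longrightarrow> abs_L2 f \<bullet> abs_L2 g = (\<integral>x. f x * g x \<partial>lborel)"
  by (simp add: inner_L2.abs_eq L2_eq_def)

lemma inner_L2_rep: "F \<bullet> G = (\<integral>x. rep_L2 F x * rep_L2 G x \<partial>lborel)"
  by (metis abs_rep_L2 inner_abs_L2 rep_L2_square_integrable)

lemma inner_abs_L2_left:
  "square_integrable f \<Longrightarrow> abs_L2 f \<bullet> G = (\<integral>x. f x * rep_L2 G x \<partial>lborel)"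
  by (metis abs_rep_L2 inner_abs_L2 rep_L2_square_integrable)

lemma norm_L2_rep: "(norm F)\<^sup>2 = (\<integral>x. (rep_L2 F x)\<^sup>2 \<partial>lborel)"
  unfolding power2_norm_eq_inner inner_L2_rep by (simp add: power2_eq_square)

lemma rep_L2_add: "AE x in lborel. rep_L2 (F + G) x = rep_L2 F x + rep_L2 G x"
  using rep_abs_L2_AE[OF square_integrable_add[OF rep_L2_square_integrable rep_L2_square_integrable, of F G]]
  by (simp add: abs_L2_add[symmetric] rep_L2_square_integrable abs_rep_L2)

lemma rep_L2_scaleR: "AE x in lborel. rep_L2 (c *\<^sub>R F) x = c * rep_L2 F x"
  using rep_abs_L2_AE[OF square_integrable_scale[OF rep_L2_square_integrable, of c F]]
  by (simp add: abs_L2_scale[symmetric] rep_L2_square_integrable abs_rep_L2)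

lemma rep_L2_zero: "AE x in lborel. rep_L2 0 x = 0"
  using rep_L2_scaleR[of 0 0] by simp

lemma square_integrable_indicator_mult:
  "A \<in> sets borel \<Longrightarrow> square_integrable f \<Longrightarrow> square_integrable (\<lambda>x. indicator A x * f x)"
  by (rule square_integrable_bound[of f]) (auto simp: square_integrable_def indicator_def)

definition L2_cut :: "'a::euclidean_space set \<Rightarrow> 'a L2 \<Rightarrow> 'a L2" where
  "L2_cut A F = abs_L2 (\<lambda>x. indicator A x * rep_L2 F x)"

context
  fixes A :: "'a::euclidean_space set"
  assumes A [measurable]: "A \<in> sets borel"
begin

lemma rep_cut: "AE x in lborel. rep_L2 (L2_cut A F) x = indicator A x * rep_L2 F x"
  unfolding L2_cut_def
  by (intro rep_abs_L2_AE square_integrable_indicator_mult A rep_L2_square_integrable)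

lemma cut_abs_L2:
  assumes "square_integrable f"
  shows "L2_cut A (abs_L2 f) = abs_L2 (\<lambda>x. indicator A x * f x)"
  unfolding L2_cut_def
  by (subst abs_L2_eq_iff)
    (use rep_abs_L2_AE[OF assms] in \<open>auto intro!: square_integrable_indicator_mult A assms rep_L2_square_integrable elim: eventually_mono\<close>)

text \<open>Turns an almost-everywhere condition into the fixed point equation of a bounded linear
  map, from which closedness and the subspace property of \<open>L2_on A\<close> follow at
  once.\<close>

lemma cut_eq_iff: "L2_cut A F = F \<longleftrightarrow> F \<in> L2_on A"
proof
  assume "L2_cut A F = F"
  with rep_cut[of F] show "F \<in> L2_on A"
    by (auto simp: L2_on_def elim!: eventually_mono)
next
  assume "F \<in> L2_on A"
  then have "AE x in lborel. rep_L2 (L2_cut A F) x = rep_L2 F x"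
    unfolding L2_on_def mem_Collect_eq using rep_cut[of F]
    by eventually_elim (auto simp: indicator_def)
  then show "L2_cut A F = F" by (rule L2_eqI)
qed

lemma cut_add: "L2_cut A (F + G) = L2_cut A F + L2_cut A G"
proof (rule L2_eqI)
  show "AE x in lborel. rep_L2 (L2_cut A (F + G)) x = rep_L2 (L2_cut A F + L2_cut A G) x"
    using rep_cut[of "F+G"] rep_cut[of F] rep_cut[of G] rep_L2_add[of "L2_cut A F" "L2_cut A G"] rep_L2_add[of F G]
    by eventually_elim (simp add: distrib_left)
qed

lemma cut_scaleR: "L2_cut A (c *\<^sub>R F) = c *\<^sub>R L2_cut A F"
proof (rule L2_eqI)
  show "AE x in lborel. rep_L2 (L2_cut A (c *\<^sub>R F)) x = rep_L2 (c *\<^sub>R L2_cut A F) x"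
    using rep_cut[of "c *\<^sub>R F"] rep_cut[of F] rep_L2_scaleR[of c "L2_cut A F"] rep_L2_scaleR[of c F]
    by eventually_elim (simp add: mult.left_commute)
qed

lemma norm_cut_le: "norm (L2_cut A F) \<le> norm F"
proof -
  have 1: "square_integrable (\<lambda>x. indicator A x * rep_L2 F x)"
    by (intro square_integrable_indicator_mult A rep_L2_square_integrable)
  have "(norm (L2_cut A F))\<^sup>2 = (\<integral>x. (indicator A x * rep_L2 F x)\<^sup>2 \<partial>lborel)"
    unfolding L2_cut_def using 1 by (simp add: norm_abs_L2)
  also have "\<dots> \<le> (\<integral>x. (rep_L2 F x)\<^sup>2 \<partial>lborel)"
    using 1 rep_L2_square_integrable[of F]
    by (intro integral_mono) (auto simp: square_integrable_def indicator_def)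
  finally show ?thesis by (simp add: norm_L2_rep[symmetric])
qed

lemma bounded_linear_cut: "bounded_linear (L2_cut A)"
  by (rule bounded_linear_intro[where K=1]) (auto simp: cut_add cut_scaleR norm_cut_le)

lemma cut_in_L2_on: "L2_cut A F \<in> L2_on A"
  unfolding L2_on_def mem_Collect_eq using rep_cut[of F] by eventually_elim auto

lemma abs_L2_indicator_mem: "square_integrable f \<Longrightarrow> abs_L2 (\<lambda>x. indicator A x * f x) \<in> L2_on A"
  using cut_in_L2_on cut_abs_L2 by metis

lemma closed_L2_on: "closed (L2_on A)"
proof -
  have "closed {F. L2_cut A F = F}"
    by (intro closed_Collect_eq bounded_linear.continuous_on[OF bounded_linear_cut] continuous_on_id)
  then show ?thesis by (simp add: cut_eq_iff)
qed

lemma subspace_L2_on: "subspace (L2_on A)"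
  unfolding subspace_def by (simp add: cut_eq_iff[symmetric] cut_add cut_scaleR linear_0 bounded_linear.linear[OF bounded_linear_cut])

end

lemma square_integrable_continuous_support:
  fixes f :: "real \<Rightarrow> real"
  assumes "continuous_on UNIV f" "\<And>x. x \<notin> {a..b} \<Longrightarrow> f x = 0"
  shows "square_integrable f"
proof -
  have [measurable]: "f \<in> borel_measurable borel" using assms(1) by (rule borel_measurable_continuous_onI)
  have "compact (f ` {a..b})"
    by (intro compact_continuous_image continuous_on_subset[OF assms(1)]) auto
  then obtain B where B: "\<And>x. x \<in> {a..b} \<Longrightarrow> \<bar>f x\<bar> \<le> B"
    by (metis (no_types) compact_imp_bounded bounded_iff image_eqI real_norm_def)
  have B': "\<And>x. x \<in> {a..b} \<Longrightarrow> \<bar>f x\<bar> \<le> \<bar>B\<bar>" using B by fastforce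
  show ?thesis
  proof (rule square_integrable_bound[where g="\<lambda>x. B * indicator {a..b} x"])
    show "square_integrable (\<lambda>x. B * indicator {a..b} x)"
      by (intro square_integrable_scale square_integrable_indicator) (auto simp: emeasure_lborel_Icc_eq)
    show "\<bar>f x\<bar> \<le> \<bar>B * indicator {a..b} x\<bar>" for x
      using assms(2)[of x] B'[of x] by (cases "x \<in> {a..b}") auto
  qed simp
qed

section \<open>Density in \<open>L\<^sup>2(0,l)\<close>\<close>

text \<open>A density principle, phrased for closed subspaces so that it applies directly to
  orthogonal complements. Since \<open>rat_span\<close> is dense and an element of
  \<open>L2_on {0<..<l}\<close> equals its own cut, only indicators of open subsets of the interval
  matter, and these are monotone limits of truncated distance functions.\<close>

lemma L2_on_interval_subset:
  fixes M :: "real L2 set"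
  assumes M: "closed M" "subspace M"
    and cont: "\<And>f a b. continuous_on UNIV f \<Longrightarrow> 0 < a \<Longrightarrow> b < l \<Longrightarrow>
      (\<And>x. x \<notin> {a..b} \<Longrightarrow> f x = 0) \<Longrightarrow> abs_L2 f \<in> M"
  shows "L2_on {0<..<l} \<subseteq> M"
proof -
  let ?I = "{0<..<l}"
  have op: "abs_L2 (indicator (U \<inter> ?I)) \<in> M" if U: "open U" for U
  proof -
    let ?C = "- (U \<inter> ?I)"
    \<comment> \<open>The shift by 1 makes \<open>f n\<close> vanish within distance
      \<open>1 / Suc n\<close> of the complement, so its support stays in a compact part of the
      interval.\<close>
    define f where "f n x = max 0 (min 1 (real (Suc n) * infdist x ?C - 1))" for n :: nat and x
    have "open (U \<inter> ?I)" using U by (intro open_Int) auto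
    then have C: "closed ?C" "0 \<in> ?C" "l \<in> ?C" by (simp_all only: closed_Compl) auto
    have cf: "continuous_on UNIV (f n)" for n
      unfolding f_def by (intro continuous_intros)
    have zero: "f n x = 0" if "x \<notin> {1 / Suc n..l - 1 / Suc n}" for n x
    proof -
      have "infdist x ?C \<le> 1 / Suc n"
      proof (cases "x \<in> ?C")
        case False
        have "infdist x ?C \<le> \<bar>x - 0\<bar>" "infdist x ?C \<le> \<bar>x - l\<bar>"
          using infdist_le[OF C(2), of x] infdist_le[OF C(3), of x] by (auto simp: dist_real_def)
        then show ?thesis using that False by auto
      qed simp
      then show ?thesis by (simp add: f_def field_simps)
    qed
    have le: "\<bar>f n x\<bar> \<le> \<bar>indicator ?I x\<bar>" for n x
    proof (cases "x \<in> ?I")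
      case False
      then have "infdist x ?C = 0" by (intro infdist_zero) auto
      then show ?thesis by (simp add: f_def)
    qed (auto simp: f_def)
    have "(\<lambda>n. abs_L2 (f n)) \<longlonglongrightarrow> abs_L2 (indicator (U \<inter> ?I))"
    proof (rule tendsto_abs_L2(2)[where w="indicator ?I"])
      show "square_integrable (f n)" for n
        using cf zero by (rule square_integrable_continuous_support)
      show "square_integrable (indicator ?I :: real \<Rightarrow> real)"
        by (rule square_integrable_indicator, simp) (rule emeasure_bounded_finite, simp)
      show "(\<lambda>n. f n x) \<longlonglongrightarrow> indicator (U \<inter> ?I) x" for x
      proof (cases "x \<in> ?C")
        case False
        then have "0 < infdist x ?C" using C by (intro infdist_pos_not_in_closed) auto
        then obtain N :: nat where N: "2 < real N * infdist x ?C" using reals_Archimedean3 by blast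
        have "\<forall>\<^sub>F n in sequentially. f n x = 1"
        proof (rule eventually_sequentiallyI[of N])
          fix n assume "N \<le> n"
          then have "real N * infdist x ?C \<le> real (Suc n) * infdist x ?C"
            by (intro mult_right_mono) (auto simp: infdist_nonneg)
          then show "f n x = 1" using N by (simp add: f_def)
        qed
        then show ?thesis using False by (simp add: tendsto_eventually)
      qed (simp add: f_def)
      show "(indicator (U \<inter> ?I) :: real \<Rightarrow> real) \<in> borel_measurable lborel"
        using U by (intro borel_measurable_indicator) (auto intro!: sets.Int borel_open)
    qed (rule le)
    moreover have "abs_L2 (f n) \<in> M" for n
      by (rule cont[OF cf _ _ zero]) auto
    ultimately show ?thesis using M(1) by (metis closed_sequentially)
  qed
  have I: "?I \<in> sets borel" by simp
  have box: "L2_cut ?I c \<in> M" if "c \<in> box_union_classes" for c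
  proof -
    from that obtain \<B> n where c: "c = abs_L2 (indicator (\<Union>\<B> \<inter> ball 0 (real n)))"
      and \<B>: "\<B> \<subseteq> (SOME B. countable B \<and> topological_basis B)"
      by (auto simp: box_union_classes_def)
    have o: "open (\<Union>\<B>)"
      using \<B> topological_basis_open[OF some_basis(2)[where 'a=real]] by blast
    have "L2_cut ?I c = abs_L2 (\<lambda>x. indicator ?I x * indicator (\<Union>\<B> \<inter> ball 0 (real n)) x)"
      unfolding c by (rule cut_abs_L2[OF I]) (rule square_integrable_indicator_ball, use o in auto)
    also have "(\<lambda>x. indicator ?I x * indicator (\<Union>\<B> \<inter> ball 0 (real n)) x :: real) =
        indicator (\<Union>\<B> \<inter> ball 0 (real n) \<inter> ?I)"
      by (auto simp: indicator_def fun_eq_iff)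
    finally show ?thesis using op[of "\<Union>\<B> \<inter> ball 0 (real n)"] o by (simp only:) (intro op, auto)
  qed
  have "L2_cut ?I (\<Sum>(q, c)\<leftarrow>xs. of_rat q *\<^sub>R c) \<in> M" if "set xs \<subseteq> UNIV \<times> box_union_classes" for xs
    using that
  proof (induction xs)
    case Nil
    then show ?case using subspace_0[OF M(2)] by (simp add: linear_0 bounded_linear.linear[OF bounded_linear_cut[OF I]])
  next
    case (Cons p xs)
    then show ?case using box by (auto simp: cut_add[OF I] cut_scaleR[OF I] intro!: subspace_add[OF M(2)] subspace_scale[OF M(2)])
  qed
  then have "rat_span \<subseteq> L2_cut ?I -` M" by (auto simp: rat_span_def)
  moreover have "closed (L2_cut ?I -` M)"
    by (intro closed_vimage M bounded_linear.continuous_on[OF bounded_linear_cut[OF I]] continuous_on_id)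
  ultimately have "closure rat_span \<subseteq> L2_cut ?I -` M" by (rule closure_minimal)
  then show ?thesis using cut_eq_iff[OF I] by (auto simp: closure_rat_span_UNIV) (metis UNIV_I subsetD vimageE)
qed

lemma square_integrable_indicator_continuous:
  fixes f :: "real \<Rightarrow> real"
  assumes f: "continuous_on {a..b} f"
  shows "square_integrable (\<lambda>x. indicator {a<..<b} x * f x)"
proof -
  have [measurable]: "(\<lambda>x. indicator {a<..<b} x * f x) \<in> borel_measurable borel"
    using borel_measurable_continuous_on_indicator[of "{a<..<b}" f] continuous_on_subset[OF f, of "{a<..<b}"]
    by (simp add: subset_iff)
  have "compact (f ` {a..b})"
    by (intro compact_continuous_image f) auto
  then obtain B where B: "\<And>x. x \<in> {a..b} \<Longrightarrow> \<bar>f x\<bar> \<le> B"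
    by (metis (no_types) compact_imp_bounded bounded_iff image_eqI real_norm_def)
  have B': "\<And>x. x \<in> {a..b} \<Longrightarrow> \<bar>f x\<bar> \<le> \<bar>B\<bar>" using B by fastforce
  show ?thesis
  proof (rule square_integrable_bound[where g="\<lambda>x. B * indicator {a<..<b} x"])
    show "square_integrable (\<lambda>x. B * indicator {a<..<b} x)"
      by (intro square_integrable_scale square_integrable_indicator emeasure_bounded_finite) auto
    show "\<bar>indicator {a<..<b} x * f x\<bar> \<le> \<bar>B * indicator {a<..<b} x\<bar>" for x
      using B'[of x] by (cases "x \<in> {a<..<b}") auto
  qed simp
qed

text \<open>Uniform approximation on the closed interval implies approximation in L^2. Polynomials
  are the convenient test class because their derivatives and boundary values are explicit.\<close>

lemma L2_on_interval_subset_polynomial: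
  fixes M :: "real L2 set"
  assumes l: "0 < l" and M: "closed M" "subspace M"
    and poly: "\<And>f :: real \<Rightarrow> real. polynomial_function f \<Longrightarrow> abs_L2 (\<lambda>x. indicator {0<..<l} x * f x) \<in> M"
  shows "L2_on {0<..<l} \<subseteq> M"
proof (rule L2_on_interval_subset[OF M])
  fix f :: "real \<Rightarrow> real" and a b
  assume f: "continuous_on UNIV f" "0 < a" "b < l" "\<And>x. x \<notin> {a..b} \<Longrightarrow> f x = 0"
  let ?I = "{0<..<l}"
  have fI: "(\<lambda>x. indicator ?I x * f x) = f"
  proof
    fix x show "indicator ?I x * f x = f x"
    proof (cases "x \<in> {a..b}")
      case True
      then have "x \<in> ?I" using f(2,3) by simp
      then show ?thesis by simp
    qed (simp add: f(4))
  qed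
  have cf: "continuous_on {0..l} f" using f(1) continuous_on_subset by blast
  have "\<exists>g. polynomial_function g \<and> (\<forall>x\<in>{0..l}. norm (f x - g x) < 1 / Suc n)" for n
    by (rule Stone_Weierstrass_polynomial_function[OF compact_Icc cf]) auto
  then obtain g where g: "\<And>n. polynomial_function (g n)"
    "\<And>n x. x \<in> {0..l} \<Longrightarrow> \<bar>f x - g n x\<bar> < 1 / Suc n" by (metis real_norm_def)
  have cg: "continuous_on {0..l} (g n)" for n
    using g(1) continuous_on_polymonial_function by blast
  have sg: "square_integrable (\<lambda>x. indicator ?I x * g n x)" for n
    by (rule square_integrable_indicator_continuous[OF cg])
  have sf: "square_integrable (\<lambda>x. indicator ?I x * f x)"
    by (rule square_integrable_indicator_continuous[OF cf])
  have "(\<lambda>n. abs_L2 (\<lambda>x. indicator ?I x * g n x)) \<longlonglongrightarrow> abs_L2 (\<lambda>x. indicator ?I x * f x)"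
  proof (rule tendsto_abs_L2(2)[OF sg])
    show "(\<lambda>x. indicat_real {0<..<l} x * f x) \<in> borel_measurable lborel"
      using sf by (simp add: square_integrable_def)
    \<comment> \<open>All uniform errors are below \<open>1 / Suc n\<close>, hence below 1, so
      \<open>|f| + 1\<close> dominates every \<open>g n\<close>.\<close>
    show "square_integrable (\<lambda>x. indicator ?I x * (\<bar>f x\<bar> + 1))"
      by (rule square_integrable_indicator_continuous) (intro continuous_intros cf)
    show "\<bar>indicat_real {0<..<l} x * g n x\<bar> \<le> \<bar>indicat_real {0<..<l} x * (\<bar>f x\<bar> + 1)\<bar>" for n x
    proof (cases "x \<in> ?I")
      case True
      have "(1::real) / Suc n \<le> 1" by simp
      moreover have "\<bar>f x - g n x\<bar> < 1 / Suc n" using g(2) True by auto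
      ultimately have "\<bar>g n x\<bar> \<le> \<bar>f x\<bar> + 1" by linarith
      then show ?thesis by (simp add: indicator_def)
    qed simp
    show "(\<lambda>n. indicat_real ?I x * g n x) \<longlonglongrightarrow> indicat_real ?I x * f x" for x
    proof (cases "x \<in> ?I")
      case True
      have "(\<lambda>n. g n x - f x) \<longlonglongrightarrow> 0"
      proof (rule Lim_null_comparison)
        show "\<forall>\<^sub>F n in sequentially. norm (g n x - f x) \<le> 1 / real (Suc n)"
          using g(2)[of x] True by (intro always_eventually allI) (auto simp: abs_minus_commute intro: less_imp_le)
      qed (rule LIMSEQ_Suc[OF lim_1_over_n])
      then show ?thesis using True by (simp add: LIM_zero_cancel)
    qed simp
  qed
  then have "abs_L2 (\<lambda>x. indicator ?I x * f x) \<in> M"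
    by (rule closed_sequentially[OF M(1), rotated]) (rule poly[OF g(1)])
  then show "abs_L2 f \<in> M" by (simp only: fI)
qed

section \<open>Sobolev functions on an interval\<close>

lemma integral_indicator_atLeast_eq_greaterThan:
  fixes f :: "real \<Rightarrow> real"
  assumes [measurable]: "f \<in> borel_measurable borel"
  shows "(LBINT x. indicator {c..} x * f x) = (LBINT x. indicator {c<..} x * f x)"
proof (rule integral_cong_AE)
  show "AE x in lborel. indicator {c..} x * f x = indicator {c<..} x * f x"
    using AE_lborel_singleton[of c] by eventually_elim (auto simp: indicator_def)
qed auto

text \<open>Integration by parts without differentiating: Fubini for \<open>f x * g y\<close>, with
  the plane split along the diagonal. Each half plane gives one of the two products of a function
  with a primitive.\<close>

lemma integral_by_parts_atMost:
  fixes f g :: "real \<Rightarrow> real"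
  assumes f: "integrable lborel f" and g: "integrable lborel g"
  shows "(LBINT x. f x * (LBINT y. indicator {..x} y * g y)) +
      (LBINT x. g x * (LBINT y. indicator {..x} y * f y)) = (LBINT x. f x) * (LBINT x. g x)"
proof -
  have [measurable]: "f \<in> borel_measurable borel" "g \<in> borel_measurable borel"
    using f g by auto
  let ?h = "\<lambda>x y. f x * g y"
  have h: "integrable (lborel \<Otimes>\<^sub>M lborel) (case_prod ?h)"
  proof (rule lborel_pair.Fubini_integrable)
    show "integrable lborel (\<lambda>x. LBINT y. norm (case (x, y) of (x, y) \<Rightarrow> f x * g y))"
      using f by (simp add: abs_mult)
    show "AE x in lborel. integrable lborel (\<lambda>y. case (x, y) of (x, y) \<Rightarrow> f x * g y)"
      using g by simp
  qed auto
  have h1: "integrable (lborel \<Otimes>\<^sub>M lborel) (\<lambda>(x, y). indicator {..x} y * ?h x y)"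
    by (rule Bochner_Integration.integrable_bound[OF h]) (auto simp: indicator_def)
  have h2: "integrable (lborel \<Otimes>\<^sub>M lborel) (\<lambda>(x, y). indicator {x<..} y * ?h x y)"
    by (rule Bochner_Integration.integrable_bound[OF h]) (auto simp: indicator_def)
  have 1: "(LBINT x. f x * (LBINT y. indicator {..x} y * g y)) =
      (\<integral>z. (\<lambda>(x, y). indicator {..x} y * ?h x y) z \<partial>(lborel \<Otimes>\<^sub>M lborel))"
    using lborel_pair.integral_fst'[OF h1]
    by (simp add: mult.left_commute[of _ "f _"])
  have "(LBINT x. g x * (LBINT y. indicator {..x} y * f y)) =
      (LBINT y. LBINT x. indicator {x..} y * ?h x y)"
    by (simp add: mult.commute[of _ "g _"] mult.left_commute[of _ "g _"] indicator_def cong: if_cong)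
  also have "\<dots> = (LBINT x. LBINT y. indicator {x..} y * ?h x y)"
    by (rule lborel_pair.Fubini_integral) (rule Bochner_Integration.integrable_bound[OF h], auto simp: indicator_def)
  \<comment> \<open>The diagonal is dropped from one half, so that the two half planes partition the
    plane.\<close>
  also have "\<dots> = (LBINT x. LBINT y. indicator {x<..} y * ?h x y)"
    by (intro Bochner_Integration.integral_cong refl integral_indicator_atLeast_eq_greaterThan) auto
  also have "\<dots> = (\<integral>z. (\<lambda>(x, y). indicator {x<..} y * ?h x y) z \<partial>(lborel \<Otimes>\<^sub>M lborel))"
    using lborel_pair.integral_fst'[OF h2] by simp
  finally have 2: "(LBINT x. g x * (LBINT y. indicator {..x} y * f y)) = \<dots>" .
  have "(LBINT x. f x * (LBINT y. indicator {..x} y * g y)) +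
      (LBINT x. g x * (LBINT y. indicator {..x} y * f y)) =
      (\<integral>z. (\<lambda>(x, y). indicator {..x} y * ?h x y) z + (\<lambda>(x, y). indicator {x<..} y * ?h x y) z \<partial>(lborel \<Otimes>\<^sub>M lborel))"
    unfolding 1 2 using h1 h2 by simp
  also have "\<dots> = (\<integral>z. case_prod ?h z \<partial>(lborel \<Otimes>\<^sub>M lborel))"
    by (rule Bochner_Integration.integral_cong) (auto simp: indicator_def)
  also have "\<dots> = (LBINT x. f x) * (LBINT x. g x)"
    using lborel_pair.integral_fst'[OF h] by simp
  finally show ?thesis .
qed

text \<open>Dominated convergence: the indicators converge at every point except possibly the limit
  point itself.\<close>

lemma continuous_on_integral_atMost:
  fixes f :: "real \<Rightarrow> real"
  assumes f: "integrable lborel f"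
  shows "continuous_on UNIV (\<lambda>x. LBINT y. indicator {..x} y * f y)"
  unfolding continuous_on_sequentially
proof (intro allI ballI impI, elim conjE)
  fix X :: "nat \<Rightarrow> real" and x assume X: "X \<longlonglongrightarrow> x"
  have [measurable]: "f \<in> borel_measurable borel" using f by auto
  show "((\<lambda>x. LBINT y. indicator {..x} y * f y) \<circ> X) \<longlonglongrightarrow> (LBINT y. indicator {..x} y * f y)"
    unfolding comp_def
  proof (rule integral_dominated_convergence[where w="\<lambda>x. norm (f x)"])
    show "AE y in lborel. (\<lambda>i. indicator {..X i} y * f y) \<longlonglongrightarrow> indicator {..x} y * f y"
      using AE_lborel_singleton[of x]
    proof eventually_elim
      case (elim y)
      have "\<forall>\<^sub>F i in sequentially. indicator {..X i} y * f y = indicator {..x} y * f y"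
      proof (cases "y < x")
        case True
        from order_tendstoD(1)[OF X this] show ?thesis
          by eventually_elim (use True in auto)
      next
        case False
        then have "x < y" using elim by simp
        from order_tendstoD(2)[OF X this] show ?thesis
          by eventually_elim (use False elim in auto)
      qed
      then show ?case by (rule tendsto_eventually)
    qed
  qed (use f in \<open>auto simp: indicator_def\<close>)
qed

text \<open>The coincidence set is closed and has full measure in the open interval, so it contains
  the interval and then its closure. Reaching the endpoints is what makes boundary traces
  unique.\<close>

lemma continuous_eq_on_Icc_if_AE:
  fixes f g :: "real \<Rightarrow> real"
  assumes l: "0 < l" and f: "continuous_on {0..l} f" and g: "continuous_on {0..l} g"
    and eq: "AE x in lborel. x \<in> {0<..<l} \<longrightarrow> f x = g x"
    and x: "x \<in> {0..l}"
  shows "f x = g x"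
proof -
  let ?C = "{x\<in>{0..l}. f x - g x = 0}"
  have "closed ?C"
    by (intro continuous_closed_preimage_constant continuous_intros f g)
  moreover have "AE x\<in>{0<..<l} in lebesgue. x \<in> ?C"
    using AE_completion[OF eq] by eventually_elim auto
  ultimately have "{0<..<l} \<subseteq> ?C"
    by (intro subsetI mem_closed_if_AE_lebesgue_open[of "{0<..<l}" ?C]) (simp_all only: open_greaterThanLessThan)
  then have "closure {0<..<l} \<subseteq> ?C"
    using \<open>closed ?C\<close> by (rule closure_minimal)
  then show ?thesis using l x by auto
qed

text \<open>For \<open>p\<close> in \<open>L2_on {0<..<l}\<close> this is the primitive that
  vanishes at 0; integrating from minus infinity matches the form of
  \<open>integral_by_parts_atMost\<close>.\<close>

definition L2_prim :: "real L2 \<Rightarrow> real \<Rightarrow> real" where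
  "L2_prim p x = (LBINT s. indicator {..x} s * rep_L2 p s)"

text \<open>For such \<open>p\<close> this is the H^1 function with value \<open>c\<close> at 0 and
  weak derivative \<open>p\<close>.\<close>

definition H1_fun :: "real \<Rightarrow> real \<Rightarrow> real L2 \<Rightarrow> real L2" where
  "H1_fun l c p = abs_L2 (\<lambda>x. indicator {0<..<l} x * (c + L2_prim p x))"

text \<open>An antiderivative of a compactly supported function is constant on either side of the
  support; zero mean makes the two constants agree, so subtracting the constant leaves compact
  support.\<close>

lemma test_function_of_continuous:
  fixes h :: "real \<Rightarrow> real"
  assumes h: "continuous_on UNIV h" "0 < a" "b < l" "\<And>x. x \<notin> {a..b} \<Longrightarrow> h x = 0"
    and int: "(LBINT x. h x) = 0"
  obtains \<psi> where "test_function l \<psi>" "deriv \<psi> = h"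
proof -
  have "\<exists>F. \<forall>x::real. -\<infinity> < ereal x \<longrightarrow> ereal x < \<infinity> \<longrightarrow> (F has_vector_derivative h x) (at x)"
    by (rule einterval_antiderivative) (use h(1) in \<open>auto simp: continuous_on_eq_continuous_at\<close>)
  then obtain F where F: "\<And>x. (F has_vector_derivative h x) (at x)" by auto
  have FTC: "(LBINT x. indicator {c..d} x *\<^sub>R h x) = F d - F c" if "c \<le> d" for c d
    by (rule integral_FTC_Icc[OF that])
      (use F h(1) in \<open>auto intro: has_vector_derivative_at_within continuous_on_subset\<close>)
  have "F x = F 0" if "x \<notin> {a..b}" for x
  proof (cases "x < 0" "x < a" rule: bool.exhaust[case_product bool.exhaust])
    case True_True
    then have "indicator {x..0} y *\<^sub>R h y = 0" for y
      using h(2) h(4)[of y] by (auto simp: indicator_def)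
    then have "(LBINT y. indicator {x..0} y *\<^sub>R h y) = 0"
      by (simp only: Bochner_Integration.integral_zero)
    then show ?thesis using FTC[of x 0] True_True by simp
  next
    case False_True
    then have "indicator {0..x} y *\<^sub>R h y = 0" for y
      using h(4)[of y] by (auto simp: indicator_def)
    then have "(LBINT y. indicator {0..x} y *\<^sub>R h y) = 0"
      by (simp only: Bochner_Integration.integral_zero)
    then show ?thesis using FTC[of 0 x] False_True by simp
  next
    case False_False
    then have "indicator {0..x} y *\<^sub>R h y = h y" for y
      using h(2) h(4)[of y] that by (cases "y \<in> {a..b}") (auto simp: indicator_def)
    then have "(LBINT y. indicator {0..x} y *\<^sub>R h y) = (LBINT y. h y)"
      by (simp only:)
    then show ?thesis using FTC[of 0 x] False_False int by simp
  qed (use h(2) in auto)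
  then have F0: "\<And>x. x \<notin> {a..b} \<Longrightarrow> F x - F 0 = 0" by simp
  have dF: "((\<lambda>x. F x - F 0) has_vector_derivative h x) (at x)" for x
    using has_vector_derivative_diff[OF F[of x] has_vector_derivative_const[of "F 0"]] by simp
  have "test_function l (\<lambda>x. F x - F 0)"
    unfolding test_function_def C1_differentiable_on_def
    using dF F0 h(1-3) by (intro conjI exI[of _ h] exI[of _ a] exI[of _ b] ballI allI impI)
  moreover have "deriv (\<lambda>x. F x - F 0) = h"
  proof
    fix x
    show "deriv (\<lambda>x. F x - F 0) x = h x"
      using dF[of x]
      by (intro DERIV_imp_deriv) (simp add: has_real_derivative_iff_has_vector_derivative)
  qed
  ultimately show ?thesis by (rule that)
qed

lemma test_functionD:
  assumes "test_function l \<psi>" "0 < l"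
  obtains a b where "0 < a" "b < l" "continuous_on UNIV (deriv \<psi>)" "continuous_on UNIV \<psi>"
    "\<And>x. x \<notin> {a..b} \<Longrightarrow> \<psi> x = 0" "\<And>x. x \<notin> {a..b} \<Longrightarrow> deriv \<psi> x = 0"
    "\<And>x. \<psi> x = (LBINT s. indicator {..x} s * deriv \<psi> s)" "(LBINT s. deriv \<psi> s) = 0"
proof -
  from assms obtain D a0 b0 where D: "\<And>x. (\<psi> has_vector_derivative D x) (at x)" "continuous_on UNIV D"
    and ab: "0 < a0" "b0 < l" "\<And>x. x \<notin> {a0..b0} \<Longrightarrow> \<psi> x = 0"
    unfolding test_function_def C1_differentiable_on_def by auto
  \<comment> \<open>The given bounds may come in the wrong order when the function is zero;
    including the midpoint gives a nonempty interval inside (0,l).\<close>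
  define a where "a = min a0 (l/2)"
  define b where "b = max b0 (l/2)"
  have ab: "0 < a" "a \<le> b" "b < l" "\<And>x. x \<notin> {a..b} \<Longrightarrow> \<psi> x = 0"
  proof -
    show "\<psi> x = 0" if "x \<notin> {a..b}" for x
      by (rule ab(3)) (use that in \<open>auto simp: a_def b_def\<close>)
  qed (use ab assms(2) in \<open>auto simp: a_def b_def\<close>)
  have [simp]: "deriv \<psi> = D"
    using D(1) by (auto intro!: DERIV_imp_deriv simp: has_real_derivative_iff_has_vector_derivative)
  have c: "continuous_on UNIV \<psi>"
    using D(1) by (auto intro!: continuous_at_imp_continuous_on has_vector_derivative_continuous)
  have D0: "D x = 0" if x: "x \<notin> {a..b}" for x
  proof -
    have "((\<lambda>x. 0) has_vector_derivative D x) (at x)"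
      by (rule has_vector_derivative_transform_within_open[OF D(1), of "- {a..b}"]) (use x ab in auto)
    then show ?thesis
      using has_vector_derivative_const by (rule vector_derivative_unique_at)
  qed
  have FTC: "(LBINT x. indicator {c..d} x *\<^sub>R D x) = \<psi> d - \<psi> c" if "c \<le> d" for c d
    by (rule integral_FTC_Icc[OF that])
      (use D in \<open>auto intro: has_vector_derivative_at_within continuous_on_subset\<close>)
  have 1: "\<psi> x = (LBINT s. indicator {..x} s * D s)" for x
  proof (cases "x < a")
    case True
    then have "indicator {..x} s * D s = 0" for s using D0[of s] by (auto simp: indicator_def)
    then have "(LBINT s. indicator {..x} s * D s) = 0"
      by (simp only: Bochner_Integration.integral_zero)
    then show ?thesis using True ab(4)[of x] by simp
  next
    case False
    have "indicator {..x} s * D s = indicator {0..x} s *\<^sub>R D s" for s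
      using D0[of s] ab(1) by (auto simp: indicator_def)
    then have "(LBINT s. indicator {..x} s * D s) = (LBINT s. indicator {0..x} s *\<^sub>R D s)"
      by (simp only:)
    then show ?thesis using FTC[of 0 x] False ab(1) ab(4)[of 0] by simp
  qed
  have "indicator {..l} s * D s = D s" for s
    using D0[of s] ab by (cases "s \<in> {a..b}") (auto simp: indicator_def)
  then have "(LBINT s. indicator {..l} s * D s) = (LBINT s. D s)"
    by (simp only:)
  then have 2: "(LBINT s. D s) = 0"
    using 1[of l] ab(3) ab(4)[of l] by simp
  show ?thesis
    using that[of a b] ab D(2) D0 1 2 c by simp
qed

lemma L2_on_AE: "p \<in> L2_on A \<Longrightarrow> AE x in lborel. x \<notin> A \<longrightarrow> rep_L2 p x = 0"
  unfolding L2_on_def by simp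

lemma L2_on_add: "A \<in> sets borel \<Longrightarrow> p \<in> L2_on A \<Longrightarrow> q \<in> L2_on A \<Longrightarrow> p + q \<in> L2_on A"
  by (metis subspace_L2_on subspace_add)

lemma L2_on_diff: "A \<in> sets borel \<Longrightarrow> p \<in> L2_on A \<Longrightarrow> q \<in> L2_on A \<Longrightarrow> p - q \<in> L2_on A"
  by (metis subspace_L2_on subspace_diff)

lemma L2_on_scaleR: "A \<in> sets borel \<Longrightarrow> p \<in> L2_on A \<Longrightarrow> c *\<^sub>R p \<in> L2_on A"
  by (metis subspace_L2_on subspace_scale)

lemma square_integrable_indicator_interval: "square_integrable (indicator {a<..<b} :: real \<Rightarrow> real)"
  by (rule square_integrable_indicator, simp) (rule emeasure_bounded_finite, simp)

lemma square_integrable_imp_integrable_interval: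
  assumes "square_integrable f"
  shows "integrable lborel (\<lambda>x. indicator {a<..<b::real} x * f x)"
  by (rule square_integrable_mult[OF square_integrable_indicator_interval assms])

section \<open>Functions in H^1(0,l) as primitives\<close>

locale interval =
  fixes l :: real
  assumes l: "0 < l"
begin

lemma rep_L2_integrable:
  assumes p: "p \<in> L2_on {0<..<l}"
  shows "integrable lborel (rep_L2 p)"
proof -
  have "integrable lborel (\<lambda>x. indicator {0<..<l} x * rep_L2 p x)"
    by (rule square_integrable_imp_integrable_interval[OF rep_L2_square_integrable])
  then show ?thesis
  proof (rule integrable_cong_AE_imp)
    show "AE x in lborel. indicator {0<..<l} x * rep_L2 p x = rep_L2 p x"
      using L2_on_AE[OF p] by eventually_elim (auto simp: indicator_def)
  qed simp
qed

lemma integral_rep_L2: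
  assumes p: "p \<in> L2_on {0<..<l}"
  shows "(LBINT x. rep_L2 p x) = L2_prim p l"
  unfolding L2_prim_def
proof (rule integral_cong_AE)
  show "AE x in lborel. rep_L2 p x = indicator {..l} x * rep_L2 p x"
    using L2_on_AE[OF p] by eventually_elim (auto simp: indicator_def)
qed auto

lemma L2_prim_0:
  assumes p: "p \<in> L2_on {0<..<l}"
  shows "L2_prim p 0 = 0"
proof -
  have "L2_prim p 0 = (LBINT x::real. (0::real))"
    unfolding L2_prim_def
  proof (rule integral_cong_AE)
    show "AE x in lborel. indicator {..0} x * rep_L2 p x = 0"
      using L2_on_AE[OF p] by eventually_elim (auto simp: indicator_def)
  qed auto
  then show ?thesis by simp
qed

lemma continuous_L2_prim:
  assumes p: "p \<in> L2_on {0<..<l}"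
  shows "continuous_on A (L2_prim p)"
  using continuous_on_integral_atMost[OF rep_L2_integrable[OF p]] continuous_on_subset
  unfolding L2_prim_def[abs_def] by blast

lemma L2_prim_add:
  assumes p: "p \<in> L2_on {0<..<l}" and q: "q \<in> L2_on {0<..<l}"
  shows "L2_prim (p + q) x = L2_prim p x + L2_prim q x"
proof -
  have i: "integrable lborel (\<lambda>s. indicator {..x} s * rep_L2 r s)" if "r \<in> L2_on {0<..<l}" for r
    by (rule Bochner_Integration.integrable_bound[OF rep_L2_integrable[OF that]]) (auto simp: indicator_def)
  have "L2_prim (p + q) x = (LBINT s. indicator {..x} s * rep_L2 p s + indicator {..x} s * rep_L2 q s)"
    unfolding L2_prim_def
    by (rule integral_cong_AE, simp, simp)
      (use rep_L2_add[of p q] in \<open>eventually_elim, simp add: distrib_left\<close>)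
  also have "\<dots> = L2_prim p x + L2_prim q x"
    unfolding L2_prim_def using i[OF p] i[OF q] by simp
  finally show ?thesis .
qed

lemma L2_prim_scaleR: "L2_prim (a *\<^sub>R p) x = a * L2_prim p x"
proof -
  have "L2_prim (a *\<^sub>R p) x = (LBINT s. a * (indicator {..x} s * rep_L2 p s))"
    unfolding L2_prim_def
    by (rule integral_cong_AE, simp, simp)
      (use rep_L2_scaleR[of a p] in \<open>eventually_elim, simp\<close>)
  then show ?thesis unfolding L2_prim_def by simp
qed

lemma square_integrable_H1_fun:
  assumes p: "p \<in> L2_on {0<..<l}"
  shows "square_integrable (\<lambda>x. indicator {0<..<l} x * (c + L2_prim p x))"
  by (rule square_integrable_indicator_continuous) (intro continuous_intros continuous_L2_prim p)

lemma H1_fun_in_L2_on: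
  assumes p: "p \<in> L2_on {0<..<l}"
  shows "H1_fun l c p \<in> L2_on {0<..<l}"
proof -
  have "(\<lambda>x. indicator {0<..<l} x * (indicator {0<..<l} x * (c + L2_prim p x))) =
      (\<lambda>x. indicator {0<..<l} x * (c + L2_prim p x))"
    by (auto simp: indicator_def)
  then have "L2_cut {0<..<l} (H1_fun l c p) = H1_fun l c p"
    unfolding H1_fun_def by (simp add: cut_abs_L2[OF _ square_integrable_H1_fun[OF p]])
  then show ?thesis by (simp add: cut_eq_iff)
qed

lemma rep_H1_fun:
  assumes p: "p \<in> L2_on {0<..<l}"
  shows "AE x in lborel. rep_L2 (H1_fun l c p) x = indicator {0<..<l} x * (c + L2_prim p x)"
  unfolding H1_fun_def by (rule rep_abs_L2_AE[OF square_integrable_H1_fun[OF p]])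

lemma H1_fun_add:
  assumes p: "p \<in> L2_on {0<..<l}" and q: "q \<in> L2_on {0<..<l}"
  shows "H1_fun l c p + H1_fun l d q = H1_fun l (c + d) (p + q)"
  unfolding H1_fun_def
  by (subst abs_L2_add[OF square_integrable_H1_fun[OF p] square_integrable_H1_fun[OF q]])
    (simp add: L2_prim_add[OF p q] algebra_simps)

lemma H1_fun_scaleR:
  assumes p: "p \<in> L2_on {0<..<l}"
  shows "a *\<^sub>R H1_fun l c p = H1_fun l (a * c) (a *\<^sub>R p)"
  unfolding H1_fun_def
  by (subst abs_L2_scale[OF square_integrable_H1_fun[OF p]])
    (simp add: L2_prim_scaleR algebra_simps)

text \<open>Integration by parts against the primitive of \<open>deriv \<psi>\<close>, which is
  \<open>\<psi>\<close>. Both the boundary product and the contribution of \<open>c\<close> vanish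
  because \<open>deriv \<psi>\<close> has integral zero.\<close>

lemma weak_derivative_H1_fun:
  assumes p: "p \<in> L2_on {0<..<l}"
  shows "weak_derivative l (H1_fun l c p) p"
  unfolding weak_derivative_def
proof (intro conjI allI impI H1_fun_in_L2_on p)
  fix \<psi> assume \<psi>: "test_function l \<psi>"
  obtain a b where
    ab: "0 < a" "b < l" and c: "continuous_on UNIV (deriv \<psi>)" "continuous_on UNIV \<psi>" and
    z: "\<And>x. x \<notin> {a..b} \<Longrightarrow> \<psi> x = 0" "\<And>x. x \<notin> {a..b} \<Longrightarrow> deriv \<psi> x = 0" and
    ftc: "\<And>x. \<psi> x = (LBINT s. indicator {..x} s * deriv \<psi> s)" "(LBINT s. deriv \<psi> s) = 0"
    by (rule test_functionD[OF \<psi> l]) (rule that)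
  have I: "indicator {0<..<l} x * deriv \<psi> x = deriv \<psi> x" for x
    using z(2)[of x] ab by (cases "x \<in> {a..b}") (auto simp: indicator_def)
  have sq: "square_integrable (deriv \<psi>)" by (rule square_integrable_continuous_support[OF c(1) z(2)])
  then have [measurable]: "deriv \<psi> \<in> borel_measurable borel" by (simp add: square_integrable_def)
  have int: "integrable lborel (deriv \<psi>)"
    using square_integrable_imp_integrable_interval[OF sq, of 0 l] by (simp only: I)
  have [measurable]: "L2_prim p \<in> borel_measurable borel"
    by (intro borel_measurable_continuous_onI continuous_L2_prim p)
  have "(LBINT x. rep_L2 (H1_fun l c p) x * deriv \<psi> x) = (LBINT x. c * deriv \<psi> x + deriv \<psi> x * L2_prim p x)"
  proof (rule integral_cong_AE)
    show "AE x in lborel. rep_L2 (H1_fun l c p) x * deriv \<psi> x = c * deriv \<psi> x + deriv \<psi> x * L2_prim p x"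
      using rep_H1_fun[OF p, of c]
    proof eventually_elim
      case (elim x)
      then have "rep_L2 (H1_fun l c p) x * deriv \<psi> x = (indicator {0<..<l} x * deriv \<psi> x) * (c + L2_prim p x)"
        by simp
      then show ?case by (simp only: I) (simp add: algebra_simps)
    qed
  qed auto
  also have "\<dots> = c * (LBINT x. deriv \<psi> x) + (LBINT x. deriv \<psi> x * L2_prim p x)"
  proof (subst Bochner_Integration.integral_add)
    have "integrable lborel (\<lambda>x. deriv \<psi> x * (indicator {0<..<l} x * (0 + L2_prim p x)))"
      by (rule square_integrable_mult[OF sq square_integrable_H1_fun[OF p]])
    also have "(\<lambda>x. deriv \<psi> x * (indicator {0<..<l} x * (0 + L2_prim p x))) = (\<lambda>x. deriv \<psi> x * L2_prim p x)"
    proof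
      fix x
      have "deriv \<psi> x * (indicator {0<..<l} x * (0 + L2_prim p x)) = (indicator {0<..<l} x * deriv \<psi> x) * L2_prim p x"
        by simp
      then show "deriv \<psi> x * (indicator {0<..<l} x * (0 + L2_prim p x)) = deriv \<psi> x * L2_prim p x"
        by (simp only: I)
    qed
    finally show "integrable lborel (\<lambda>x. deriv \<psi> x * L2_prim p x)" .
  qed (use int in auto)
  also have "(LBINT x. deriv \<psi> x * L2_prim p x) = - (LBINT x. rep_L2 p x * \<psi> x)"
    using integral_by_parts_atMost[OF int rep_L2_integrable[OF p]] ftc(2)
    unfolding L2_prim_def ftc(1)[symmetric] by simp
  finally show "(LBINT x. rep_L2 (H1_fun l c p) x * deriv \<psi> x) = - (LBINT x. rep_L2 p x * \<psi> x)"
    using ftc(2) by simp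
qed


text \<open>Green's formula with all boundary terms kept: \<open>c\<close> and
  \<open>c + L2_prim p l\<close> are the values at 0 and l. For \<open>c = d = 0\<close> it is
  \<open>integral_by_parts_atMost\<close>, and the constants add integrals of \<open>p\<close> and
  \<open>q\<close>, which are values of the primitives at l.\<close>

lemma green_H1_fun:
  assumes p: "p \<in> L2_on {0<..<l}" and q: "q \<in> L2_on {0<..<l}"
  shows "H1_fun l c p \<bullet> q + p \<bullet> H1_fun l d q = (c + L2_prim p l) * (d + L2_prim q l) - c * d"
proof -
  have *: "H1_fun l c p \<bullet> q = c * L2_prim q l + (LBINT x. rep_L2 q x * L2_prim p x)"
    if p: "p \<in> L2_on {0<..<l}" and q: "q \<in> L2_on {0<..<l}" for c p q
  proof -
    have [measurable]: "L2_prim p \<in> borel_measurable borel"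
      by (intro borel_measurable_continuous_onI continuous_L2_prim p)
    have AE: "AE x in lborel. indicator {0<..<l} x * rep_L2 q x = rep_L2 q x"
      using L2_on_AE[OF q] by eventually_elim (auto simp: indicator_def)
    have "integrable lborel (\<lambda>x. (indicator {0<..<l} x * (0 + L2_prim p x)) * rep_L2 q x)"
      by (rule square_integrable_mult[OF square_integrable_H1_fun[OF p] rep_L2_square_integrable])
    then have i: "integrable lborel (\<lambda>x. rep_L2 q x * L2_prim p x)"
    proof (rule integrable_cong_AE_imp)
      show "AE x in lborel. (indicator {0<..<l} x * (0 + L2_prim p x)) * rep_L2 q x = rep_L2 q x * L2_prim p x"
        using AE by eventually_elim auto
    qed simp
    have "H1_fun l c p \<bullet> q = (LBINT x. (indicator {0<..<l} x * (c + L2_prim p x)) * rep_L2 q x)"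
      unfolding H1_fun_def by (rule inner_abs_L2_left[OF square_integrable_H1_fun[OF p]])
    also have "\<dots> = (LBINT x. c * rep_L2 q x + rep_L2 q x * L2_prim p x)"
    proof (rule integral_cong_AE)
      show "AE x in lborel. (indicator {0<..<l} x * (c + L2_prim p x)) * rep_L2 q x
          = c * rep_L2 q x + rep_L2 q x * L2_prim p x"
        using AE
      proof eventually_elim
        case (elim x)
        have "(indicator {0<..<l} x * (c + L2_prim p x)) * rep_L2 q x
          = (c + L2_prim p x) * (indicator {0<..<l} x * rep_L2 q x)" by simp
        also have "\<dots> = (c + L2_prim p x) * rep_L2 q x" by (simp only: elim)
        finally show ?case by (simp add: algebra_simps)
      qed
    qed auto
    also have "\<dots> = c * (LBINT x. rep_L2 q x) + (LBINT x. rep_L2 q x * L2_prim p x)"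
      using i rep_L2_integrable[OF q] by simp
    finally show ?thesis by (simp add: integral_rep_L2[OF q])
  qed
  have "(LBINT x. rep_L2 p x * L2_prim q x) + (LBINT x. rep_L2 q x * L2_prim p x) = L2_prim p l * L2_prim q l"
    using integral_by_parts_atMost[OF rep_L2_integrable[OF p] rep_L2_integrable[OF q]]
    unfolding L2_prim_def[symmetric] integral_rep_L2[OF p] integral_rep_L2[OF q] .
  then show ?thesis
    using *[OF p q, of c] *[OF q p, of d] by (simp add: inner_commute[of p] algebra_simps)
qed

lemma polynomial_eq_H1_fun:
  fixes g :: "real \<Rightarrow> real"
  assumes g: "polynomial_function g"
  obtains p where "p \<in> L2_on {0<..<l}" "L2_prim p l = g l - g 0"
    "H1_fun l (g 0) p = abs_L2 (\<lambda>x. indicator {0<..<l} x * g x)"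
proof -
  obtain g' where g': "polynomial_function g'" "\<And>x. (g has_vector_derivative g' x) (at x)"
    using has_vector_derivative_polynomial_function[OF g] by blast
  have c: "continuous_on A g'" for A using continuous_on_polymonial_function[OF g'(1)] .
  then have [measurable]: "g' \<in> borel_measurable borel" by (rule borel_measurable_continuous_onI)
  have sq: "square_integrable (\<lambda>x. indicator {0<..<l} x * g' x)"
    by (rule square_integrable_indicator_continuous[OF c])
  define p where "p = abs_L2 (\<lambda>x. indicator {0<..<l} x * g' x)"
  have rp: "AE x in lborel. rep_L2 p x = indicator {0<..<l} x * g' x"
    unfolding p_def by (rule rep_abs_L2_AE[OF sq])
  have p: "p \<in> L2_on {0<..<l}"
    unfolding L2_on_def using rp by (auto elim!: eventually_mono)
  have prim: "L2_prim p x = g x - g 0" if x: "x \<in> {0..l}" for x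
  proof -
    have "L2_prim p x = (LBINT s. indicator {0..x} s *\<^sub>R g' s)"
      unfolding L2_prim_def
    proof (rule integral_cong_AE)
      show "AE s in lborel. indicator {..x} s * rep_L2 p s = indicator {0..x} s *\<^sub>R g' s"
        using rp AE_lborel_singleton[of 0] AE_lborel_singleton[of l]
        by eventually_elim (use x in \<open>auto simp: indicator_def\<close>)
    qed auto
    also have "\<dots> = g x - g 0"
      by (rule integral_FTC_Icc) (use x g'(2) c in \<open>auto intro: has_vector_derivative_at_within\<close>)
    finally show ?thesis .
  qed
  have "H1_fun l (g 0) p = abs_L2 (\<lambda>x. indicator {0<..<l} x * g x)"
    unfolding H1_fun_def
  proof (rule arg_cong[where f=abs_L2], rule ext)
    show "indicator {0<..<l} x * (g 0 + L2_prim p x) = indicator {0<..<l} x * g x" for x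
      using prim[of x] by (cases "x \<in> {0<..<l}") auto
  qed
  then show ?thesis using that p prim[of l] l by simp
qed

lemma H1_fun_eqD:
  assumes p: "p \<in> L2_on {0<..<l}" and q: "q \<in> L2_on {0<..<l}"
    and eq: "H1_fun l c p = H1_fun l d q" and x: "x \<in> {0..l}"
  shows "c + L2_prim p x = d + L2_prim q x"
proof (rule continuous_eq_on_Icc_if_AE[OF l _ _ _ x])
  show "AE x in lborel. x \<in> {0<..<l} \<longrightarrow> c + L2_prim p x = d + L2_prim q x"
    using rep_H1_fun[OF p, of c] rep_H1_fun[OF q, of d] unfolding eq
    by eventually_elim (auto simp: indicator_def)
qed (intro continuous_intros continuous_L2_prim p q)+

text \<open>Green's formula shifts the pairing of \<open>p\<close> with a polynomial onto the
  primitive of \<open>p\<close>, which is zero. Hence \<open>p\<close> is orthogonal to all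
  polynomials, which are dense, and so to itself.\<close>

lemma L2_prim_zeroD:
  assumes p: "p \<in> L2_on {0<..<l}" and z: "\<And>x. x \<in> {0..l} \<Longrightarrow> L2_prim p x = 0"
  shows "p = 0"
proof -
  have "(\<lambda>x. indicator {0<..<l} x * (0 + L2_prim p x)) = (\<lambda>x. 0)"
    using z by (auto simp: fun_eq_iff indicator_def)
  then have 0: "H1_fun l 0 p = 0" unfolding H1_fun_def zero_L2_def by (simp only:)
  have "L2_on {0<..<l} \<subseteq> {q. p \<bullet> q = 0}"
  proof (rule L2_on_interval_subset_polynomial[OF l])
    show "closed {q. p \<bullet> q = 0}" by (intro closed_Collect_eq continuous_intros)
    show "subspace {q. p \<bullet> q = 0}" by (simp add: subspace_def inner_add_right)
    fix f :: "real \<Rightarrow> real" assume f: "polynomial_function f"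
    obtain q where q: "q \<in> L2_on {0<..<l}"
      "H1_fun l (f 0) q = abs_L2 (\<lambda>x. indicator {0<..<l} x * f x)"
      using polynomial_eq_H1_fun[OF f] by metis
    have "H1_fun l 0 p \<bullet> q + p \<bullet> H1_fun l (f 0) q = 0"
      using green_H1_fun[OF p q(1), of 0 "f 0"] z[of l] l by simp
    then show "abs_L2 (\<lambda>x. indicator {0<..<l} x * f x) \<in> {q. p \<bullet> q = 0}"
      by (simp add: 0 q(2))
  qed
  then have "p \<bullet> p = 0" using p by auto
  then show ?thesis by simp
qed

lemma H1_fun_inject:
  assumes p: "p \<in> L2_on {0<..<l}" and q: "q \<in> L2_on {0<..<l}"
    and eq: "H1_fun l c p = H1_fun l d q"
  shows "c = d" "p = q"
proof -
  show cd: "c = d"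
    using H1_fun_eqD[OF p q eq, of 0] L2_prim_0[OF p] L2_prim_0[OF q] l by simp
  have "p - q = 0"
  proof (rule L2_prim_zeroD)
    show "p - q \<in> L2_on {0<..<l}" by (intro L2_on_diff p q) simp
    have "L2_prim (p - q) x = L2_prim p x - L2_prim q x" for x
      using L2_prim_add[OF p L2_on_scaleR[OF _ q], of "-1" x] L2_prim_scaleR[of "-1" q x] by simp
    then show "L2_prim (p - q) x = 0" if "x \<in> {0..l}" for x
      using H1_fun_eqD[OF p q eq that] cd by simp
  qed
  then show "p = q" by simp
qed

text \<open>The du Bois-Reymond lemma: \<open>u\<close> annihilates every continuous, compactly
  supported function of mean zero, because these are derivatives of test functions. What remains of
  \<open>u\<close> is its component along the indicator \<open>e\<close> of the interval.\<close>

lemma weak_derivative_zeroD: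
  assumes w: "weak_derivative l u 0"
  obtains c where "u = H1_fun l c 0"
proof -
  define e where "e = abs_L2 (indicator {0<..<l} :: real \<Rightarrow> real)"
  have e: "e \<in> L2_on {0<..<l}"
    using abs_L2_indicator_mem[of "{0<..<l}" "indicator {0<..<l}"] square_integrable_indicator_interval[of 0 l]
    by (simp add: e_def indicator_inter_arith[symmetric])
  have [simp]: "L2_prim 0 x = 0" for x
    using L2_prim_scaleR[of 0 0 x] by simp
  have z: "0 \<in> L2_on {0<..<l}" by (rule subspace_0[OF subspace_L2_on]) simp
  have He: "H1_fun l c 0 = c *\<^sub>R e" for c
    unfolding H1_fun_def e_def by (simp add: abs_L2_scale[OF square_integrable_indicator_interval] mult.commute)
  let ?test = "\<lambda>f. continuous_on UNIV f \<and> (\<exists>a b. 0 < a \<and> b < l \<and> (\<forall>x. x \<notin> {a..b} \<longrightarrow> f x = (0::real)))"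
  have sub: "closed {q. v \<bullet> q = 0}" "subspace {q. v \<bullet> q = 0}" for v :: "real L2"
    by (intro closed_Collect_eq continuous_intros) (simp add: subspace_def inner_add_right)
  have e_int: "e \<bullet> abs_L2 f = (LBINT x. f x)" if "?test f" for f
  proof -
    from that obtain a b where ab: "0 < a" "b < l" "\<And>x. x \<notin> {a..b} \<Longrightarrow> f x = 0" "continuous_on UNIV f" by auto
    have "indicator {0<..<l} x * f x = f x" for x
      using ab(1,2) ab(3)[of x] by (cases "x \<in> {a..b}") (auto simp: indicator_def)
    moreover have "e \<bullet> abs_L2 f = (LBINT x. indicator {0<..<l} x * f x)"
      unfolding e_def
      by (intro inner_abs_L2 square_integrable_indicator_interval square_integrable_continuous_support[OF ab(4,3)])
    ultimately show ?thesis by (simp only:)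
  qed
  have uh: "u \<bullet> abs_L2 h = 0" if h: "?test h" and int: "(LBINT x. h x) = 0" for h
  proof -
    from h obtain a b where ab: "0 < a" "b < l" "\<And>x. x \<notin> {a..b} \<Longrightarrow> h x = 0" "continuous_on UNIV h" by auto
    obtain \<psi> where \<psi>: "test_function l \<psi>" "deriv \<psi> = h"
      by (rule test_function_of_continuous[OF ab(4,1,2,3) int])
    have "(LBINT x. rep_L2 u x * h x) = - (LBINT x. rep_L2 0 x * \<psi> x)"
      using w \<psi> unfolding weak_derivative_def by blast
    also have "(LBINT x. rep_L2 0 x * \<psi> x) = (LBINT x::real. (0::real))"
    proof (rule integral_cong_AE)
      obtain a b :: real where "continuous_on UNIV \<psi>"
        by (rule test_functionD[OF \<psi>(1) l]) (rule that)
      then have [measurable]: "\<psi> \<in> borel_measurable borel" by (rule borel_measurable_continuous_onI)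
      show "(\<lambda>x. rep_L2 0 x * \<psi> x) \<in> borel_measurable lborel" by simp
      show "AE x in lborel. rep_L2 0 x * \<psi> x = 0"
        using rep_L2_zero by eventually_elim simp
    qed simp
    finally have "(LBINT x. h x * rep_L2 u x) = 0" by (simp add: mult.commute)
    moreover have "abs_L2 h \<bullet> u = (LBINT x. h x * rep_L2 u x)"
      by (rule inner_abs_L2_left[OF square_integrable_continuous_support[OF ab(4,3)]])
    ultimately show ?thesis by (simp add: inner_commute)
  qed
  \<comment> \<open>Subtracting a multiple of a fixed \<open>f0\<close> with nonzero mean makes every \<open>f\<close> a derivative of a test function.\<close>
  have "\<exists>f. ?test f \<and> e \<bullet> abs_L2 f \<noteq> 0"
  proof (rule ccontr)
    assume "\<not> ?thesis"
    then have "L2_on {0<..<l} \<subseteq> {q. e \<bullet> q = 0}"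
      by (intro L2_on_interval_subset sub) blast
    then have "e \<bullet> e = 0" using e by auto
    moreover have "e \<bullet> e = (LBINT x. indicator {0<..<l} x * indicator {0<..<l} x)"
      unfolding e_def by (intro inner_abs_L2 square_integrable_indicator_interval)
    ultimately show False using l by (simp add: indicator_inter_arith[symmetric])
  qed
  then obtain f0 where f0: "?test f0" "e \<bullet> abs_L2 f0 \<noteq> 0" by blast
  \<comment> \<open>Chosen so that \<open>u - c *\<^sub>R e\<close> is orthogonal to
    \<open>f0\<close> as well as to the functions of mean zero.\<close>
  define c where "c = (u \<bullet> abs_L2 f0) / (e \<bullet> abs_L2 f0)"
  have "L2_on {0<..<l} \<subseteq> {q. (u - c *\<^sub>R e) \<bullet> q = 0}"
  proof (rule L2_on_interval_subset[OF sub])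
    fix f :: "real \<Rightarrow> real" and a b
    assume f: "continuous_on UNIV f" "0 < a" "b < l" "\<And>x. x \<notin> {a..b} \<Longrightarrow> f x = 0"
    from f0(1) obtain a0 b0 where ab: "0 < a0" "b0 < l" "\<And>x. x \<notin> {a0..b0} \<Longrightarrow> f0 x = 0" "continuous_on UNIV f0" by auto
    define k where "k = (e \<bullet> abs_L2 f) / (e \<bullet> abs_L2 f0)"
    let ?h = "\<lambda>x. f x - k * f0 x"
    have sq: "square_integrable f" "square_integrable f0"
      using square_integrable_continuous_support[OF f(1,4)] square_integrable_continuous_support[OF ab(4,3)] by blast+
    have abs_h: "abs_L2 ?h = abs_L2 f - k *\<^sub>R abs_L2 f0"
      by (simp add: abs_L2_scale abs_L2_diff sq square_integrable_scale)
    have ch: "continuous_on UNIV ?h" by (intro continuous_intros f(1) ab(4))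
    have zh: "?h x = 0" if "x \<notin> {min a a0..max b b0}" for x
    proof -
      have "f x = 0" by (rule f(4)) (use that in auto)
      moreover have "f0 x = 0" by (rule ab(3)) (use that in auto)
      ultimately show ?thesis by simp
    qed
    have test: "?test ?h"
      by (rule conjI[OF ch], rule exI[of _ "min a a0"], rule exI[of _ "max b b0"]) (use zh f(2,3) ab(1,2) in simp)
    have "(LBINT x. ?h x) = e \<bullet> abs_L2 ?h" by (rule e_int[symmetric, OF test])
    also have "\<dots> = 0" unfolding abs_h using f0(2) by (simp add: inner_diff_right k_def)
    finally have "u \<bullet> abs_L2 ?h = 0" by (rule uh[OF test])
    then show "abs_L2 f \<in> {q. (u - c *\<^sub>R e) \<bullet> q = 0}"
      unfolding abs_h by (simp add: inner_diff_right inner_diff_left c_def k_def)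
  qed
  moreover have "u - c *\<^sub>R e \<in> L2_on {0<..<l}"
    using w e by (intro L2_on_diff L2_on_scaleR) (auto simp: weak_derivative_def)
  ultimately have "(u - c *\<^sub>R e) \<bullet> (u - c *\<^sub>R e) = 0" by blast
  then have "u = H1_fun l c 0" by (simp add: He)
  then show ?thesis by (rule that)
qed

text \<open>Subtracting the primitive \<open>H1_fun l 0 p\<close> of the same derivative leaves a
  function with weak derivative zero, hence a constant.\<close>

lemma weak_derivative_iff:
  "weak_derivative l u p \<longleftrightarrow> p \<in> L2_on {0<..<l} \<and> (\<exists>c. u = H1_fun l c p)"
proof
  assume w: "weak_derivative l u p"
  then have u: "u \<in> L2_on {0<..<l}" and p: "p \<in> L2_on {0<..<l}" by (auto simp: weak_derivative_def)
  have z: "0 \<in> L2_on {0<..<l}" by (rule subspace_0[OF subspace_L2_on]) simp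
  let ?v = "H1_fun l 0 p"
  note w2 = weak_derivative_H1_fun[OF p, of 0]
  have "weak_derivative l (u - ?v) 0"
    unfolding weak_derivative_def
  proof (intro conjI allI impI)
    show "u - ?v \<in> L2_on {0<..<l}" by (intro L2_on_diff u H1_fun_in_L2_on p) simp
    show "0 \<in> L2_on {0<..<l}" by (rule z)
    fix \<psi> assume \<psi>: "test_function l \<psi>"
    obtain a b where c: "continuous_on UNIV (deriv \<psi>)" "\<And>x. x \<notin> {a..b} \<Longrightarrow> deriv \<psi> x = 0" "continuous_on UNIV \<psi>"
      by (rule test_functionD[OF \<psi> l]) (rule that)
    have sq: "square_integrable (deriv \<psi>)" by (rule square_integrable_continuous_support[OF c(1,2)])
    have [measurable]: "\<psi> \<in> borel_measurable borel" by (rule borel_measurable_continuous_onI[OF c(3)])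
    have "(LBINT x. rep_L2 (u - ?v) x * deriv \<psi> x) = (u - ?v) \<bullet> abs_L2 (deriv \<psi>)"
      by (subst inner_commute) (simp add: inner_abs_L2_left[OF sq] mult.commute)
    also have "\<dots> = (LBINT x. rep_L2 u x * deriv \<psi> x) - (LBINT x. rep_L2 ?v x * deriv \<psi> x)"
      by (subst inner_commute) (simp add: inner_diff_right inner_abs_L2_left[OF sq] mult.commute)
    also have "\<dots> = 0"
      using w w2 \<psi> unfolding weak_derivative_def by simp
    also have "0 = - (LBINT x. rep_L2 0 x * \<psi> x)"
    proof -
      have "(LBINT x. rep_L2 0 x * \<psi> x) = (LBINT x::real. (0::real))"
        by (rule integral_cong_AE) (use rep_L2_zero in \<open>auto elim: eventually_mono\<close>)
      then show ?thesis by simp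
    qed
    finally show "(LBINT x. rep_L2 (u - ?v) x * deriv \<psi> x) = - (LBINT x. rep_L2 0 x * \<psi> x)" .
  qed
  then obtain c where "u - ?v = H1_fun l c 0" by (rule weak_derivative_zeroD)
  then have "u = H1_fun l c 0 + H1_fun l 0 p" by (simp add: algebra_simps)
  then have "u = H1_fun l c p" by (simp add: H1_fun_add[OF z p])
  then show "p \<in> L2_on {0<..<l} \<and> (\<exists>c. u = H1_fun l c p)" using p by blast
qed (auto intro: weak_derivative_H1_fun)

lemma wderiv_H1_fun:
  assumes p: "p \<in> L2_on {0<..<l}"
  shows "wderiv l (H1_fun l c p) = p"
  unfolding wderiv_def
proof (rule the_equality)
  show "weak_derivative l (H1_fun l c p) p" by (rule weak_derivative_H1_fun[OF p])
  show "q = p" if "weak_derivative l (H1_fun l c p) q" for q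
    using that p unfolding weak_derivative_iff by (metis H1_fun_inject(2))
qed

lemma trace_H1_fun:
  assumes p: "p \<in> L2_on {0<..<l}" and z: "z \<in> {0..l}"
  shows "trace l (H1_fun l c p) z = c + L2_prim p z"
  unfolding trace_def
proof (rule the_equality)
  have AE: "AE x in lborel. x \<in> {0<..<l} \<longrightarrow> rep_L2 (H1_fun l c p) x = c + L2_prim p x"
    using rep_H1_fun[OF p, of c] by eventually_elim auto
  have c: "continuous_on {0..l} (\<lambda>x. c + L2_prim p x)"
    by (intro continuous_intros continuous_L2_prim p)
  show "\<exists>v. continuous_on {0..l} v \<and> (AE x in lborel. x \<in> {0<..<l} \<longrightarrow> rep_L2 (H1_fun l c p) x = v x) \<and>
      c + L2_prim p z = v z"
    by (intro exI[of _ "\<lambda>x. c + L2_prim p x"] conjI c AE refl)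
  fix a assume "\<exists>v. continuous_on {0..l} v \<and>
      (AE x in lborel. x \<in> {0<..<l} \<longrightarrow> rep_L2 (H1_fun l c p) x = v x) \<and> a = v z"
  then obtain v where v: "continuous_on {0..l} v" "a = v z"
    "AE x in lborel. x \<in> {0<..<l} \<longrightarrow> rep_L2 (H1_fun l c p) x = v x" by blast
  have "v z = c + L2_prim p z"
    by (rule continuous_eq_on_Icc_if_AE[OF l v(1) c _ z]) (use v(3) AE in \<open>eventually_elim, auto\<close>)
  then show "a = c + L2_prim p z" by (simp add: v)
qed

section \<open>The spaces of triples and the operator B\<close>

definition H1_triple :: "real \<Rightarrow> real L2 \<Rightarrow> triple" where
  "H1_triple c p = (H1_fun l c p, c, c + L2_prim p l)"

lemma HH_1: "HH l 1 = {H1_triple c p | c p. p \<in> L2_on {0<..<l}}"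
proof -
  have "sobolev l 1 = {H1_fun l c p | c p. p \<in> L2_on {0<..<l}}"
    by (auto simp: weak_derivative_iff)
  then show ?thesis
    unfolding HH_def H1_triple_def using l by (force simp: trace_H1_fun L2_prim_0)
qed

lemma HH_2: "HH l 2 = {H1_triple c (H1_fun l d q) | c d q. q \<in> L2_on {0<..<l}}"
proof -
  have "sobolev l 2 = {H1_fun l c (H1_fun l d q) | c d q. q \<in> L2_on {0<..<l}}"
    by (auto simp: numeral_2_eq_2 weak_derivative_iff H1_fun_in_L2_on) (use H1_fun_in_L2_on in blast)
  then show ?thesis
    unfolding HH_def H1_triple_def using l by (force simp: trace_H1_fun L2_prim_0 H1_fun_in_L2_on)
qed


lemma zero_L2_on: "0 \<in> L2_on {0<..<l}"
  by (rule subspace_0[OF subspace_L2_on]) simp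

lemma H1_triple_add:
  assumes "p \<in> L2_on {0<..<l}" "q \<in> L2_on {0<..<l}"
  shows "H1_triple c p + H1_triple d q = H1_triple (c + d) (p + q)"
  using assms by (simp add: H1_triple_def H1_fun_add L2_prim_add)

lemma H1_triple_scaleR:
  assumes "p \<in> L2_on {0<..<l}"
  shows "a *\<^sub>R H1_triple c p = H1_triple (a * c) (a *\<^sub>R p)"
  using assms by (simp add: H1_triple_def H1_fun_scaleR L2_prim_scaleR algebra_simps)

lemma H1_triple_0: "H1_triple 0 0 = 0"
  using H1_triple_scaleR[OF zero_L2_on, of 0 0] by simp

lemma subspace_HH_1: "subspace (HH l 1)"
  unfolding subspace_def HH_1
proof (intro conjI ballI allI)
  show "0 \<in> {H1_triple c p |c p. p \<in> L2_on {0<..<l}}"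
    using H1_triple_0[symmetric] zero_L2_on by blast
next
  fix x y assume "x \<in> {H1_triple c p |c p. p \<in> L2_on {0<..<l}}" "y \<in> {H1_triple c p |c p. p \<in> L2_on {0<..<l}}"
  then obtain c p d q where "x = H1_triple c p" "y = H1_triple d q" "p \<in> L2_on {0<..<l}" "q \<in> L2_on {0<..<l}" by blast
  moreover from this have "x + y = H1_triple (c + d) (p + q)" "p + q \<in> L2_on {0<..<l}"
    by (simp_all add: H1_triple_add L2_on_add)
  ultimately show "x + y \<in> {H1_triple c p |c p. p \<in> L2_on {0<..<l}}" by blast
next
  fix a x assume "x \<in> {H1_triple c p |c p. p \<in> L2_on {0<..<l}}"
  then obtain c p where "x = H1_triple c p" "p \<in> L2_on {0<..<l}" by blast
  moreover from this have "a *\<^sub>R x = H1_triple (a * c) (a *\<^sub>R p)" "a *\<^sub>R p \<in> L2_on {0<..<l}"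
    by (simp_all add: H1_triple_scaleR L2_on_scaleR)
  ultimately show "a *\<^sub>R x \<in> {H1_triple c p |c p. p \<in> L2_on {0<..<l}}" by blast
qed

lemma HH_2_subset: "HH l 2 \<subseteq> HH l 1"
  unfolding HH_1 HH_2 using H1_fun_in_L2_on by blast

lemma zero_HH_2: "0 \<in> HH l 2"
proof -
  have "H1_fun l 0 0 = 0" using H1_triple_0 by (simp add: H1_triple_def zero_prod_def)
  then have "0 = H1_triple 0 (H1_fun l 0 0)" by (simp add: H1_triple_0)
  then show ?thesis unfolding HH_2 using zero_L2_on by blast
qed

lemma HH_1_subset_LL2: "HH l 1 \<subseteq> LL2 l"
  unfolding HH_1 LL2_def by (auto simp: H1_triple_def H1_fun_in_L2_on)

lemma subspace_LL2: "subspace (LL2 l)"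
  unfolding LL2_def by (intro subspace_Times subspace_UNIV subspace_L2_on) simp

lemma wderiv_H1_triple: "p \<in> L2_on {0<..<l} \<Longrightarrow> wderiv l (fst (H1_triple c p)) = p"
  by (simp add: H1_triple_def wderiv_H1_fun)

lemma wave_B_H1_triple:
  assumes "q \<in> L2_on {0<..<l}"
  shows "wave_B l (H1_triple c (H1_fun l d q)) = (q, d, - (d + L2_prim q l))"
  using assms l
  by (simp add: wave_B_def H1_triple_def wderiv_H1_fun H1_fun_in_L2_on trace_H1_fun L2_prim_0)

text \<open>The real components of the triples supply exactly the boundary terms of Green's formula.
  With \<open>V\<close> the velocity of the orbit the identity gives energy conservation; with two
  displacements its symmetry gives conservation of the symplectic form.\<close>

lemma inner_wave_B:
  assumes "U \<in> HH l 2" "V \<in> HH l 1"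
  shows "V \<bullet> wave_B l U = - (wderiv l (fst V) \<bullet> wderiv l (fst U))"
proof -
  obtain c d q where U: "U = H1_triple c (H1_fun l d q)" and q: "q \<in> L2_on {0<..<l}"
    using assms(1) unfolding HH_2 by blast
  obtain k r where V: "V = H1_triple k r" and r: "r \<in> L2_on {0<..<l}"
    using assms(2) unfolding HH_1 by blast
  have "V \<bullet> wave_B l U = H1_fun l k r \<bullet> q + k * d - (k + L2_prim r l) * (d + L2_prim q l)"
    unfolding U wave_B_H1_triple[OF q] by (simp add: V H1_triple_def inner_prod_def algebra_simps)
  then show ?thesis
    unfolding U V wderiv_H1_triple[OF r] wderiv_H1_triple[OF H1_fun_in_L2_on[OF q]]
    using green_H1_fun[OF r q, of k d] by (simp add: algebra_simps)
qed

lemma wave_B_in_LL2: "U \<in> HH l 2 \<Longrightarrow> wave_B l U \<in> LL2 l"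
  by (auto simp: HH_2 wave_B_H1_triple LL2_def)

section \<open>Density of H^1 triples\<close>

lemma polynomial_in_HH_1:
  fixes g :: "real \<Rightarrow> real"
  assumes g: "polynomial_function g"
  shows "(abs_L2 (\<lambda>x. indicator {0<..<l} x * g x), g 0, g l) \<in> HH l 1"
proof -
  obtain p where "p \<in> L2_on {0<..<l}" "L2_prim p l = g l - g 0"
    "H1_fun l (g 0) p = abs_L2 (\<lambda>x. indicator {0<..<l} x * g x)"
    by (rule polynomial_eq_H1_fun[OF g])
  then have "(abs_L2 (\<lambda>x. indicator {0<..<l} x * g x), g 0, g l) = H1_triple (g 0) p"
    by (simp add: H1_triple_def)
  then show ?thesis unfolding HH_1 using \<open>p \<in> _\<close> by blast
qed

text \<open>The powers \<open>(1 - x/l)^n\<close> and \<open>(x/l)^n\<close> tend to zero in \<open>L\<^sup>2\<close> while one boundary value stays \<open>1\<close>,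
  so the two trace components can be approximated independently of the bulk component.\<close>

lemma LL2_subset_closure_HH_1: "LL2 l \<subseteq> closure (HH l 1)"
proof -
  let ?C = "closure (HH l 1)"
  have C: "subspace ?C"
    unfolding subspace_def
  proof (intro conjI ballI allI)
    show "0 \<in> ?C" using subspace_0[OF subspace_HH_1] closure_subset by blast
    fix x assume x: "x \<in> ?C"
    then obtain f where f: "\<And>n. f n \<in> HH l 1" "f \<longlonglongrightarrow> x" unfolding closure_sequential by blast
    show "a *\<^sub>R x \<in> ?C" for a
      unfolding closure_sequential
      using f by (intro exI[of _ "\<lambda>n. a *\<^sub>R f n"]) (auto intro: subspace_scale[OF subspace_HH_1] tendsto_scaleR simp del: One_nat_def)
    fix y assume "y \<in> ?C"
    then obtain g where g: "\<And>n. g n \<in> HH l 1" "g \<longlonglongrightarrow> y" unfolding closure_sequential by blast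
    show "x + y \<in> ?C"
      unfolding closure_sequential
      using f g by (intro exI[of _ "\<lambda>n. f n + g n"]) (auto intro: subspace_add[OF subspace_HH_1] tendsto_add simp del: One_nat_def)
  qed
  have lim: "(\<lambda>n. abs_L2 (\<lambda>x. indicator {0<..<l} x * (f x) ^ n)) \<longlonglongrightarrow> 0"
    if f: "continuous_on UNIV f" "\<And>x. x \<in> {0<..<l} \<Longrightarrow> \<bar>f x\<bar> < 1" for f :: "real \<Rightarrow> real"
    unfolding zero_L2_def
  proof (rule tendsto_abs_L2(2)[where w="indicator {0<..<l}"])
    show "square_integrable (\<lambda>x. indicator {0<..<l} x * (f x) ^ n)" for n
      by (rule square_integrable_indicator_continuous) (intro continuous_intros continuous_on_subset[OF f(1)], auto)
    show "\<bar>indicator {0<..<l} x * (f x) ^ n\<bar> \<le> \<bar>indicator {0<..<l} x\<bar>" for n x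
      using f(2)[of x] power_le_one[of "\<bar>f x\<bar>" n] by (cases "x \<in> {0<..<l}") (auto simp: power_abs)
    show "(\<lambda>n. indicator {0<..<l} x * (f x) ^ n) \<longlonglongrightarrow> 0" for x
      using f(2)[of x] LIMSEQ_power_zero[of "f x"] by (cases "x \<in> {0<..<l}") auto
  qed (auto intro: square_integrable_indicator_interval)
  have e: "(0, 1, 0) \<in> ?C" "(0, 0, 1) \<in> ?C"
  proof -
    let ?f = "\<lambda>x. 1 - x / l" and ?g = "\<lambda>x. x / l"
    let ?F = "\<lambda>f n. abs_L2 (\<lambda>x. indicator {0<..<l} x * (f x) ^ n)"
    have poly: "polynomial_function (\<lambda>x. (1 - x / l) ^ n)" "polynomial_function (\<lambda>x. (x / l) ^ n)" for n
      unfolding real_polynomial_function_eq[symmetric]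
      by (intro real_polynomial_function_power real_polynomial_function_diff real_polynomial_function_divide;
          simp add: real_polynomial_function_eq)+
    \<comment> \<open>Exponents start at 1, since the power with exponent 0 takes the value 1 at
      both ends.\<close>
    have h: "(?F ?f (Suc n), 1, 0) \<in> HH l 1" "(?F ?g (Suc n), 0, 1) \<in> HH l 1" for n
      using polynomial_in_HH_1[OF poly(1)[of "Suc n"]] polynomial_in_HH_1[OF poly(2)[of "Suc n"]] l by auto
    have t1: "(\<lambda>n. (?F ?f (Suc n), 1::real, 0::real)) \<longlonglongrightarrow> (0, 1, 0)"
      by (intro tendsto_Pair tendsto_const LIMSEQ_Suc lim continuous_intros) (use l in \<open>auto simp: field_simps\<close>)
    have t2: "(\<lambda>n. (?F ?g (Suc n), 0::real, 1::real)) \<longlonglongrightarrow> (0, 0, 1)"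
      by (intro tendsto_Pair tendsto_const LIMSEQ_Suc lim continuous_intros) (use l in \<open>auto simp: field_simps\<close>)
    show "(0, 1, 0) \<in> ?C"
      unfolding closure_sequential by (intro exI conjI allI, rule h(1), rule t1)
    show "(0, 0, 1) \<in> ?C"
      unfolding closure_sequential by (intro exI conjI allI, rule h(2), rule t2)
  qed
  have bulk: "L2_on {0<..<l} \<subseteq> {v. (v, 0, 0) \<in> ?C}"
  proof (rule L2_on_interval_subset_polynomial[OF l])
    have "closed ((\<lambda>v. (v, 0::real, 0::real)) -` ?C)"
      by (intro closed_vimage closed_closure continuous_intros)
    then show "closed {v. (v, 0, 0) \<in> ?C}" by (simp add: vimage_def)
    show "subspace {v. (v, 0, 0) \<in> ?C}"
      unfolding subspace_def
      using subspace_0[OF C] subspace_add[OF C] subspace_scale[OF C]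
      by (auto simp: zero_prod_def) (fastforce, fastforce)
    fix g :: "real \<Rightarrow> real" assume "polynomial_function g"
    then have "(abs_L2 (\<lambda>x. indicator {0<..<l} x * g x), g 0, g l) \<in> ?C"
      using polynomial_in_HH_1 closure_subset by blast
    \<comment> \<open>Both boundary values of a polynomial can be removed inside the closure, which
      leaves its bulk component alone.\<close>
    from subspace_diff[OF C subspace_diff[OF C this subspace_scale[OF C e(1), of "g 0"]] subspace_scale[OF C e(2), of "g l"]]
    have "(abs_L2 (\<lambda>x. indicator {0<..<l} x * g x), g 0, g l) - g 0 *\<^sub>R (0, 1, 0) - g l *\<^sub>R (0, 0, 1) \<in> ?C" .
    also have "(abs_L2 (\<lambda>x. indicator {0<..<l} x * g x), g 0, g l) - g 0 *\<^sub>R (0, 1, 0) - g l *\<^sub>R (0, 0, 1) =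
        (abs_L2 (\<lambda>x. indicator {0<..<l} x * g x), 0, 0)" by (simp add: zero_prod_def)
    finally show "abs_L2 (\<lambda>x. indicator {0<..<l} x * g x) \<in> {v. (v, 0, 0) \<in> ?C}" by (simp only: mem_Collect_eq)
  qed
  show ?thesis
  proof
    fix V assume "V \<in> LL2 l"
    then obtain v a b where V: "V = (v, a, b)" "(v, 0, 0) \<in> ?C" using bulk by (auto simp: LL2_def)
    from subspace_add[OF C subspace_add[OF C V(2) subspace_scale[OF C e(1), of a]] subspace_scale[OF C e(2), of b]]
    show "V \<in> ?C" by (simp add: V(1))
  qed
qed

text \<open>Adjoining the weak derivative as a further component turns the energy norm into the norm
  of a product of inner product spaces. Limits in the energy norm become ordinary limits, and the
  usual calculus of vector-valued derivatives applies to orbits.\<close>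

definition energy_embed :: "triple \<times> triple \<Rightarrow> real L2 \<times> triple \<times> triple" where
  "energy_embed Z = (wderiv l (fst (fst Z)), Z)"

lemma energy_space_norm_eq: "energy_space_norm l Z = norm (energy_embed Z)"
  by (simp add: energy_space_norm_def HH1_norm_def energy_embed_def norm_prod_def split_beta algebra_simps)

lemma subspace_energy_space: "subspace (energy_space l)"
  unfolding energy_space_def by (intro subspace_Times subspace_HH_1 subspace_LL2)

lemma wderiv_add: "U \<in> HH l 1 \<Longrightarrow> V \<in> HH l 1 \<Longrightarrow> wderiv l (fst (U + V)) = wderiv l (fst U) + wderiv l (fst V)"
  unfolding HH_1 by (auto simp: H1_triple_add wderiv_H1_triple L2_on_add simp del: fst_add)

lemma wderiv_scaleR: "U \<in> HH l 1 \<Longrightarrow> wderiv l (fst (a *\<^sub>R U)) = a *\<^sub>R wderiv l (fst U)"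
  unfolding HH_1 by (auto simp: H1_triple_scaleR wderiv_H1_triple L2_on_scaleR simp del: fst_scaleR)

lemma energy_embed_add:
  "Z \<in> energy_space l \<Longrightarrow> Z' \<in> energy_space l \<Longrightarrow> energy_embed (Z + Z') = energy_embed Z + energy_embed Z'"
  using wderiv_add[of "fst Z" "fst Z'"] by (auto simp: energy_embed_def energy_space_def)

lemma energy_embed_scaleR:
  "Z \<in> energy_space l \<Longrightarrow> energy_embed (a *\<^sub>R Z) = a *\<^sub>R energy_embed Z"
  using wderiv_scaleR[of "fst Z" a] by (auto simp: energy_embed_def energy_space_def)

lemma energy_embed_diff:
  assumes "Z \<in> energy_space l" "Z' \<in> energy_space l"
  shows "energy_embed (Z - Z') = energy_embed Z - energy_embed Z'"
  using energy_embed_add[OF assms(1) subspace_scale[OF subspace_energy_space assms(2), of "-1"]]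
    energy_embed_scaleR[OF assms(2), of "-1"] by simp

lemma norm_le_energy_embed: "norm Z \<le> norm (energy_embed Z)"
  unfolding energy_embed_def by (simp add: norm_snd_le)

lemma wderiv_zero: "wderiv l 0 = 0"
  using wderiv_H1_triple[OF zero_L2_on, of 0] by (simp add: H1_triple_0)

lemma norm_energy_embed_0: "norm (energy_embed (0, V)) = norm V"
  by (simp add: energy_embed_def norm_prod_def wderiv_zero)

end

section \<open>The wave group\<close>

locale wave_flow = interval +
  fixes S :: "real \<Rightarrow> triple \<times> triple \<Rightarrow> triple \<times> triple"
  assumes wave_group: "wave_group l S"
begin

abbreviation "X \<equiv> energy_space l"
abbreviation "D \<equiv> HH l 2 \<times> HH l 1"

lemma group_facts:
  shows S_mem: "x \<in> X \<Longrightarrow> S t x \<in> X"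
    and S_add: "x \<in> X \<Longrightarrow> y \<in> X \<Longrightarrow> S t (x + y) = S t x + S t y"
    and S_scaleR: "x \<in> X \<Longrightarrow> S t (c *\<^sub>R x) = c *\<^sub>R S t x"
    and S_bounded: "\<exists>M. \<forall>x\<in>X. norm (energy_embed (S t x)) \<le> M * norm (energy_embed x)"
    and S_zero: "x \<in> X \<Longrightarrow> S 0 x = x"
    and S_plus: "x \<in> X \<Longrightarrow> S (s + t) x = S s (S t x)"
    and S_continuous: "x \<in> X \<Longrightarrow> ((\<lambda>t. norm (energy_embed (S t x - x))) \<longlongrightarrow> 0) (at 0)"
    and S_generator: "x \<in> X \<Longrightarrow> y \<in> X \<Longrightarrow> x \<in> D \<and> y = wave_A l x \<longleftrightarrow>
        ((\<lambda>h. norm (energy_embed (inverse h *\<^sub>R (S h x - x) - y))) \<longlongrightarrow> 0) (at 0)"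
  using wave_group unfolding wave_group_def generates_group_def C0_group_on_def energy_space_norm_eq
  by blast+

lemma S_diff:
  assumes "x \<in> X" "y \<in> X"
  shows "S t (x - y) = S t x - S t y"
  using S_add[OF assms(1) subspace_scale[OF subspace_energy_space assms(2), of "-1"], of t]
    S_scaleR[OF assms(2), of t "-1"] by simp

lemma domain_subset: "x \<in> D \<Longrightarrow> x \<in> X"
  unfolding energy_space_def using HH_2_subset HH_1_subset_LL2 by auto

lemma wave_A_mem: "x \<in> D \<Longrightarrow> wave_A l x \<in> X"
  unfolding energy_space_def wave_A_def by (auto intro: wave_B_in_LL2)

text \<open>\<open>S t\<close> commutes with the difference quotients at 0, and its boundedness in
  the energy norm carries their limit at \<open>x\<close> over to \<open>S t x\<close>.\<close>

lemma S_domain: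
  assumes x: "x \<in> D"
  shows "S t x \<in> D" "wave_A l (S t x) = S t (wave_A l x)"
proof -
  note xX = domain_subset[OF x] and Ax = wave_A_mem[OF x]
  obtain M where M: "\<And>y. y \<in> X \<Longrightarrow> norm (energy_embed (S t y)) \<le> M * norm (energy_embed y)"
    using S_bounded by blast
  let ?q = "\<lambda>h. inverse h *\<^sub>R (S h x - x) - wave_A l x"
  have q: "?q h \<in> X" for h
    by (intro subspace_diff[OF subspace_energy_space] subspace_scale[OF subspace_energy_space] S_mem xX Ax)
  have eq: "inverse h *\<^sub>R (S h (S t x) - S t x) - S t (wave_A l x) = S t (?q h)" for h
  proof -
    have "S h (S t x) = S t (S h x)" using S_plus[OF xX, of h t] S_plus[OF xX, of t h] by (simp add: add.commute)
    then show ?thesis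
      by (simp add: S_diff S_scaleR S_mem xX Ax subspace_diff[OF subspace_energy_space] subspace_scale[OF subspace_energy_space])
  qed
  have "((\<lambda>h. M * norm (energy_embed (?q h))) \<longlongrightarrow> 0) (at 0)"
    using S_generator[OF xX Ax] x by (intro tendsto_mult_right_zero) blast
  then have "((\<lambda>h. norm (energy_embed (inverse h *\<^sub>R (S h (S t x) - S t x) - S t (wave_A l x)))) \<longlongrightarrow> 0) (at 0)"
    unfolding eq by (rule Lim_null_comparison[rotated]) (use M q in auto)
  then have "S t x \<in> D \<and> S t (wave_A l x) = wave_A l (S t x)"
    using S_generator[OF S_mem[OF xX] S_mem[OF Ax]] by blast
  then show "S t x \<in> D" "wave_A l (S t x) = S t (wave_A l x)" by auto
qed

text \<open>The group law moves the difference quotient at time \<open>t\<close> to time 0 for the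
  orbit starting at \<open>S t x\<close>, which is again in the domain; there the generator supplies
  the two-sided limit.\<close>

lemma orbit_has_derivative:
  assumes x: "x \<in> D"
  shows "((\<lambda>t. energy_embed (S t x)) has_vector_derivative energy_embed (wave_A l (S t x))) (at t)"
  unfolding has_vector_derivative_def has_derivative_at
proof (intro conjI bounded_linear_scaleR_left)
  let ?y = "S t x"
  note y = S_domain(1)[OF x, of t]
  note yX = domain_subset[OF y] and Ay = wave_A_mem[OF y]
  have "((\<lambda>h. norm (energy_embed (inverse h *\<^sub>R (S h ?y - ?y) - wave_A l ?y))) \<longlongrightarrow> 0) (at 0)"
    using S_generator[OF yX Ay] y by blast
  then show "(\<lambda>h. norm (energy_embed (S (t + h) x) - energy_embed ?y - h *\<^sub>R energy_embed (wave_A l ?y)) / norm h) \<midarrow>0\<rightarrow> 0"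
  proof (rule Lim_transform_eventually)
    show "\<forall>\<^sub>F h in at 0. norm (energy_embed (inverse h *\<^sub>R (S h ?y - ?y) - wave_A l ?y)) =
      norm (energy_embed (S (t + h) x) - energy_embed ?y - h *\<^sub>R energy_embed (wave_A l ?y)) / norm h"
    proof (rule eventually_at_topological[THEN iffD2], intro exI[of _ UNIV] conjI ballI impI open_UNIV UNIV_I)
      fix h :: real assume "h \<noteq> 0"
      have "S (t + h) x = S h ?y" using S_plus[OF domain_subset[OF x], of h t] by (simp add: add.commute)
      then have "energy_embed (S (t + h) x) - energy_embed ?y - h *\<^sub>R energy_embed (wave_A l ?y) =
          h *\<^sub>R (inverse h *\<^sub>R (energy_embed (S h ?y) - energy_embed ?y) - energy_embed (wave_A l ?y))"
        using \<open>h \<noteq> 0\<close> by (simp add: scaleR_diff_right)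
      also have "\<dots> = h *\<^sub>R energy_embed (inverse h *\<^sub>R (S h ?y - ?y) - wave_A l ?y)"
        by (simp add: energy_embed_diff energy_embed_scaleR S_mem yX Ay
            subspace_diff[OF subspace_energy_space] subspace_scale[OF subspace_energy_space])
      finally show "norm (energy_embed (inverse h *\<^sub>R (S h ?y - ?y) - wave_A l ?y)) =
        norm (energy_embed (S (t + h) x) - energy_embed ?y - h *\<^sub>R energy_embed (wave_A l ?y)) / norm h"
        using \<open>h \<noteq> 0\<close> by simp
    qed
  qed
qed

text \<open>Projections of the embedded orbit. The first says that the space derivative of the
  displacement is differentiable in time, with derivative the space derivative of the velocity; the
  energy argument needs this.\<close>

lemma orbit_derivatives:
  assumes x: "x \<in> D"
  shows "((\<lambda>t. wderiv l (fst (fst (S t x)))) has_vector_derivative wderiv l (fst (snd (S t x)))) (at t)"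
    and "((\<lambda>t. fst (S t x)) has_vector_derivative snd (S t x)) (at t)"
    and "((\<lambda>t. snd (S t x)) has_vector_derivative wave_B l (fst (S t x))) (at t)"
  using bounded_linear.has_vector_derivative[OF bounded_linear_fst orbit_has_derivative[OF x, of t]]
    bounded_linear.has_vector_derivative[OF bounded_linear_compose[OF bounded_linear_fst bounded_linear_snd] orbit_has_derivative[OF x, of t]]
    bounded_linear.has_vector_derivative[OF bounded_linear_compose[OF bounded_linear_snd bounded_linear_snd] orbit_has_derivative[OF x, of t]]
  by (simp_all add: energy_embed_def wave_A_def split_beta)

lemma S_mem_domain:
  assumes "x \<in> D"
  shows "fst (S t x) \<in> HH l 2" "snd (S t x) \<in> HH l 1" "fst (S t x) \<in> HH l 1"
  using S_domain(1)[OF assms, of t] HH_2_subset by (auto simp: mem_Times_iff)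

section \<open>Conserved quantities\<close>

lemma energy_conserved:
  assumes x: "x \<in> D"
  shows "wderiv l (fst (fst (S t x))) \<bullet> wderiv l (fst (fst (S t x))) + snd (S t x) \<bullet> snd (S t x) =
    wderiv l (fst (fst x)) \<bullet> wderiv l (fst (fst x)) + snd x \<bullet> snd x"
proof -
  let ?w = "\<lambda>t. wderiv l (fst (fst (S t x)))" and ?v = "\<lambda>t. snd (S t x)"
  have "((\<lambda>t. ?w t \<bullet> ?w t + ?v t \<bullet> ?v t) has_vector_derivative
      (?w t \<bullet> wderiv l (fst (snd (S t x))) + wderiv l (fst (snd (S t x))) \<bullet> ?w t) +
      (?v t \<bullet> wave_B l (fst (S t x)) + wave_B l (fst (S t x)) \<bullet> ?v t)) (at t)" for t
    by (intro has_vector_derivative_add bounded_bilinear.has_vector_derivative[OF bounded_bilinear_inner]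
        orbit_derivatives x)
  moreover have "(?w t \<bullet> wderiv l (fst (snd (S t x))) + wderiv l (fst (snd (S t x))) \<bullet> ?w t) +
      (?v t \<bullet> wave_B l (fst (S t x)) + wave_B l (fst (S t x)) \<bullet> ?v t) = 0" for t
    using inner_wave_B[OF S_mem_domain(1)[OF x, of t] S_mem_domain(2)[OF x, of t]] by (simp add: inner_commute)
  ultimately have "((\<lambda>t. ?w t \<bullet> ?w t + ?v t \<bullet> ?v t) has_real_derivative 0) (at t)" for t
    by (simp add: has_real_derivative_iff_has_vector_derivative)
  then have "?w t \<bullet> ?w t + ?v t \<bullet> ?v t = ?w 0 \<bullet> ?w 0 + ?v 0 \<bullet> ?v 0"
    by (intro DERIV_isconst_all) auto
  then show ?thesis by (simp add: S_zero domain_subset[OF x])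
qed

lemma symplectic_form_conserved:
  assumes y: "y \<in> D" and z: "z \<in> D"
  shows "fst (S t y) \<bullet> snd (S t z) - snd (S t y) \<bullet> fst (S t z) = fst y \<bullet> snd z - snd y \<bullet> fst z"
proof -
  let ?g = "\<lambda>t. fst (S t y) \<bullet> snd (S t z) - snd (S t y) \<bullet> fst (S t z)"
  have "(?g has_vector_derivative
      (fst (S t y) \<bullet> wave_B l (fst (S t z)) + snd (S t y) \<bullet> snd (S t z)) -
      (snd (S t y) \<bullet> snd (S t z) + wave_B l (fst (S t y)) \<bullet> fst (S t z))) (at t)" for t
    by (intro has_vector_derivative_diff bounded_bilinear.has_vector_derivative[OF bounded_bilinear_inner]
        orbit_derivatives y z)
  moreover have "(fst (S t y) \<bullet> wave_B l (fst (S t z)) + snd (S t y) \<bullet> snd (S t z)) -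
      (snd (S t y) \<bullet> snd (S t z) + wave_B l (fst (S t y)) \<bullet> fst (S t z)) = 0" for t
    using inner_wave_B[OF S_mem_domain(1)[OF y, of t] S_mem_domain(3)[OF z, of t]]
      inner_wave_B[OF S_mem_domain(1)[OF z, of t] S_mem_domain(3)[OF y, of t]]
    by (simp add: inner_commute)
  ultimately have "(?g has_real_derivative 0) (at t)" for t
    by (simp add: has_real_derivative_iff_has_vector_derivative)
  then have "?g t = ?g 0" by (intro DERIV_isconst_all) auto
  then show ?thesis by (simp only: S_zero[OF domain_subset[OF y]] S_zero[OF domain_subset[OF z]])
qed

section \<open>Orbits starting with zero displacement\<close>

lemma zero_pair_mem: "V \<in> LL2 l \<Longrightarrow> (0, V) \<in> X"
  unfolding energy_space_def using zero_HH_2 HH_2_subset by auto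

lemma zero_pair_domain: "V \<in> HH l 1 \<Longrightarrow> (0, V) \<in> D"
  using zero_HH_2 by auto

text \<open>On pairs \<open>(0, V)\<close> the energy norm is just \<open>norm V\<close>, so
  approximating \<open>V\<close> in the L^2 norm suffices although \<open>S t\<close> is bounded
  only in the energy norm.\<close>

lemma tendsto_S_zero_pair:
  assumes V: "\<And>n. V n \<in> LL2 l" "W \<in> LL2 l" "V \<longlonglongrightarrow> W"
  shows "(\<lambda>n. S t (0, V n)) \<longlonglongrightarrow> S t (0, W)"
proof -
  obtain M where M: "\<And>y. y \<in> X \<Longrightarrow> norm (energy_embed (S t y)) \<le> M * norm (energy_embed y)"
    using S_bounded by blast
  have "(\<lambda>n. S t (0, V n) - S t (0, W)) \<longlonglongrightarrow> 0"
  proof (rule Lim_null_comparison)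
    show "\<forall>\<^sub>F n in sequentially. norm (S t (0, V n) - S t (0, W)) \<le> M * norm (V n - W)"
    proof (intro always_eventually allI)
      fix n
      have d: "V n - W \<in> LL2 l" by (intro subspace_diff[OF subspace_LL2] V)
      have "norm (S t (0, V n) - S t (0, W)) = norm (S t (0, V n - W))"
        using S_diff[OF zero_pair_mem[OF V(1)[of n]] zero_pair_mem[OF V(2)], of t] by simp
      also have "\<dots> \<le> norm (energy_embed (S t (0, V n - W)))" by (rule norm_le_energy_embed)
      also have "\<dots> \<le> M * norm (V n - W)"
        using M[OF zero_pair_mem[OF d]] by (simp add: norm_energy_embed_0)
      finally show "norm (S t (0, V n) - S t (0, W)) \<le> M * norm (V n - W)" .
    qed
    show "(\<lambda>n. M * norm (V n - W)) \<longlonglongrightarrow> 0"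
      using V(3) by (intro tendsto_mult_right_zero tendsto_norm_zero) (simp add: LIM_zero)
  qed
  then show ?thesis by (rule LIM_zero_cancel)
qed

lemma HH_1_approximation:
  assumes "V \<in> LL2 l"
  obtains W where "\<And>n. W n \<in> HH l 1" "\<And>n. W n \<in> LL2 l" "W \<longlonglongrightarrow> V"
proof -
  from assms have "V \<in> closure (HH l 1)" using LL2_subset_closure_HH_1 by blast
  then obtain W where "\<And>n. W n \<in> HH l 1" "W \<longlonglongrightarrow> V" unfolding closure_sequential by blast
  then show ?thesis using that HH_1_subset_LL2 by blast
qed

text \<open>The initial energy is \<open>V \<bullet> V\<close>, which bounds the speed at all times.
  The displacement starts at 0, so the mean value inequality bounds it by \<open>|t|\<close> times
  the speed bound.\<close>

lemma norm_S_zero_pair_domain: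
  assumes V: "V \<in> HH l 1"
  shows "norm (snd (S t (0, V))) \<le> norm V" "norm (fst (S t (0, V))) \<le> \<bar>t\<bar> * norm V"
proof -
  note x = zero_pair_domain[OF V]
  show v: "norm (snd (S t (0, V))) \<le> norm V" for t
  proof -
    let ?w = "wderiv l (fst (fst (S t (0, V))))"
    have "?w \<bullet> ?w + snd (S t (0, V)) \<bullet> snd (S t (0, V)) = V \<bullet> V"
      using energy_conserved[OF x, of t] by (simp add: wderiv_zero)
    with inner_ge_zero[of ?w] show ?thesis unfolding norm_le by linarith
  qed
  have "norm (fst (S t (0, V)) - fst (S 0 (0, V))) \<le> norm V * norm (t - 0)"
  proof (rule differentiable_bound[OF convex_UNIV])
    show "((\<lambda>t. fst (S t (0, V))) has_derivative (\<lambda>h. h *\<^sub>R snd (S t (0, V)))) (at t within UNIV)" for t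
      using orbit_derivatives(2)[OF x] by (simp add: has_vector_derivative_def)
    show "onorm (\<lambda>h. h *\<^sub>R snd (S t (0, V))) \<le> norm V" for t
      by (rule onorm_le) (use mult_left_mono[OF v[of t] abs_ge_zero] in \<open>simp add: mult.commute\<close>)
  qed auto
  then show "norm (fst (S t (0, V))) \<le> \<bar>t\<bar> * norm V"
    by (simp add: S_zero domain_subset[OF x] mult.commute)
qed

lemma norm_S_zero_pair:
  assumes V: "V \<in> LL2 l"
  shows "norm (snd (S t (0, V))) \<le> norm V" "norm (fst (S t (0, V))) \<le> \<bar>t\<bar> * norm V"
proof -
  obtain W where W: "\<And>n. W n \<in> HH l 1" "\<And>n. W n \<in> LL2 l" "W \<longlonglongrightarrow> V"
    using HH_1_approximation[OF V] by metis
  note lim = tendsto_S_zero_pair[OF W(2) V W(3), of t]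
  show "norm (snd (S t (0, V))) \<le> norm V"
    by (rule LIMSEQ_le[OF tendsto_norm[OF tendsto_snd[OF lim]] tendsto_norm[OF W(3)]])
      (use norm_S_zero_pair_domain(1)[OF W(1)] in auto)
  show "norm (fst (S t (0, V))) \<le> \<bar>t\<bar> * norm V"
    by (rule LIMSEQ_le[OF tendsto_norm[OF tendsto_fst[OF lim]] tendsto_mult[OF tendsto_const tendsto_norm[OF W(3)]]])
      (use norm_S_zero_pair_domain(2)[OF W(1)] in auto)
qed

text \<open>The symplectic form of the orbits through \<open>S (- t) (0, V)\<close> and
  \<open>(0, W)\<close> is compared at times 0 and \<open>t\<close>. At time 0 the second
  displacement vanishes, at time \<open>t\<close> the first one does, so one product survives at
  each time.\<close>

lemma S_zero_pair_duality_domain: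
  assumes V: "V \<in> HH l 1" and W: "W \<in> HH l 1"
  shows "fst (S (- t) (0, V)) \<bullet> W = - (V \<bullet> fst (S t (0, W)))"
proof -
  note x = zero_pair_domain[OF V] and z = zero_pair_domain[OF W]
  have "S t (S (- t) (0, V)) = (0, V)"
    using S_plus[OF domain_subset[OF x], of t "- t"] S_zero[OF domain_subset[OF x]] by simp
  then show ?thesis
    using symplectic_form_conserved[OF S_domain(1)[OF x, of "- t"] z, of t] by simp
qed

lemma S_zero_pair_duality:
  assumes V: "V \<in> LL2 l" and W: "W \<in> LL2 l"
  shows "fst (S (- t) (0, V)) \<bullet> W = - (V \<bullet> fst (S t (0, W)))"
proof -
  obtain V' where V': "\<And>n. V' n \<in> HH l 1" "\<And>n. V' n \<in> LL2 l" "V' \<longlonglongrightarrow> V"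
    using HH_1_approximation[OF V] by metis
  obtain W' where W': "\<And>n. W' n \<in> HH l 1" "\<And>n. W' n \<in> LL2 l" "W' \<longlonglongrightarrow> W"
    using HH_1_approximation[OF W] by metis
  have "(\<lambda>n. fst (S (- t) (0, V' n)) \<bullet> W' n) \<longlonglongrightarrow> fst (S (- t) (0, V)) \<bullet> W"
    by (intro tendsto_inner tendsto_fst tendsto_S_zero_pair V W V' W')
  moreover have "(\<lambda>n. - (V' n \<bullet> fst (S t (0, W' n)))) \<longlonglongrightarrow> - (V \<bullet> fst (S t (0, W)))"
    by (intro tendsto_minus tendsto_inner tendsto_fst tendsto_S_zero_pair V W V' W')
  ultimately show ?thesis
    using S_zero_pair_duality_domain[OF V'(1) W'(1), of t] LIMSEQ_unique by simp
qed

lemma orbit_continuous: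
  assumes x: "x \<in> X"
  shows "continuous_on UNIV (\<lambda>t. S t x)"
  unfolding continuous_on_eq_continuous_at[OF open_UNIV]
proof
  fix t
  have "((\<lambda>h. S (t + h) x - S t x) \<longlongrightarrow> 0) (at 0)"
  proof (rule Lim_null_comparison[OF _ S_continuous[OF S_mem[OF x, of t]]])
    have "S (t + h) x = S h (S t x)" for h using S_plus[OF x, of h t] by (simp add: add.commute)
    then show "\<forall>\<^sub>F h in at 0. norm (S (t + h) x - S t x) \<le> norm (energy_embed (S h (S t x) - S t x))"
      by (simp add: norm_le_energy_embed)
  qed
  then have "((\<lambda>h. S (t + h) x) \<longlongrightarrow> S t x) (at 0)" by (rule LIM_zero_cancel)
  then show "isCont (\<lambda>t. S t x) t" by (simp add: isCont_def LIM_offset_zero_iff)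
qed

text \<open>\<open>S t\<close> is unspecified outside the energy space, while a source has its
  values there only for almost every time. Projecting the velocity first makes the integrand
  meaningful at every time without changing it almost everywhere.\<close>

definition LL2_proj :: "triple \<Rightarrow> triple" where
  "LL2_proj V = (L2_cut {0<..<l} (fst V), snd V)"

lemma bounded_linear_LL2_proj: "bounded_linear LL2_proj"
  unfolding LL2_proj_def[abs_def]
  by (intro bounded_linear_Pair bounded_linear_snd
      bounded_linear_compose[OF bounded_linear_cut bounded_linear_fst]) simp

lemma LL2_proj_mem: "LL2_proj V \<in> LL2 l"
  unfolding LL2_proj_def LL2_def by (simp add: cut_in_L2_on)

lemma LL2_proj_eq_iff: "LL2_proj V = V \<longleftrightarrow> V \<in> LL2 l"
  unfolding LL2_proj_def LL2_def by (cases V) (simp add: cut_eq_iff)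

lemma norm_LL2_proj: "norm (LL2_proj V) \<le> norm V"
  unfolding LL2_proj_def norm_prod_def
  by (intro real_sqrt_le_mono add_right_mono power_mono norm_cut_le) (simp_all add: norm_cut_le)

lemma norm_S_zero_pair_le:
  assumes V: "V \<in> LL2 l"
  shows "norm (S t (0, V)) \<le> (1 + \<bar>t\<bar>) * norm V"
  using norm_S_zero_pair[OF V, of t] norm_Pair_le[of "fst (S t (0, V))" "snd (S t (0, V))"]
  by (simp add: algebra_simps)

text \<open>Needed for the Borel measurability of the Duhamel integrand, where time and vector vary
  together. Strong continuity of a single orbit combines with an operator bound that is locally
  uniform in time.\<close>

lemma continuous_on_S_zero_proj: "continuous_on UNIV (\<lambda>(t, V). S t (0, LL2_proj V))"
  unfolding continuous_on_sequentially
proof (intro allI ballI impI, elim conjE)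
  fix Z :: "nat \<Rightarrow> real \<times> triple" and z assume "Z \<longlonglongrightarrow> z"
  then have t: "(\<lambda>n. fst (Z n)) \<longlonglongrightarrow> fst z" and v: "(\<lambda>n. LL2_proj (snd (Z n))) \<longlonglongrightarrow> LL2_proj (snd z)"
    by (auto intro: tendsto_fst tendsto_snd bounded_linear.tendsto[OF bounded_linear_LL2_proj])
  let ?v = "LL2_proj (snd z)"
  have d: "LL2_proj V - ?v \<in> LL2 l" for V
    by (intro subspace_diff[OF subspace_LL2] LL2_proj_mem)
  have eq: "S t (0, LL2_proj V) = S t (0, LL2_proj V - ?v) + S t (0, ?v)" for t V
    using S_diff[OF zero_pair_mem[OF LL2_proj_mem[of V]] zero_pair_mem[OF LL2_proj_mem[of "snd z"]], of t]
    by simp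
  have "(\<lambda>n. S (fst (Z n)) (0, LL2_proj (snd (Z n)) - ?v)) \<longlonglongrightarrow> 0"
  proof (rule Lim_null_comparison[OF always_eventually[OF allI]])
    show "norm (S (fst (Z n)) (0, LL2_proj (snd (Z n)) - ?v)) \<le> (1 + \<bar>fst (Z n)\<bar>) * norm (LL2_proj (snd (Z n)) - ?v)" for n
      by (rule norm_S_zero_pair_le[OF d])
    have "(\<lambda>n. (1 + \<bar>fst (Z n)\<bar>) * norm (LL2_proj (snd (Z n)) - ?v)) \<longlonglongrightarrow> (1 + \<bar>fst z\<bar>) * norm (?v - ?v)"
      by (intro tendsto_intros t v)
    then show "(\<lambda>n. (1 + \<bar>fst (Z n)\<bar>) * norm (LL2_proj (snd (Z n)) - ?v)) \<longlonglongrightarrow> 0" by simp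
  qed
  moreover have "(\<lambda>n. S (fst (Z n)) (0, ?v)) \<longlonglongrightarrow> S (fst z) (0, ?v)"
    using continuous_on_tendsto_compose[OF orbit_continuous[OF zero_pair_mem[OF LL2_proj_mem]] t] by simp
  ultimately have "(\<lambda>n. S (fst (Z n)) (0, LL2_proj (snd (Z n)))) \<longlonglongrightarrow> 0 + S (fst z) (0, ?v)"
    unfolding eq[of _ "snd (Z _)"] by (rule tendsto_add)
  then show "((\<lambda>(t, V). S t (0, LL2_proj V)) \<circ> Z) \<longlonglongrightarrow> (\<lambda>(t, V). S t (0, LL2_proj V)) z"
    by (simp add: comp_def split_beta)
qed

end

section \<open>Time slices and paths\<close>

text \<open>In a second countable space an open set is a countable union of balls, by the Lindelof
  property, and preimages of balls are described by distances to points.\<close>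

lemma borel_measurable_if_norm_diff:
  fixes g :: "'b \<Rightarrow> 'a::{real_normed_vector, second_countable_topology}"
  assumes [measurable]: "\<And>d. (\<lambda>t. norm (g t - d)) \<in> borel_measurable M"
  shows "g \<in> borel_measurable M"
proof (rule borel_measurableI)
  fix U :: "'a set" assume U: "open U"
  obtain \<B> where \<B>: "\<B> \<subseteq> {ball d r | d r. ball d r \<subseteq> U}" "countable \<B>" "\<Union>\<B> = \<Union>{ball d r | d r. ball d r \<subseteq> U}"
    by (rule Lindelof[of "{ball d r | d r. ball d r \<subseteq> U}"]) auto
  have "U = \<Union>{ball d r | d r. ball d r \<subseteq> U}"
    using U by (auto simp: open_contains_ball) (metis centre_in_ball)
  then have "g -` U \<inter> space M = (\<Union>B\<in>\<B>. g -` B \<inter> space M)" using \<B>(3) by auto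
  also have "\<dots> \<in> sets M"
  proof (rule sets.countable_UN'[OF \<B>(2)], safe)
    fix B assume "B \<in> \<B>"
    then obtain d r where "B = ball d r" using \<B>(1) by blast
    then have "g -` B \<inter> space M = {t \<in> space M. norm (g t - d) < r}"
      by (auto simp: dist_norm norm_minus_commute)
    also have "\<dots> \<in> sets M" by measurable
    finally show "g -` B \<inter> space M \<in> sets M" .
  qed
  finally show "g -` U \<inter> space M \<in> sets M" .
qed

text \<open>The distance of a slice to a fixed class is the root of an integral over
  \<open>x\<close> with parameter \<open>t\<close>, hence measurable in \<open>t\<close>.\<close>

lemma borel_measurable_abs_L2_slices:
  fixes f :: "real \<times> real \<Rightarrow> real"
  assumes [measurable]: "f \<in> borel_measurable borel"
    and sq: "\<And>t. square_integrable (\<lambda>x. f (t, x))"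
  shows "(\<lambda>t. abs_L2 (\<lambda>x. f (t, x))) \<in> borel_measurable borel"
proof (rule borel_measurable_if_norm_diff)
  fix d :: "real L2"
  have "norm (abs_L2 (\<lambda>x. f (t, x)) - d) = sqrt (LBINT x. (f (t, x) - rep_L2 d x)\<^sup>2)" for t
  proof -
    have "abs_L2 (\<lambda>x. f (t, x)) - d = abs_L2 (\<lambda>x. f (t, x) - rep_L2 d x)"
      using abs_L2_diff[OF sq rep_L2_square_integrable, of t d] by (simp add: abs_rep_L2)
    then show ?thesis
      by (simp add: norm_abs_L2 square_integrable_diff[OF sq rep_L2_square_integrable])
  qed
  moreover have "(\<lambda>(t, x). (f (t, x) - rep_L2 d x)\<^sup>2) \<in> borel_measurable (borel \<Otimes>\<^sub>M lborel)"
    by measurable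
  ultimately show "(\<lambda>t. norm (abs_L2 (\<lambda>x. f (t, x)) - d)) \<in> borel_measurable borel"
    by (simp add: lborel.borel_measurable_lebesgue_integral)
qed

lemma square_integrable_AE_slice:
  assumes "square_integrable (f :: real \<times> real \<Rightarrow> real)"
  shows "AE t in lborel. square_integrable (\<lambda>x. f (t, x))"
proof -
  have [measurable]: "f \<in> borel_measurable borel" using assms by (simp add: square_integrable_def)
  have "integrable (lborel \<Otimes>\<^sub>M lborel) (\<lambda>z. (f z)\<^sup>2)"
    using assms by (simp add: square_integrable_def lborel_prod)
  from lborel_pair.AE_integrable_fst'[OF this] show ?thesis
    by eventually_elim (simp add: square_integrable_def)
qed

lemma L2_slice_abs_L2:
  assumes f: "square_integrable f"
  shows "AE t in lborel. L2_slice (abs_L2 f) t = abs_L2 (\<lambda>x. f (t, x))"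
proof -
  have "AE z in lborel \<Otimes>\<^sub>M lborel. rep_L2 (abs_L2 f) z = f z"
    unfolding lborel_prod by (rule rep_abs_L2_AE[OF f])
  from lborel_pair.AE_pair[OF this] square_integrable_AE_slice[OF f]
    square_integrable_AE_slice[OF rep_L2_square_integrable[of "abs_L2 f"]]
  show ?thesis
    by eventually_elim (simp add: L2_slice_def abs_L2_eq_iff)
qed

lemma L2_slice_add: "AE t in lborel. L2_slice (F + G) t = L2_slice F t + L2_slice G t"
proof -
  note F = rep_L2_square_integrable[of F] and G = rep_L2_square_integrable[of G]
  have eq: "F + G = abs_L2 (\<lambda>z. rep_L2 F z + rep_L2 G z)"
    using abs_L2_add[OF F G] by (simp add: abs_rep_L2)
  show ?thesis
    using L2_slice_abs_L2[OF square_integrable_add[OF F G]]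
      square_integrable_AE_slice[OF F] square_integrable_AE_slice[OF G]
  proof eventually_elim
    case (elim t)
    then show ?case unfolding eq elim(1) by (simp add: L2_slice_def abs_L2_add)
  qed
qed

lemma L2_slice_diff: "AE t in lborel. L2_slice (F - G) t = L2_slice F t - L2_slice G t"
proof -
  note F = rep_L2_square_integrable[of F] and G = rep_L2_square_integrable[of G]
  have eq: "F - G = abs_L2 (\<lambda>z. rep_L2 F z - rep_L2 G z)"
    using abs_L2_diff[OF F G] by (simp add: abs_rep_L2)
  show ?thesis
    using L2_slice_abs_L2[OF square_integrable_diff[OF F G]]
      square_integrable_AE_slice[OF F] square_integrable_AE_slice[OF G]
  proof eventually_elim
    case (elim t)
    then show ?case unfolding eq elim(1) by (simp add: L2_slice_def abs_L2_diff)
  qed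
qed

lemma L2_slice_L2_on:
  assumes F: "F \<in> L2_on (A \<times> B)"
  shows "AE t in lborel. L2_slice F t \<in> L2_on B \<and> (t \<notin> A \<longrightarrow> L2_slice F t = 0)"
proof -
  have "AE z in lborel \<Otimes>\<^sub>M lborel. z \<notin> A \<times> B \<longrightarrow> rep_L2 F z = 0"
    unfolding lborel_prod by (rule L2_on_AE[OF F])
  from lborel_pair.AE_pair[OF this] square_integrable_AE_slice[OF rep_L2_square_integrable[of F]]
  show ?thesis
  proof eventually_elim
    case (elim t)
    have "AE x in lborel. x \<notin> B \<longrightarrow> rep_L2 (L2_slice F t) x = 0"
      using rep_abs_L2_AE[OF elim(2)] elim(1) unfolding L2_slice_def by eventually_elim auto
    moreover have "L2_slice F t = 0" if "t \<notin> A"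
      unfolding L2_slice_def zero_L2_def
      by (subst abs_L2_eq_iff[OF elim(2) square_integrable_0]) (use elim(1) that in \<open>auto elim: eventually_mono\<close>)
    ultimately show ?case by (auto simp: L2_on_def)
  qed
qed

text \<open>On the null set of \<open>t\<close> with a slice that is not square integrable, \<open>L2_slice\<close> is an unspecified class, so it
  need not be Borel.\<close>

definition Borel_slice :: "(real \<times> real) L2 \<Rightarrow> real \<Rightarrow> real L2" where
  "Borel_slice F t = (if square_integrable (\<lambda>x. rep_L2 F (t, x)) then L2_slice F t else 0)"

lemma Borel_slice_AE: "AE t in lborel. Borel_slice F t = L2_slice F t"
  using square_integrable_AE_slice[OF rep_L2_square_integrable[of F]]
  by eventually_elim (simp add: Borel_slice_def)

lemma Borel_slice_measurable [measurable]: "Borel_slice F \<in> borel_measurable borel"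
proof -
  let ?P = "\<lambda>t. square_integrable (\<lambda>x. rep_L2 F (t, x))"
  have P: "?P t \<longleftrightarrow> (\<integral>\<^sup>+x. ennreal ((rep_L2 F (t, x))\<^sup>2) \<partial>lborel) < \<infinity>" for t
    by (simp add: square_integrable_def integrable_iff_bounded)
  have [measurable]: "Measurable.pred borel ?P"
    unfolding P by measurable
  let ?f = "\<lambda>z. if ?P (fst z) then rep_L2 F z else 0"
  have "(\<lambda>t. abs_L2 (\<lambda>x. ?f (t, x))) \<in> borel_measurable borel"
  proof (rule borel_measurable_abs_L2_slices)
    have [measurable]: "(fst :: real \<times> real \<Rightarrow> real) \<in> borel_measurable borel"
      by (intro borel_measurable_continuous_onI continuous_intros)
    show "?f \<in> borel_measurable borel" by measurable
    show "square_integrable (\<lambda>x. ?f (t, x))" for t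
      by (cases "?P t") (auto simp: square_integrable_0)
  qed
  also have "(\<lambda>t. abs_L2 (\<lambda>x. ?f (t, x))) = Borel_slice F"
    by (auto simp: fun_eq_iff Borel_slice_def L2_slice_def zero_L2_def)
  finally show ?thesis .
qed

text \<open>Fubini: slicing preserves inner products, so classes on the plane can be handled as
  square integrable paths.\<close>

lemma inner_Borel_slice:
  shows "integrable lborel (\<lambda>t. Borel_slice F t \<bullet> Borel_slice G t)"
    and "(LBINT t. Borel_slice F t \<bullet> Borel_slice G t) = F \<bullet> G"
proof -
  have i: "integrable (lborel \<Otimes>\<^sub>M lborel) (\<lambda>z. rep_L2 F z * rep_L2 G z)"
    using square_integrable_mult[OF rep_L2_square_integrable[of F] rep_L2_square_integrable[of G]]
    by (simp add: lborel_prod)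
  have AE: "AE t in lborel. (LBINT x. rep_L2 F (t, x) * rep_L2 G (t, x)) = Borel_slice F t \<bullet> Borel_slice G t"
    using square_integrable_AE_slice[OF rep_L2_square_integrable[of F]]
      square_integrable_AE_slice[OF rep_L2_square_integrable[of G]]
    by eventually_elim (simp add: Borel_slice_def L2_slice_def inner_abs_L2)
  show "integrable lborel (\<lambda>t. Borel_slice F t \<bullet> Borel_slice G t)"
    by (rule integrable_cong_AE_imp[OF lborel_pair.integrable_fst'[OF i] _ AE]) measurable
  have "(LBINT t. Borel_slice F t \<bullet> Borel_slice G t) = (LBINT t. LBINT x. rep_L2 F (t, x) * rep_L2 G (t, x))"
    by (rule integral_cong_AE) (use AE lborel_pair.integrable_fst'[OF i] in \<open>auto elim: eventually_mono\<close>)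
  also have "\<dots> = F \<bullet> G"
    using lborel_pair.integral_fst'[OF i] by (simp add: inner_L2_rep lborel_prod)
  finally show "(LBINT t. Borel_slice F t \<bullet> Borel_slice G t) = F \<bullet> G" .
qed

lemma L2_slice_eqI:
  assumes "AE t in lborel. L2_slice F t = L2_slice G t"
  shows "F = G"
proof -
  have "AE t in lborel. Borel_slice (F - G) t \<bullet> Borel_slice (F - G) t = 0"
    using assms L2_slice_diff[of F G] Borel_slice_AE[of "F - G"] by eventually_elim simp
  then have "(F - G) \<bullet> (F - G) = (LBINT t::real. (0::real))"
    unfolding inner_Borel_slice(2)[symmetric] by (intro integral_cong_AE) auto
  then show ?thesis by simp
qed

section \<open>Paths in L^2(0,l) as elements of L^2 of the rectangle\<close>

lemma norm_le_L2_slice: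
  assumes T: "0 \<le> T" and c: "0 \<le> c"
    and AE: "AE t in lborel. norm (L2_slice F t) \<le> c * indicator {0<..<T} t"
  shows "(norm F)\<^sup>2 \<le> c\<^sup>2 * T"
proof -
  have "(norm F)\<^sup>2 = (LBINT t. Borel_slice F t \<bullet> Borel_slice F t)"
    by (simp add: inner_Borel_slice(2) power2_norm_eq_inner)
  also have "\<dots> \<le> (LBINT t. c\<^sup>2 * indicator {0<..<T} t)"
  proof (rule integral_mono_AE[OF inner_Borel_slice(1)])
    show "integrable lborel (\<lambda>t. c\<^sup>2 * indicator {0<..<T} t)"
      using emeasure_bounded_finite[of "{0<..<T}"] by simp
    show "AE t in lborel. Borel_slice F t \<bullet> Borel_slice F t \<le> c\<^sup>2 * indicator {0<..<T} t"
      using AE Borel_slice_AE[of F]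
    proof eventually_elim
      case (elim t)
      then have "(norm (Borel_slice F t))\<^sup>2 \<le> (c * indicator {0<..<T} t)\<^sup>2" by (intro power_mono) auto
      then show ?case by (cases "t \<in> {0<..<T}") (simp_all add: power2_norm_eq_inner)
    qed
  qed
  also have "\<dots> = c\<^sup>2 * T" using T by simp
  finally show ?thesis .
qed

text \<open>For a general path the chosen representatives \<open>rep_L2 (u t)\<close> need not fit
  together to a jointly measurable function. A path indexed by integers involves only countably many
  representatives, so gluing them is measurable.\<close>

lemma L2_of_step_path:
  fixes u :: "int \<Rightarrow> real L2" and \<tau> :: "real \<Rightarrow> int"
  assumes T: "0 < T" and \<tau>[measurable]: "\<tau> \<in> measurable borel (count_space UNIV)"
    and u: "\<And>k. u k \<in> L2_on {0<..<l}"
    and B: "\<And>t. t \<in> {0<..<T} \<Longrightarrow> norm (u (\<tau> t)) \<le> B"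
  obtains F where "F \<in> L2_on ({0<..<T} \<times> {0<..<l})"
    "AE t in lborel. L2_slice F t = indicator {0<..<T} t *\<^sub>R u (\<tau> t)"
proof -
  define f where "f z = indicator {0<..<T} (fst z) * rep_L2 (u (\<tau> (fst z))) (snd z)" for z :: "real \<times> real"
  have "(\<lambda>z. rep_L2 (u (\<tau> (fst z))) (snd z)) \<in> borel_measurable (borel \<Otimes>\<^sub>M borel)"
    by (rule measurable_compose_countable[where f="\<lambda>k z. rep_L2 (u k) (snd z)" and g="\<lambda>z. \<tau> (fst z)"]) measurable
  then have f': "f \<in> borel_measurable (borel \<Otimes>\<^sub>M borel)"
    unfolding f_def by measurable
  then have [measurable]: "f \<in> borel_measurable borel" by (simp add: borel_prod)
  have slice: "(\<lambda>x. f (t, x)) = (\<lambda>x. indicator {0<..<T} t * rep_L2 (u (\<tau> t)) x)" for t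
    by (simp add: f_def)
  have sq: "square_integrable (\<lambda>x. f (t, x))" for t
    unfolding slice by (rule square_integrable_scale[OF rep_L2_square_integrable])
  have ab: "abs_L2 (\<lambda>x. f (t, x)) = indicator {0<..<T} t *\<^sub>R u (\<tau> t)" for t
    unfolding slice by (simp add: abs_L2_scale[symmetric] rep_L2_square_integrable abs_rep_L2)
  have int: "(LBINT x. (f (t, x))\<^sup>2) = (norm (indicator {0<..<T} t *\<^sub>R u (\<tau> t)))\<^sup>2" for t
    unfolding ab[symmetric] by (simp add: norm_abs_L2 sq)
  have sqf: "square_integrable f"
    unfolding square_integrable_def lborel_prod[symmetric]
  proof (intro conjI)
    show "f \<in> borel_measurable (lborel \<Otimes>\<^sub>M lborel)" by (simp add: lborel_prod)
    show "integrable (lborel \<Otimes>\<^sub>M lborel) (\<lambda>z. (f z)\<^sup>2)"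
    proof (rule lborel_pair.Fubini_integrable)
      show "(\<lambda>z. (f z)\<^sup>2) \<in> borel_measurable (lborel \<Otimes>\<^sub>M lborel)" by (simp add: lborel_prod)
      show "AE t in lborel. integrable lborel (\<lambda>x. (f (t, x))\<^sup>2)"
        using sq by (simp add: square_integrable_def)
      have m: "(\<lambda>t. LBINT x. (f (t, x))\<^sup>2) \<in> borel_measurable borel"
        by (rule lborel.borel_measurable_lebesgue_integral) (use f' in measurable)
      show "integrable lborel (\<lambda>t. LBINT x. norm ((f (t, x))\<^sup>2))"
      proof (rule Bochner_Integration.integrable_bound[where f="\<lambda>t. B\<^sup>2 * indicator {0<..<T} t"])
        show "integrable lborel (\<lambda>t. B\<^sup>2 * indicator {0<..<T} t)"
          using emeasure_bounded_finite[of "{0<..<T}"] by simp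
        show "AE t in lborel. norm (LBINT x. norm ((f (t, x))\<^sup>2)) \<le> norm (B\<^sup>2 * indicator {0<..<T} t)"
        proof (intro AE_I2)
          fix t
          show "norm (LBINT x. norm ((f (t, x))\<^sup>2)) \<le> norm (B\<^sup>2 * indicator {0<..<T} t)"
            using power_mono[OF B norm_ge_zero, of t 2] by (cases "t \<in> {0<..<T}") (simp_all add: int)
        qed
      qed (use m in simp)
    qed
  qed
  have "AE t in lborel. L2_slice (abs_L2 f) t = indicator {0<..<T} t *\<^sub>R u (\<tau> t)"
    using L2_slice_abs_L2[OF sqf] by (simp add: ab)
  moreover have "abs_L2 f \<in> L2_on ({0<..<T} \<times> {0<..<l})"
  proof -
    have "AE z in lborel \<Otimes>\<^sub>M lborel. z \<notin> {0<..<T} \<times> {0<..<l} \<longrightarrow> f z = 0"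
    proof (rule lborel_pair.AE_pair_measure)
      show "{z \<in> space (lborel \<Otimes>\<^sub>M lborel). z \<notin> {0<..<T} \<times> {0<..<l} \<longrightarrow> f z = 0} \<in> sets (lborel \<Otimes>\<^sub>M lborel)"
        using f' by measurable
      show "AE t in lborel. AE x in lborel. (t, x) \<notin> {0<..<T} \<times> {0<..<l} \<longrightarrow> f (t, x) = 0"
      proof (rule AE_I2)
        fix t
        show "AE x in lborel. (t, x) \<notin> {0<..<T} \<times> {0<..<l} \<longrightarrow> f (t, x) = 0"
          using L2_on_AE[OF u[of "\<tau> t"]] by eventually_elim (auto simp: f_def)
      qed
    qed
    then have "AE z in lborel. z \<notin> {0<..<T} \<times> {0<..<l} \<longrightarrow> f z = 0" unfolding lborel_prod .
    with rep_abs_L2_AE[OF sqf] show ?thesis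
      unfolding L2_on_def mem_Collect_eq by eventually_elim simp
  qed
  ultimately show ?thesis using that by blast
qed

lemma rectangle_in_borel: "{a<..<b} \<times> {c<..<d} \<in> sets (borel :: (real \<times> real) measure)"
  by (intro borel_open open_Times open_greaterThanLessThan)

text \<open>Step paths sampling \<open>u\<close> on finer and finer grids converge uniformly on
  (0,T), so their classes form a Cauchy sequence. The slices of the limit are identified by showing
  that their mean square distance to \<open>u\<close> is zero.\<close>

lemma L2_path_exists:
  fixes u :: "real \<Rightarrow> real L2"
  assumes T: "0 < T" and u: "continuous_on UNIV u" and ul: "\<And>t. u t \<in> L2_on {0<..<l}"
  obtains F where "F \<in> L2_on ({0<..<T} \<times> {0<..<l})"
    "AE t in lborel. L2_slice F t = indicator {0<..<T} t *\<^sub>R u t"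
proof -
  let ?ind = "indicator {0<..<T} :: real \<Rightarrow> real"
  have cu: "continuous_on {0..T} u" using u continuous_on_subset by blast
  \<comment> \<open>Rounds \<open>t\<close> down to the grid of mesh \<open>T / Suc n\<close>; for
    \<open>t\<close> in (0,T) the result stays in [0,T].\<close>
  define s where "s n t = T * of_int \<lfloor>real (Suc n) * t / T\<rfloor> / real (Suc n)" for n t
  have s: "s n t \<in> {0..T}" "\<bar>s n t - t\<bar> \<le> T / real (Suc n)" if t: "t \<in> {0<..<T}" for n t
  proof -
    let ?x = "real (Suc n) * t / T"
    have x: "0 \<le> ?x" "T * ?x / real (Suc n) = t" using t T by auto
    have "s n t \<le> T * ?x / real (Suc n)"
      unfolding s_def using T by (intro divide_right_mono mult_left_mono) auto
    then have le: "s n t \<le> t" by (simp only: x)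
    have "T * (?x - 1) / real (Suc n) \<le> s n t"
      unfolding s_def using T by (intro divide_right_mono mult_left_mono) linarith+
    then have ge: "t - T / real (Suc n) \<le> s n t"
      using x(2) by (simp only: right_diff_distrib diff_divide_distrib mult_1_right)
    have "0 \<le> s n t" unfolding s_def using T x(1) by (intro divide_nonneg_nonneg mult_nonneg_nonneg) auto
    then show "s n t \<in> {0..T}" "\<bar>s n t - t\<bar> \<le> T / real (Suc n)"
      using le ge t by auto
  qed
  obtain B where B: "\<And>t. t \<in> {0..T} \<Longrightarrow> norm (u t) \<le> B"
    using compact_imp_bounded[OF compact_continuous_image[OF cu compact_Icc]]
    unfolding bounded_iff by blast
  have "\<exists>F. F \<in> L2_on ({0<..<T} \<times> {0<..<l}) \<and> (AE t in lborel. L2_slice F t = ?ind t *\<^sub>R u (s n t))" for n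
  proof -
    obtain F where "F \<in> L2_on ({0<..<T} \<times> {0<..<l})"
      "AE t in lborel. L2_slice F t = ?ind t *\<^sub>R u (T * of_int \<lfloor>real (Suc n) * t / T\<rfloor> / real (Suc n))"
    proof (rule L2_of_step_path[OF T, of "\<lambda>t. \<lfloor>real (Suc n) * t / T\<rfloor>"
          "\<lambda>k. u (T * of_int k / real (Suc n))" l B])
      show "(\<lambda>t. \<lfloor>real (Suc n) * t / T\<rfloor>) \<in> measurable borel (count_space UNIV)" by measurable
      show "norm (u (T * of_int \<lfloor>real (Suc n) * t / T\<rfloor> / real (Suc n))) \<le> B" if "t \<in> {0<..<T}" for t
        using B[OF s(1)[OF that, of n]] unfolding s_def .
    qed (use ul in auto)
    then show ?thesis unfolding s_def by blast
  qed
  then obtain F where F: "\<And>n. F n \<in> L2_on ({0<..<T} \<times> {0<..<l})"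
    "\<And>n. AE t in lborel. L2_slice (F n) t = ?ind t *\<^sub>R u (s n t)" by metis
  have conv: "\<exists>N. \<forall>n\<ge>N. \<forall>t\<in>{0<..<T}. norm (u (s n t) - u t) \<le> e" if e: "0 < e" for e
  proof -
    obtain d where d: "0 < d" "\<And>x y. x \<in> {0..T} \<Longrightarrow> y \<in> {0..T} \<Longrightarrow> dist y x < d \<Longrightarrow> dist (u y) (u x) < e"
      using compact_uniformly_continuous[OF cu compact_Icc] e unfolding uniformly_continuous_on_def by metis
    obtain N :: nat where N: "T / d < real N" using reals_Archimedean2 by blast
    have "norm (u (s n t) - u t) \<le> e" if n: "n \<ge> N" and t: "t \<in> {0<..<T}" for n t
    proof -
      have "T / d < real (Suc n)" using N n by linarith
      then have "T / real (Suc n) < d" using d(1) by (simp add: field_simps)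
      then have "dist (s n t) t < d" using s(2)[OF t, of n] by (simp add: dist_real_def)
      then show ?thesis using d(2)[of t "s n t"] s(1)[OF t, of n] t by (simp add: dist_norm)
    qed
    then show ?thesis by blast
  qed
  have "Cauchy F"
  proof (rule CauchyI)
    fix e :: real assume e: "0 < e"
    \<comment> \<open>Two step paths differ by at most \<open>2 * e'\<close> on (0,T), and
      \<open>(2 * e')^2 * T\<close> equals \<open>(e / 2)^2\<close>.\<close>
    define e' where "e' = e / (4 * sqrt T)"
    have e': "0 < e'" using e T by (simp add: e'_def)
    obtain N where N: "\<And>n t. n \<ge> N \<Longrightarrow> t \<in> {0<..<T} \<Longrightarrow> norm (u (s n t) - u t) \<le> e'"
      using conv[OF e'] by blast
    have "norm (F m - F n) < e" if mn: "m \<ge> N" "n \<ge> N" for m n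
    proof -
      have "(norm (F m - F n))\<^sup>2 \<le> (2 * e')\<^sup>2 * T"
      proof (rule norm_le_L2_slice)
        show "AE t in lborel. norm (L2_slice (F m - F n) t) \<le> (2 * e') * ?ind t"
          using F(2)[of m] F(2)[of n] L2_slice_diff[of "F m" "F n"]
        proof eventually_elim
          case (elim t)
          show ?case
          proof (cases "t \<in> {0<..<T}")
            case True
            have "norm (u (s m t) - u (s n t)) \<le> 2 * e'"
              using N[OF mn(1) True] N[OF mn(2) True] norm_triangle_ineq4[of "u (s m t) - u t" "u (s n t) - u t"] by simp
            then show ?thesis using True elim by simp
          qed (use elim in simp)
        qed
      qed (use T e' in auto)
      also have "\<dots> = (e / 2)\<^sup>2" using T by (simp add: e'_def power_mult_distrib power_divide)
      finally have "norm (F m - F n) \<le> e / 2" by (rule power2_le_imp_le) (use e in simp)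
      then show ?thesis using e by simp
    qed
    then show "\<exists>M. \<forall>m\<ge>M. \<forall>n\<ge>M. norm (F m - F n) < e" by blast
  qed
  then obtain G where G: "F \<longlonglongrightarrow> G" using Cauchy_convergent_iff convergent_def by blast
  have G_on: "G \<in> L2_on ({0<..<T} \<times> {0<..<l})"
    by (rule closed_sequentially[OF closed_L2_on[OF rectangle_in_borel] F(1) G])
  have [measurable]: "u \<in> borel_measurable borel" by (rule borel_measurable_continuous_onI[OF u])
  let ?d = "\<lambda>t. ?ind t * (norm (Borel_slice G t - u t))\<^sup>2"
  have "(\<integral>\<^sup>+t. ennreal (?d t) \<partial>lborel) \<le> 0"
  proof (rule ennreal_le_epsilon)
    fix r :: real assume r: "0 < r"
    \<comment> \<open>The square of a sum is at most twice the sum of squares; this \<open>e\<close>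
      and the distance \<open>sqrt (r / 4)\<close> to the limit each contribute at most
      \<open>r / 2\<close>.\<close>
    define e where "e = sqrt (r / (4 * T))"
    have e: "0 < e" "2 * e\<^sup>2 * T = r / 2" using r T by (simp_all add: e_def)
    obtain N where N: "\<And>n t. n \<ge> N \<Longrightarrow> t \<in> {0<..<T} \<Longrightarrow> norm (u (s n t) - u t) \<le> e"
      using conv[OF e(1)] by blast
    obtain N' where N': "\<And>n. n \<ge> N' \<Longrightarrow> norm (F n - G) < sqrt (r / 4)"
      using LIMSEQ_D[OF G, of "sqrt (r / 4)"] r by auto
    define n where "n = max N N'"
    let ?H = "G - F n"
    have "norm ?H \<le> sqrt (r / 4)" using N'[of n] by (simp add: n_def norm_minus_commute less_imp_le)
    from power_mono[OF this norm_ge_zero, of 2] have H: "?H \<bullet> ?H \<le> r / 4"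
      using r by (simp add: power2_norm_eq_inner)
    let ?b = "\<lambda>t. 2 * (Borel_slice ?H t \<bullet> Borel_slice ?H t) + 2 * e\<^sup>2 * ?ind t"
    have i: "integrable lborel ?b"
      using inner_Borel_slice(1)[of ?H ?H] emeasure_bounded_finite[of "{0<..<T}"] by simp
    have "(\<integral>\<^sup>+t. ennreal (?d t) \<partial>lborel) \<le> (\<integral>\<^sup>+t. ennreal (?b t) \<partial>lborel)"
    proof (rule nn_integral_mono_AE)
      show "AE t in lborel. ennreal (?d t) \<le> ennreal (?b t)"
        using F(2)[of n] Borel_slice_AE[of G] Borel_slice_AE[of ?H] L2_slice_diff[of G "F n"]
      proof eventually_elim
        case (elim t)
        show ?case
        proof (cases "t \<in> {0<..<T}")
          case True
          let ?x = "norm (Borel_slice ?H t)"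
          have eq: "Borel_slice G t - u t = Borel_slice ?H t + (u (s n t) - u t)" using elim True by simp
          have "norm (u (s n t) - u t) \<le> e" using N[of n t] True by (simp add: n_def)
          then have "norm (Borel_slice G t - u t) \<le> ?x + e"
            unfolding eq using norm_triangle_ineq[of "Borel_slice ?H t" "u (s n t) - u t"] by linarith
          then have "(norm (Borel_slice G t - u t))\<^sup>2 \<le> (?x + e)\<^sup>2" by (intro power_mono) auto
          also have "\<dots> \<le> 2 * ?x\<^sup>2 + 2 * e\<^sup>2"
            using zero_le_power2[of "?x - e"] by (simp add: power2_sum power2_diff)
          finally show ?thesis using True by (intro ennreal_leI) (simp add: power2_norm_eq_inner)
        qed simp
      qed
    qed
    also have "\<dots> = ennreal (LBINT t. ?b t)"
      by (rule nn_integral_eq_integral[OF i]) (auto simp: indicator_def)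
    also have "(LBINT t. ?b t) = 2 * (?H \<bullet> ?H) + 2 * e\<^sup>2 * T"
      using inner_Borel_slice[of ?H ?H] emeasure_bounded_finite[of "{0<..<T}"] T by simp
    also have "\<dots> \<le> r" using H e(2) by simp
    finally show "(\<integral>\<^sup>+t. ennreal (?d t) \<partial>lborel) \<le> 0 + ennreal r" by (simp add: ennreal_leI)
  qed
  then have zero: "(\<integral>\<^sup>+t. ennreal (?d t) \<partial>lborel) = 0" by (simp only: le_zero_eq)
  have m: "(\<lambda>t. ennreal (?d t)) \<in> borel_measurable lborel" by measurable
  have "AE t in lborel. ennreal (?d t) = 0"
    using zero unfolding nn_integral_0_iff_AE[OF m] .
  moreover note Borel_slice_AE[of G] L2_slice_L2_on[OF G_on]
  ultimately have "AE t in lborel. L2_slice G t = ?ind t *\<^sub>R u t"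
  proof eventually_elim
    case (elim t)
    then show ?case by (cases "t \<in> {0<..<T}") auto
  qed
  with G_on show ?thesis by (rule that)
qed

lemma L2_of_path:
  fixes u :: "real \<Rightarrow> real L2"
  assumes T: "0 < T" and u: "continuous_on UNIV u" and ul: "\<And>t. u t \<in> L2_on {0<..<l}"
  shows "L2_of_path T l u \<in> L2_on ({0<..<T} \<times> {0<..<l})"
    and "AE t in lborel. L2_slice (L2_of_path T l u) t = indicator {0<..<T} t *\<^sub>R u t"
proof -
  let ?P = "\<lambda>F. F \<in> L2_on ({0<..<T} \<times> {0<..<l}) \<and> (AE t in lborel. t \<in> {0<..<T} \<longrightarrow> L2_slice F t = u t)"
  have slices: "AE t in lborel. L2_slice F t = indicator {0<..<T} t *\<^sub>R u t" if "?P F" for F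
    using conjunct2[OF that] L2_slice_L2_on[OF conjunct1[OF that]]
    by eventually_elim (auto simp: indicator_def)
  obtain F where F: "F \<in> L2_on ({0<..<T} \<times> {0<..<l})"
    "AE t in lborel. L2_slice F t = indicator {0<..<T} t *\<^sub>R u t"
    by (rule L2_path_exists[OF T u ul])
  have "?P F" using F by (auto elim: eventually_mono)
  moreover have "G = F" if "?P G" for G
  proof (rule L2_slice_eqI)
    show "AE t in lborel. L2_slice G t = L2_slice F t"
      using slices[OF that] F(2) by eventually_elim simp
  qed
  ultimately have "?P (L2_of_path T l u)" unfolding L2_of_path_def by (rule theI)
  then show "L2_of_path T l u \<in> L2_on ({0<..<T} \<times> {0<..<l})"
    and "AE t in lborel. L2_slice (L2_of_path T l u) t = indicator {0<..<T} t *\<^sub>R u t"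
    using slices by blast+
qed

section \<open>The forced problem and its adjoint\<close>

text \<open>Every subset of a null set is measurable for the completion, so preimages under
  \<open>g\<close> are corrected preimages under \<open>f\<close>. This handles the unspecified
  values of the source on a null set of times.\<close>

lemma borel_measurable_completion_AE:
  assumes f: "f \<in> borel_measurable M" and eq: "AE x in M. f x = g x"
  shows "g \<in> borel_measurable (completion M)"
proof (rule measurableI)
  fix A :: "'b set" assume A: "A \<in> sets borel"
  have [measurable]: "Measurable.pred (completion M) (\<lambda>x. f x \<noteq> g x)"
    "Measurable.pred (completion M) (\<lambda>x. g x \<in> A \<and> f x \<noteq> g x)"
    by (rule sets_completion_AE, use eq in \<open>auto elim: eventually_mono\<close>)+
  have [measurable]: "Measurable.pred (completion M) (\<lambda>x. f x \<in> A)"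
    using measurable_completion[OF f] A by measurable
  have "g -` A \<inter> space (completion M) =
      {x \<in> space (completion M). f x \<in> A \<and> \<not> f x \<noteq> g x \<or> g x \<in> A \<and> f x \<noteq> g x}"
    by auto
  also have "\<dots> \<in> sets (completion M)" by measurable
  finally show "g -` A \<inter> space (completion M) \<in> sets (completion M)" .
qed simp

definition source_triple :: "(real \<times> real) L2 \<times> real L2 \<Rightarrow> real \<Rightarrow> triple" where
  "source_triple W s = (Borel_slice (fst W) s, rep_L2 (snd W) s, 0)"

lemma source_triple_measurable [measurable]: "source_triple W \<in> borel_measurable borel"
  unfolding source_triple_def[abs_def] by (intro borel_measurable_Pair) measurable

lemma source_triple_AE: "AE s in lborel. source W s = (0, source_triple W s)"
  using Borel_slice_AE[of "fst W"]
  by eventually_elim (simp add: source_def source_triple_def split_beta zero_prod_def)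

lemma source_triple_add: "AE s in lborel. source_triple (W + V) s = source_triple W s + source_triple V s"
  using Borel_slice_AE[of "fst (W + V)"] Borel_slice_AE[of "fst W"] Borel_slice_AE[of "fst V"]
    L2_slice_add[of "fst W" "fst V"] rep_L2_add[of "snd W" "snd V"]
  by eventually_elim (simp add: source_triple_def)

lemma source_triple_LL2:
  assumes "W \<in> LL2T T l"
  shows "AE s in lborel. source_triple W s \<in> LL2 l"
proof -
  have "fst W \<in> L2_on ({0<..<T} \<times> {0<..<l})" using assms by (auto simp: LL2T_def)
  from L2_slice_L2_on[OF this] Borel_slice_AE[of "fst W"] show ?thesis
    by eventually_elim (simp add: source_triple_def LL2_def)
qed

lemma norm_source_triple:
  shows "square_integrable (\<lambda>s. norm (source_triple W s))"
    and "(LBINT s. (norm (source_triple W s))\<^sup>2) = (norm W)\<^sup>2"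
proof -
  have eq: "(norm (source_triple W s))\<^sup>2 = Borel_slice (fst W) s \<bullet> Borel_slice (fst W) s + (rep_L2 (snd W) s)\<^sup>2" for s
    unfolding power2_norm_eq_inner source_triple_def by (simp add: inner_prod_def power2_eq_square)
  have i: "integrable lborel (\<lambda>s. (rep_L2 (snd W) s)\<^sup>2)"
    using rep_L2_square_integrable by (simp add: square_integrable_def)
  show "square_integrable (\<lambda>s. norm (source_triple W s))"
    unfolding square_integrable_def eq using inner_Borel_slice(1) i by simp
  show "(LBINT s. (norm (source_triple W s))\<^sup>2) = (norm W)\<^sup>2"
    unfolding eq using inner_Borel_slice[of "fst W" "fst W"] i
    by (simp add: norm_L2_rep[symmetric] power2_norm_eq_inner inner_prod_def)
qed

lemma subspace_LL2T: "subspace (LL2T T l)"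
  unfolding LL2T_def by (intro subspace_Times subspace_L2_on rectangle_in_borel) simp

section \<open>The map from sources to final displacements\<close>

context wave_flow
begin

text \<open>A Borel version of the integrand of \<open>mild\<close> at time \<open>T\<close>; for
  \<open>W\<close> in \<open>LL2T T l\<close> both agree almost everywhere.\<close>

definition duhamel :: "real \<Rightarrow> (real \<times> real) L2 \<times> real L2 \<Rightarrow> real \<Rightarrow> triple \<times> triple" where
  "duhamel T W s = S (T - s) (0, LL2_proj (source_triple W s))"

lemma duhamel_measurable [measurable]: "duhamel T W \<in> borel_measurable borel"
proof -
  have [measurable]: "(\<lambda>(t, V). S t (0, LL2_proj V)) \<in> borel_measurable borel"
    by (rule borel_measurable_continuous_onI[OF continuous_on_S_zero_proj])
  have "(\<lambda>s. (T - s, source_triple W s)) \<in> borel_measurable borel"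
    by (intro borel_measurable_Pair) measurable
  from measurable_compose[OF this \<open>(\<lambda>(t, V). S t (0, LL2_proj V)) \<in> borel_measurable borel\<close>]
  show ?thesis unfolding duhamel_def[abs_def] by simp
qed

lemma norm_duhamel:
  shows "norm (duhamel T W s) \<le> (1 + \<bar>T - s\<bar>) * norm (source_triple W s)"
    and "norm (fst (duhamel T W s)) \<le> \<bar>T - s\<bar> * norm (source_triple W s)"
  unfolding duhamel_def
  by (rule order_trans[OF norm_S_zero_pair_le[OF LL2_proj_mem]] order_trans[OF norm_S_zero_pair(2)[OF LL2_proj_mem]],
      rule mult_left_mono[OF norm_LL2_proj], simp)+

lemma integrable_norm_source_triple:
  "integrable lborel (\<lambda>s. indicator {0..T} s * norm (source_triple W s))"
  by (rule square_integrable_mult[OF _ norm_source_triple(1)], rule square_integrable_indicator, simp)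
    (rule emeasure_bounded_finite, simp)

lemma integrable_duhamel:
  assumes T: "0 < T"
  shows "integrable lborel (\<lambda>s. indicator {0..T} s *\<^sub>R duhamel T W s)"
proof (rule Bochner_Integration.integrable_bound)
  show "integrable lborel (\<lambda>s. (1 + T) * (indicator {0..T} s * norm (source_triple W s)))"
    using integrable_norm_source_triple by simp
  show "AE s in lborel. norm (indicator {0..T} s *\<^sub>R duhamel T W s)
      \<le> norm ((1 + T) * (indicator {0..T} s * norm (source_triple W s)))"
  proof (rule AE_I2)
    fix s
    show "norm (indicator {0..T} s *\<^sub>R duhamel T W s)
      \<le> norm ((1 + T) * (indicator {0..T} s * norm (source_triple W s)))"
    proof (cases "s \<in> {0..T}")
      case True
      then have "(1 + \<bar>T - s\<bar>) * norm (source_triple W s) \<le> (1 + T) * norm (source_triple W s)"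
        by (intro mult_right_mono) auto
      with norm_duhamel(1)[of T W s] show ?thesis using True T by (simp add: abs_mult)
    qed simp
  qed
qed measurable

text \<open>The operator \<open>K\<close> of the overview.\<close>

definition forced :: "real \<Rightarrow> (real \<times> real) L2 \<times> real L2 \<Rightarrow> triple" where
  "forced T W = (LBINT s. indicator {0..T} s *\<^sub>R fst (duhamel T W s))"

lemma fst_integral_duhamel:
  assumes T: "0 < T"
  shows "fst (LBINT s. indicator {0..T} s *\<^sub>R duhamel T W s) = forced T W"
  unfolding forced_def
  using integral_bounded_linear[OF bounded_linear_fst integrable_duhamel[OF T], of W] by simp

lemma integrable_fst_duhamel:
  assumes T: "0 < T"
  shows "integrable lborel (\<lambda>s. indicator {0..T} s *\<^sub>R fst (duhamel T W s))"
  using integrable_bounded_linear[OF bounded_linear_fst integrable_duhamel[OF T], of W] by simp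

text \<open>The Lebesgue integral in \<open>mild\<close> is replaced by a Borel integral of an
  almost everywhere equal function; taking the first component commutes with the Bochner
  integral.\<close>

lemma final_state_eq:
  assumes T: "0 < T" and W: "W \<in> LL2T T l"
  shows "final_state S T Z W = fst (S T Z) + forced T W"
proof -
  let ?f = "\<lambda>s. indicator {0..T} s *\<^sub>R duhamel T W s"
  have m: "?f \<in> borel_measurable lborel" by measurable
  have AE: "AE s in lborel. ?f s = indicator {0..T} s *\<^sub>R S (T - s) (source W s)"
    using source_triple_AE[of W] source_triple_LL2[OF W]
    by eventually_elim (simp add: duhamel_def LL2_proj_eq_iff[THEN iffD2])
  have "(LINT s:{0..T}|lebesgue. S (T - s) (source W s)) = (LINT s|lebesgue. ?f s)"
    unfolding set_lebesgue_integral_def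
    using borel_measurable_completion_AE[OF m AE] measurable_completion[OF m] AE_completion[OF AE]
    by (intro integral_cong_AE) (auto elim: eventually_mono)
  also have "\<dots> = (LBINT s. ?f s)" by (rule integral_completion[OF m])
  finally show ?thesis
    by (simp add: final_state_def mild_def fst_integral_duhamel[OF T])
qed

lemma forced_add:
  assumes T: "0 < T"
  shows "forced T (W + V) = forced T W + forced T V"
proof -
  have "forced T (W + V) = (LBINT s. indicator {0..T} s *\<^sub>R fst (duhamel T W s) + indicator {0..T} s *\<^sub>R fst (duhamel T V s))"
    unfolding forced_def
  proof (rule integral_cong_AE)
    show "AE s in lborel. indicator {0..T} s *\<^sub>R fst (duhamel T (W + V) s) =
        indicator {0..T} s *\<^sub>R fst (duhamel T W s) + indicator {0..T} s *\<^sub>R fst (duhamel T V s)"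
      using source_triple_add[of W V]
    proof eventually_elim
      case (elim s)
      have "duhamel T (W + V) s = duhamel T W s + duhamel T V s"
        unfolding duhamel_def elim
        by (subst S_add[symmetric])
          (simp_all add: zero_pair_mem LL2_proj_mem linear_add[OF bounded_linear.linear[OF bounded_linear_LL2_proj]])
      then show ?case by (simp add: scaleR_add_right)
    qed
  qed (use integrable_fst_duhamel[OF T] in auto)
  also have "\<dots> = forced T W + forced T V"
    unfolding forced_def using integrable_fst_duhamel[OF T] by (intro Bochner_Integration.integral_add)
  finally show ?thesis .
qed

text \<open>\<open>LL2_proj\<close> fixes the integrand pointwise and, being bounded linear,
  commutes with the integral.\<close>

lemma forced_LL2:
  assumes T: "0 < T"
  shows "forced T W \<in> LL2 l"
proof -
  have "LL2_proj (fst (duhamel T W s)) = fst (duhamel T W s)" for s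
    using S_mem[OF zero_pair_mem[OF LL2_proj_mem]] HH_1_subset_LL2
    unfolding LL2_proj_eq_iff duhamel_def energy_space_def mem_Times_iff by blast
  then have "LL2_proj (forced T W) = forced T W"
    unfolding forced_def
    using integral_bounded_linear[OF bounded_linear_LL2_proj integrable_fst_duhamel[OF T], of W]
    by (simp add: linear_scale[OF bounded_linear.linear[OF bounded_linear_LL2_proj]])
  then show ?thesis by (simp add: LL2_proj_eq_iff)
qed

text \<open>Bounding \<open>T - s\<close> by \<open>T\<close> gives the factor \<open>T\<close>;
  Cauchy-Schwarz against the indicator of [0,T] gives \<open>sqrt T\<close>.\<close>

lemma norm_forced:
  assumes T: "0 < T"
  shows "norm (forced T W) \<le> T * sqrt T * norm W"
proof -
  let ?n = "\<lambda>s. norm (source_triple W s)" and ?i = "indicator {0..T} :: real \<Rightarrow> real"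
  have si: "square_integrable ?i"
    by (rule square_integrable_indicator, simp) (rule emeasure_bounded_finite, simp)
  have "norm (forced T W) \<le> (LBINT s. T * (?i s * ?n s))"
    unfolding forced_def
  proof (rule Bochner_Integration.integral_norm_bound_integral)
    show "integrable lborel (\<lambda>s. indicator {0..T} s *\<^sub>R fst (duhamel T W s))" by (rule integrable_fst_duhamel[OF T])
    show "integrable lborel (\<lambda>s. T * (?i s * ?n s))" using integrable_norm_source_triple by simp
    fix s
    show "norm (indicator {0..T} s *\<^sub>R fst (duhamel T W s)) \<le> T * (?i s * ?n s)"
    proof (cases "s \<in> {0..T}")
      case True
      then have "\<bar>T - s\<bar> * ?n s \<le> T * ?n s" by (intro mult_right_mono) auto
      with norm_duhamel(2)[of T W s] show ?thesis using True by simp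
    qed simp
  qed
  also have "\<dots> = T * (abs_L2 ?i \<bullet> abs_L2 ?n)"
    using inner_abs_L2[OF si norm_source_triple(1)[of W]] by simp
  also have "\<dots> \<le> T * (norm (abs_L2 ?i) * norm (abs_L2 ?n))"
    using T by (intro mult_left_mono norm_cauchy_schwarz) auto
  also have "norm (abs_L2 ?n) = norm W"
    by (simp add: norm_abs_L2[OF norm_source_triple(1)] norm_source_triple(2))
  also have "norm (abs_L2 ?i) = sqrt T"
  proof -
    have "(\<lambda>s. (?i s)\<^sup>2) = ?i" by (auto simp: indicator_def fun_eq_iff)
    then show ?thesis using T by (simp add: norm_abs_L2[OF si])
  qed
  finally show ?thesis by simp
qed

section \<open>The adjoint problem\<close>

definition adjoint_solution :: "real \<Rightarrow> triple \<Rightarrow> real \<Rightarrow> triple" where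
  "adjoint_solution T R t = fst (S (t - T) (0, - R))"

text \<open>The adjoint of \<open>K\<close> applied to \<open>R\<close>, with \<open>R\<close> in
  the role of the residual, as \<open>inner_adjoint_control\<close> shows.\<close>

definition adjoint_control :: "real \<Rightarrow> triple \<Rightarrow> (real \<times> real) L2 \<times> real L2" where
  "adjoint_control T R = (L2_of_path T l (\<lambda>t. fst (adjoint_solution T R t)),
     abs_L2 (\<lambda>t. indicator {0<..<T} t * fst (snd (adjoint_solution T R t))))"

lemma adjoint_gradient_eq: "adjoint_gradient S T l Z Yd W = adjoint_control T (final_state S T Z W - Yd)"
  by (simp add: adjoint_gradient_def adjoint_control_def adjoint_state_def adjoint_solution_def)

context
  fixes T :: real and R :: triple
  assumes T: "0 < T" and R: "R \<in> LL2 l"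
begin

lemma adjoint_solution_LL2: "adjoint_solution T R t \<in> LL2 l"
  using S_mem[OF zero_pair_mem[OF subspace_neg[OF subspace_LL2 R]]] HH_1_subset_LL2
  unfolding adjoint_solution_def energy_space_def mem_Times_iff by blast

lemma adjoint_solution_continuous: "continuous_on UNIV (adjoint_solution T R)"
  unfolding adjoint_solution_def[abs_def]
  by (intro continuous_on_fst continuous_on_compose2[OF orbit_continuous[OF zero_pair_mem[OF subspace_neg[OF subspace_LL2 R]]]]
      continuous_intros subset_UNIV)

lemma adjoint_control_facts:
  shows "fst (adjoint_control T R) \<in> L2_on ({0<..<T} \<times> {0<..<l})"
    and "AE t in lborel. L2_slice (fst (adjoint_control T R)) t = indicator {0<..<T} t *\<^sub>R fst (adjoint_solution T R t)"
    and "square_integrable (\<lambda>t. indicator {0<..<T} t * fst (snd (adjoint_solution T R t)))"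
proof -
  have 1: "continuous_on UNIV (\<lambda>t. fst (adjoint_solution T R t))"
    by (intro continuous_on_fst adjoint_solution_continuous)
  have 2: "fst (adjoint_solution T R t) \<in> L2_on {0<..<l}" for t
    using adjoint_solution_LL2[of t] by (auto simp: LL2_def)
  show "fst (adjoint_control T R) \<in> L2_on ({0<..<T} \<times> {0<..<l})"
    and "AE t in lborel. L2_slice (fst (adjoint_control T R)) t = indicator {0<..<T} t *\<^sub>R fst (adjoint_solution T R t)"
    unfolding adjoint_control_def fst_conv using L2_of_path[OF T 1 2] by blast+
  show "square_integrable (\<lambda>t. indicator {0<..<T} t * fst (snd (adjoint_solution T R t)))"
    by (rule square_integrable_indicator_continuous)
      (intro continuous_on_fst continuous_on_snd continuous_on_subset[OF adjoint_solution_continuous], simp)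
qed

lemma adjoint_control_LL2T: "adjoint_control T R \<in> LL2T T l"
  unfolding LL2T_def mem_Times_iff
  using adjoint_control_facts(1) abs_L2_indicator_mem[OF _ square_integrable_indicator_continuous]
proof (intro conjI)
  have sq: "square_integrable (\<lambda>t. indicator {0<..<T} t * fst (snd (adjoint_solution T R t)))"
    by (rule adjoint_control_facts(3))
  show "snd (adjoint_control T R) \<in> L2_on {0<..<T}"
    unfolding L2_on_def mem_Collect_eq adjoint_control_def snd_conv
    using rep_abs_L2_AE[OF sq] by eventually_elim simp
qed

text \<open>The duality of displacements is applied under the time integral with time
  \<open>T - s\<close>; its minus sign cancels the one in the terminal velocity
  \<open>- R\<close>.\<close>

lemma inner_adjoint_control:
  assumes W: "W \<in> LL2T T l"
  shows "adjoint_control T R \<bullet> W = R \<bullet> forced T W"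
proof -
  let ?p = "adjoint_solution T R" and ?g = "adjoint_control T R"
  have sq: "square_integrable (\<lambda>t. indicator {0<..<T} t * fst (snd (?p t)))"
    by (rule adjoint_control_facts(3))
  have "R \<bullet> forced T W = (LBINT s. R \<bullet> (indicator {0..T} s *\<^sub>R fst (duhamel T W s)))"
    unfolding forced_def
    using integral_bounded_linear[OF bounded_linear_inner_right integrable_fst_duhamel[OF T], of R W] by simp
  also have "\<dots> = (LBINT s. Borel_slice (fst ?g) s \<bullet> Borel_slice (fst W) s +
      (indicator {0<..<T} s * fst (snd (?p s))) * rep_L2 (snd W) s)"
  proof (rule integral_cong_AE)
    show "(\<lambda>s. R \<bullet> (indicator {0..T} s *\<^sub>R fst (duhamel T W s))) \<in> borel_measurable lborel"
      using integrable_bounded_linear[OF bounded_linear_inner_right integrable_fst_duhamel[OF T], of R W] by auto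
    show "(\<lambda>s. Borel_slice (fst ?g) s \<bullet> Borel_slice (fst W) s +
      (indicator {0<..<T} s * fst (snd (?p s))) * rep_L2 (snd W) s) \<in> borel_measurable lborel"
    proof -
      have [measurable]: "(\<lambda>t. indicator {0<..<T} t * fst (snd (?p t))) \<in> borel_measurable borel"
        using sq by (simp add: square_integrable_def)
      show ?thesis by measurable
    qed
    show "AE s in lborel. R \<bullet> (indicator {0..T} s *\<^sub>R fst (duhamel T W s)) =
        Borel_slice (fst ?g) s \<bullet> Borel_slice (fst W) s +
        (indicator {0<..<T} s * fst (snd (?p s))) * rep_L2 (snd W) s"
      \<comment> \<open>The times 0 and \<open>T\<close> are excluded because \<open>forced\<close>
        integrates over the closed interval and \<open>adjoint_control\<close> lives on the open
        one.\<close>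
      using source_triple_LL2[OF W] Borel_slice_AE[of "fst ?g"] adjoint_control_facts(2)
        AE_lborel_singleton[of 0] AE_lborel_singleton[of T]
    proof eventually_elim
      case (elim s)
      have "S (s - T) (0, - R) = - S (s - T) (0, R)"
        using S_scaleR[OF zero_pair_mem[OF R], of "s - T" "-1"] by simp
      then have "?p s \<bullet> source_triple W s = - (fst (S (- (T - s)) (0, R)) \<bullet> source_triple W s)"
        by (simp add: adjoint_solution_def)
      also have "\<dots> = R \<bullet> fst (duhamel T W s)"
        using S_zero_pair_duality[OF R elim(1), of "T - s"] elim(1)
        by (simp add: duhamel_def LL2_proj_eq_iff[THEN iffD2])
      finally have "R \<bullet> fst (duhamel T W s) = ?p s \<bullet> source_triple W s" ..
      also have "\<dots> = fst (?p s) \<bullet> Borel_slice (fst W) s + fst (snd (?p s)) * rep_L2 (snd W) s"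
        by (simp add: source_triple_def inner_prod_def)
      finally show ?case
        using elim by (cases "s \<in> {0<..<T}") (auto simp: indicator_def)
    qed
  qed
  also have "\<dots> = (LBINT s. Borel_slice (fst ?g) s \<bullet> Borel_slice (fst W) s) +
      (LBINT s. (indicator {0<..<T} s * fst (snd (?p s))) * rep_L2 (snd W) s)"
    by (rule Bochner_Integration.integral_add[OF inner_Borel_slice(1)
          square_integrable_mult[OF sq rep_L2_square_integrable]])
  also have "\<dots> = ?g \<bullet> W"
    unfolding inner_Borel_slice(2) inner_abs_L2_left[OF sq, symmetric]
    by (simp add: inner_prod_def adjoint_control_def)
  finally show ?thesis ..
qed

end

text \<open>The adjoint inherits the norm bound of \<open>forced\<close>: pair the difference with
  itself, move it to the other side by \<open>inner_adjoint_control\<close>, apply Cauchy-Schwarz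
  and divide by its norm.\<close>

lemma norm_adjoint_control_diff:
  assumes T: "0 < T" and R: "R \<in> LL2 l" "Q \<in> LL2 l"
  shows "norm (adjoint_control T R - adjoint_control T Q) \<le> T * sqrt T * norm (R - Q)"
proof -
  let ?d = "adjoint_control T R - adjoint_control T Q"
  have d: "?d \<in> LL2T T l"
    by (intro subspace_diff[OF subspace_LL2T] adjoint_control_LL2T T R)
  have "norm ?d * norm ?d = ?d \<bullet> ?d" by (simp add: dot_square_norm power2_eq_square)
  also have "\<dots> = (R - Q) \<bullet> forced T ?d"
    using inner_adjoint_control[OF T R(1) d] inner_adjoint_control[OF T R(2) d]
    by (simp add: inner_diff_left)
  also have "\<dots> \<le> norm (R - Q) * norm (forced T ?d)" by (rule norm_cauchy_schwarz)
  also have "\<dots> \<le> norm (R - Q) * (T * sqrt T * norm ?d)"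
    by (intro mult_left_mono norm_forced T) simp
  finally have "norm ?d * norm ?d \<le> (T * sqrt T * norm (R - Q)) * norm ?d" by (simp add: mult_ac)
  then show ?thesis
    using T by (cases "norm ?d = 0") (simp_all add: mult_le_cancel_right)
qed

end

section \<open>Comparison of constants and conclusion\<close>

lemma lipschitz_constant_bound:
  fixes T l :: real
  assumes "0 < T" "0 < l"
  shows "T ^ 3 \<le> sqrt (3 * T ^ 4 * (l + (l + 2) / l * T\<^sup>2))"
proof (rule real_le_rsqrt)
  \<comment> \<open>The quotient \<open>(l + 2) / l\<close> is at least 1, so the term with
    \<open>T^6\<close> alone already dominates the square of \<open>T^3\<close>.\<close>
  have "T\<^sup>2 \<le> (l + 2) / l * T\<^sup>2"
    using assms mult_right_mono[of 1 "(l + 2) / l" "T\<^sup>2"] by simp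
  then have "T\<^sup>2 \<le> l + (l + 2) / l * T\<^sup>2" using assms by linarith
  then have "T ^ 4 * T\<^sup>2 \<le> T ^ 4 * (l + (l + 2) / l * T\<^sup>2)" by (intro mult_left_mono) simp_all
  moreover have "(T ^ 3)\<^sup>2 = T ^ 4 * T\<^sup>2" by (simp add: power_add[symmetric] flip: power_mult)
  moreover have "0 \<le> T ^ 4 * T\<^sup>2" by simp
  ultimately show "(T ^ 3)\<^sup>2 \<le> 3 * T ^ 4 * (l + (l + 2) / l * T\<^sup>2)" by linarith
qed

theorem lemma3p4:
  fixes T l F_lo F_hi G_lo G_hi :: real
    and S :: "real \<Rightarrow> triple \<times> triple \<Rightarrow> triple \<times> triple"
    and Y0 Y1 Yd :: triple
  assumes "T > 0" and "l > 0"
    and "F_lo \<le> F_hi" and "G_lo \<le> G_hi"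
    and "wave_group l S"
    and "(Y0, Y1) \<in> energy_space l"
    and "Yd \<in> LL2 l"
  shows "(\<forall>W\<in>LL2T T l. frechet_gradient_on (LL2T T l) (cost S T (Y0, Y1) Yd) W
             (adjoint_gradient S T l (Y0, Y1) Yd W)) \<and>
         0 < sqrt (3 * T ^ 4 * (l + (l + 2) / l * T\<^sup>2)) \<and>
         (\<forall>W dW. W \<in> admissible T l F_lo F_hi G_lo G_hi \<longrightarrow>
             W + dW \<in> admissible T l F_lo F_hi G_lo G_hi \<longrightarrow>
             norm (adjoint_gradient S T l (Y0, Y1) Yd (W + dW) -
                   adjoint_gradient S T l (Y0, Y1) Yd W)
               \<le> sqrt (3 * T ^ 4 * (l + (l + 2) / l * T\<^sup>2)) * norm dW)"
proof -
  interpret wave_flow l S by unfold_locales fact+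
  note T = \<open>T > 0\<close>
  let ?Z = "(Y0, Y1)" and ?c = "T * sqrt T" and ?L = "sqrt (3 * T ^ 4 * (l + (l + 2) / l * T\<^sup>2))"
  define R where "R W = final_state S T ?Z W - Yd" for W
  have c: "?c * ?c = T ^ 3" using T by (simp add: power3_eq_cube)
  have R: "R W \<in> LL2 l" if "W \<in> LL2T T l" for W
  proof -
    have "fst (S T ?Z) \<in> HH l 1"
      using S_mem[OF \<open>?Z \<in> energy_space l\<close>] unfolding energy_space_def mem_Times_iff by blast
    then show ?thesis
      unfolding R_def final_state_eq[OF T that]
      using HH_1_subset_LL2 assms(7)
      by (intro subspace_diff[OF subspace_LL2] subspace_add[OF subspace_LL2] forced_LL2 T) auto
  qed
  have R_add: "R (W + H) = R W + forced T H" if "W \<in> LL2T T l" "H \<in> LL2T T l" for W H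
    unfolding R_def
    by (simp add: final_state_eq[OF T] that subspace_add[OF subspace_LL2T] forced_add[OF T])
  have grad: "adjoint_gradient S T l ?Z Yd W = adjoint_control T (R W)" for W
    by (simp add: adjoint_gradient_eq R_def)
  have "frechet_gradient_on (LL2T T l) (cost S T ?Z Yd) W (adjoint_gradient S T l ?Z Yd W)"
    if W: "W \<in> LL2T T l" for W
    unfolding frechet_gradient_on_def grad has_derivative_within
  proof (intro conjI bounded_linear_inner_right adjoint_control_LL2T[OF T R[OF W]])
    let ?g = "adjoint_control T (R W)"
    \<comment> \<open>The cost is quadratic, so its remainder after the linear term is exactly half
      the squared norm of \<open>forced T (V - W)\<close>, which is of second order in
      \<open>V - W\<close>.\<close>
    have "norm ((1 / norm (V - W)) *\<^sub>R (cost S T ?Z Yd V - (cost S T ?Z Yd W + ?g \<bullet> (V - W))))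
        \<le> T ^ 3 * norm (V - W)" if V: "V \<in> LL2T T l" for V
    proof -
      let ?H = "V - W"
      have H: "?H \<in> LL2T T l" by (intro subspace_diff[OF subspace_LL2T] V W)
      have "R V = R W + forced T ?H" using R_add[OF W H] by simp
      then have "(norm (R V))\<^sup>2 = (norm (R W))\<^sup>2 + 2 * (R W \<bullet> forced T ?H) + (norm (forced T ?H))\<^sup>2"
        unfolding power2_norm_eq_inner by (simp add: inner_add_left inner_add_right inner_commute)
      then have "cost S T ?Z Yd V - (cost S T ?Z Yd W + ?g \<bullet> ?H) = 1 / 2 * (norm (forced T ?H))\<^sup>2"
        unfolding cost_def R_def[symmetric] inner_adjoint_control[OF T R[OF W] H] by linarith
      moreover have "(norm (forced T ?H))\<^sup>2 \<le> T ^ 3 * (norm ?H)\<^sup>2"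
      proof -
        have "(norm (forced T ?H))\<^sup>2 \<le> (?c * norm ?H)\<^sup>2"
          by (rule power_mono[OF norm_forced[OF T] norm_ge_zero])
        also have "\<dots> = (?c * ?c) * (norm ?H)\<^sup>2" by (simp only: power2_eq_square mult_ac)
        finally show ?thesis by (simp only: c)
      qed
      ultimately have "\<bar>cost S T ?Z Yd V - (cost S T ?Z Yd W + ?g \<bullet> ?H)\<bar> \<le> T ^ 3 * (norm ?H)\<^sup>2"
        using zero_le_power2[of "norm (forced T ?H)"] by linarith
      then have "1 / norm ?H * \<bar>cost S T ?Z Yd V - (cost S T ?Z Yd W + ?g \<bullet> ?H)\<bar>
          \<le> 1 / norm ?H * (T ^ 3 * (norm ?H)\<^sup>2)"
        by (rule mult_left_mono) simp
      \<comment> \<open>For \<open>?H = 0\<close> both sides are 0, because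
        \<open>1 / 0 = 0\<close>; the bound thus holds at \<open>V = W\<close> too.\<close>
      also have "\<dots> = T ^ 3 * norm ?H"
        by (cases "?H = 0") (simp_all add: power2_eq_square)
      finally show ?thesis by (simp only: real_norm_def real_scaleR_def abs_mult abs_divide abs_one abs_norm_cancel)
    qed
    then have ev: "\<forall>\<^sub>F V in at W within LL2T T l.
        norm ((1 / norm (V - W)) *\<^sub>R (cost S T ?Z Yd V - (cost S T ?Z Yd W + ?g \<bullet> (V - W)))) \<le> T ^ 3 * norm (V - W)"
      by (simp add: eventually_at_filter)
    have "((\<lambda>V. T ^ 3 * norm (V - W)) \<longlongrightarrow> T ^ 3 * norm (W - W)) (at W within LL2T T l)"
      by (intro tendsto_intros)
    then have "((\<lambda>V. T ^ 3 * norm (V - W)) \<longlongrightarrow> 0) (at W within LL2T T l)" by simp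
    with ev show "((\<lambda>V. (1 / norm (V - W)) *\<^sub>R (cost S T ?Z Yd V - (cost S T ?Z Yd W + ?g \<bullet> (V - W)))) \<longlongrightarrow> 0)
        (at W within LL2T T l)"
      by (rule Lim_null_comparison)
  qed
  moreover have "0 < ?L"
    using lipschitz_constant_bound[OF T \<open>l > 0\<close>] zero_less_power[OF T, of 3] by linarith
  moreover have "norm (adjoint_gradient S T l ?Z Yd (W + dW) - adjoint_gradient S T l ?Z Yd W) \<le> ?L * norm dW"
    if "W \<in> admissible T l F_lo F_hi G_lo G_hi" "W + dW \<in> admissible T l F_lo F_hi G_lo G_hi" for W dW
  proof -
    have W: "W \<in> LL2T T l" "W + dW \<in> LL2T T l" using that by (auto simp: admissible_def)
    from subspace_diff[OF subspace_LL2T W(2,1)] have dW: "dW \<in> LL2T T l" by simp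
    \<comment> \<open>The initial data and the datum cancel in the difference of residuals, so
      \<open>forced\<close> and its adjoint each contribute one factor
      \<open>T * sqrt T\<close>.\<close>
    have "norm (adjoint_gradient S T l ?Z Yd (W + dW) - adjoint_gradient S T l ?Z Yd W)
        \<le> ?c * norm (R (W + dW) - R W)"
      unfolding grad by (rule norm_adjoint_control_diff[OF T R[OF W(2)] R[OF W(1)]])
    also have "\<dots> = ?c * norm (forced T dW)" by (simp add: R_add[OF W(1) dW])
    also have "\<dots> \<le> ?c * (?c * norm dW)" using T by (intro mult_left_mono norm_forced) simp_all
    also have "\<dots> = T ^ 3 * norm dW" by (simp only: c[symmetric] mult.assoc)
    also have "\<dots> \<le> ?L * norm dW"
      by (intro mult_right_mono lipschitz_constant_bound T \<open>l > 0\<close>) simp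
    finally show ?thesis .
  qed
  ultimately show ?thesis by blast
qed

end
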